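(* $$\lim_{X\to\infty}\frac{\sum_{0<n<X,\ n \text{ squarefree}} \#\mathcal{F}^{3n,\mathrm{sol}}_{2n^2}}{\sum_{0<n<X,\ n\text{ squarefree}} \#\mathcal{F}^{3n,\mathrm{ls}}_{2n^2}} =\lim_{X\to\infty}\frac{\sum_{0<n<X,\ n \text{ squarefree}} \#\mathcal{F}^{-3n,\mathrm{sol}}_{2n^2}}{\sum_{0<n<X,\ n\text{ squarefree}} \#\mathcal{F}^{-3n,\mathrm{ls}}_{2n^2}}= 0.$$
   Context: For integers $B,M$, $W^B_M(\mathbb{Z})$ is the set of binary quartic forms $ax^4+Bx^2y^2+cy^4$ with $a,c\in\mathbb{Z}$, $ac=M$, and $\mathcal{F}^B_M=\{ax^4+Bx^2y^2+cy^4\in W^B_M(\mathbb{Z}): 0\le\operatorname{ord}_pa\le1 \text{ for all primes } p\}$. A form $f$ is locally soluble if for every place $v$ of $\mathbb{Q}$ there are $x,y,z\in\mathbb{Q}_v$, $(x,y)\ne(0,0)$, with $z^2=f(x,y)$; it is soluble if such $x,y,z$ exist in $\mathbb{Q}$. $\mathcal{F}^{B,\mathrm{ls}}_M$ and $\mathcal{F}^{B,\mathrm{sol}}_M$ denote the locally soluble and soluble elements of $\mathcal{F}^B_M$. *)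

theory Defs
  imports "HOL-Analysis.Analysis" "HOL-Number_Theory.Number_Theory" "HOL-Computational_Algebra.Squarefree"
begin

definition quartic :: "int \<Rightarrow> int \<Rightarrow> int \<Rightarrow> 'a::comm_ring_1 \<Rightarrow> 'a \<Rightarrow> 'a" where
  "quartic a B c x y = of_int a * x ^ 4 + of_int B * x ^ 2 * y ^ 2 + of_int c * y ^ 4"

text \<open>The family F^B_M, a form a x^4 + B x^2 y^2 + c y^4 being identified with its
  coefficient pair (a,c) (B fixed). The condition 0 <= ord_p a <= 1 for all p
  means a is a nonzero integer with multiplicity at most 1 at every prime.\<close>
definition formsF :: "int \<Rightarrow> int \<Rightarrow> (int \<times> int) set" where
  "formsF B M = {(a, c). a * c = M \<and> a \<noteq> 0 \<and>
      (\<forall>p::int. prime p \<longrightarrow> multiplicity p a \<le> 1)}"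

text \<open>p-adic integers, as the inverse limit of Z/p^k Z: compatible sequences of residues.\<close>
definition padic_int :: "int \<Rightarrow> (nat \<Rightarrow> int) \<Rightarrow> bool" where
  "padic_int p x \<longleftrightarrow> (\<forall>k. 0 \<le> x k \<and> x k < p ^ k \<and> x (Suc k) mod p ^ k = x k)"

text \<open>Solubility over Q_p. By homogeneity (scale x,y by p^m and z by p^(2m)), a Q_p-solution
  with (x,y) nonzero exists iff a Z_p-solution with (x,y) nonzero exists (z^2 in Z_p forces
  z in Z_p). A Z_p-solution is an equation in the inverse limit, i.e. a congruence mod p^k
  for every k.\<close>
definition soluble_Qp :: "int \<Rightarrow> int \<Rightarrow> int \<Rightarrow> int \<Rightarrow> bool" where
  "soluble_Qp p a B c \<longleftrightarrow> (\<exists>x y z. padic_int p x \<and> padic_int p y \<and> padic_int p z \<and>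
      \<not> (\<forall>k. x k = 0 \<and> y k = 0) \<and>
      (\<forall>k. [z k ^ 2 = quartic a B c (x k) (y k)] (mod p ^ k)))"

definition soluble_R :: "int \<Rightarrow> int \<Rightarrow> int \<Rightarrow> bool" where
  "soluble_R a B c \<longleftrightarrow> (\<exists>x y z :: real. (x, y) \<noteq> (0, 0) \<and> z ^ 2 = quartic a B c x y)"

definition locally_soluble :: "int \<Rightarrow> int \<Rightarrow> int \<Rightarrow> bool" where
  "locally_soluble a B c \<longleftrightarrow> soluble_R a B c \<and> (\<forall>p::int. prime p \<longrightarrow> soluble_Qp p a B c)"

definition soluble :: "int \<Rightarrow> int \<Rightarrow> int \<Rightarrow> bool" where
  "soluble a B c \<longleftrightarrow> (\<exists>x y z :: rat. (x, y) \<noteq> (0, 0) \<and> z ^ 2 = quartic a B c x y)"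

definition formsF_ls :: "int \<Rightarrow> int \<Rightarrow> (int \<times> int) set" where
  "formsF_ls B M = {(a, c) \<in> formsF B M. locally_soluble a B c}"

definition formsF_sol :: "int \<Rightarrow> int \<Rightarrow> (int \<times> int) set" where
  "formsF_sol B M = {(a, c) \<in> formsF B M. soluble a B c}"

end

theory Submission
  imports Defs "HOL-Real_Asymp.Real_Asymp"
begin

text \<open>With \<open>N = \<plusminus>n\<close>, a form \<open>a x^4 + 3 N x\<^sup>2 y\<^sup>2 + c y^4\<close> with \<open>a c = 2 N\<^sup>2\<close> satisfies
  \<open>a f = (a x\<^sup>2 + N y\<^sup>2) (a x\<^sup>2 + 2 N y\<^sup>2)\<close>. A rational point on \<open>z\<^sup>2 = f\<close> gives, besides \<open>a\<close>, the
  squarefree part \<open>b\<close> of the first factor, and the pair \<open>(a, b)\<close> satisfies Legendre symbol conditions at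
  every odd prime dividing \<open>n\<close>. As in Heath-Brown's treatment of Selmer groups of congruent number
  curves, the number of such pairs is expanded into a sum, over factorizations of the odd part of \<open>n\<close>
  into 16 factors, of products of Jacobi symbols. If two of the factors that exceed a power of
  \<open>log x\<close> are joined by a single Jacobi symbol, then a bilinear estimate bounds the contribution.
  Otherwise at most four factors are large, and the remaining twelve are small. Hence the soluble
  forms with \<open>n < x\<close> number at most \<open>O (x (log log x)^16)\<close>.

  Local solubility imposes no condition at a prime \<open>p \<equiv> 3, 5 (mod 8)\<close>: if \<open>p\<close> does not divide \<open>a\<close>,
  one of \<open>a\<close> and \<open>2 a\<close> is a square modulo \<open>p\<close>, and similarly otherwise. So the number of locally
  soluble forms is at least a quarter of \<open>2\<close> to the number of those primes dividing \<open>n\<close>, and the sum of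
  these powers of two over squarefree \<open>n < x\<close> exceeds \<open>x (log log x)^17\<close> up to a constant.\<close>

section \<open>Jacobi symbols and bilinear sums\<close>

text \<open>For soluble forms an upper bound up to powers of log log x is enough, and this decides
  the method: a factor below the threshold is never analysed, only summed trivially, at the cost of
  one log log x each. The number four comes from a balance. Expanding the indicator
  \<open>(1 + sym1) * (1 + sym2) / 4\<close> at every prime gives each tuple the weight 4^(-omega),
  while a squarefree l has k^omega(l) ordered factorizations into k parts. Hence up to four large
  factors contribute O(x), whereas five would contribute a power of log x. The threshold has to be a
  large power of log x, because the saving for a linked pair is only its 16th root and must offset
  all logarithms lost on the way. On the locally soluble side the sum of the powers of two has the
  order x (log x)^(1/2), far more than the exponent 17 requires. This leaves room for crude
  reciprocal sums of primes, with the constant 1/3 in place of the density 1/2 of the primes 3, 5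
  modulo 8.\<close>

lemma Legendre_cong: "[a = b] (mod p) \<Longrightarrow> Legendre a p = Legendre b p"
  unfolding Legendre_def QuadRes_def cong_def by simp

lemma Legendre_values: "Legendre a p \<in> {-1, 0, 1}"
  by (auto simp: Legendre_def)

lemma Legendre_eq_0_iff: "Legendre a p = 0 \<longleftrightarrow> p dvd a"
  by (auto simp: Legendre_def cong_0_iff)

text \<open>Euler's criterion makes both sides congruent modulo \<open>p\<close>, and two values in
  {-1, 0, 1} differ by at most 2 < p.\<close>

lemma Legendre_mult:
  assumes "prime p" "2 < p"
  shows "Legendre (a * b) (int p) = Legendre a (int p) * Legendre b (int p)"
proof -
  have "[Legendre (a * b) (int p) = (a * b) ^ ((p - 1) div 2)] (mod int p)"
    using euler_criterion assms by blast
  moreover have "[Legendre a (int p) * Legendre b (int p)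
      = a ^ ((p - 1) div 2) * b ^ ((p - 1) div 2)] (mod int p)"
    using euler_criterion assms by (intro cong_mult) blast+
  ultimately have "[Legendre (a * b) (int p) = Legendre a (int p) * Legendre b (int p)] (mod int p)"
    by (metis cong_sym cong_trans power_mult_distrib)
  then have "int p dvd Legendre (a * b) (int p) - Legendre a (int p) * Legendre b (int p)"
    by (simp add: cong_iff_dvd_diff)
  moreover have "\<bar>Legendre (a * b) (int p) - Legendre a (int p) * Legendre b (int p)\<bar> < int p"
    using Legendre_values[of "a * b" p] Legendre_values[of a p] Legendre_values[of b p] assms by auto
  ultimately show ?thesis
    using dvd_imp_le_int[of "Legendre (a * b) (int p) - Legendre a (int p) * Legendre b (int p)" "int p"]
    by linarith
qed

lemma Legendre_square:
  assumes "prime p" "\<not> p dvd a" shows "Legendre (a ^ 2) p = 1"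
proof -
  have "QuadRes p (a ^ 2)" unfolding QuadRes_def by (intro exI[of _ a]) simp
  then show ?thesis using assms by (auto simp: Legendre_def cong_0_iff dest: prime_dvd_power)
qed

text \<open>Since \<open>w\<close> and \<open>p - w\<close> have the same square, the nonzero
  squares are already the squares of \<open>1..(p - 1) div 2\<close>; these are too few to fill all
  \<open>p - 1\<close> nonzero classes.\<close>

lemma ex_Legendre_minus1:
  assumes "prime p" "2 < p"
  shows "\<exists>g. Legendre g (int p) = -1"
proof (rule ccontr)
  assume no: "\<nexists>g. Legendre g (int p) = -1"
  have "{1..<int p} \<subseteq> (\<lambda>y. y ^ 2 mod int p) ` {1..(int p - 1) div 2}"
  proof
    fix g assume g: "g \<in> {1..<int p}"
    then have "\<not> int p dvd g" using zdvd_not_zless by auto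
    with no have "QuadRes (int p) g" by (auto simp: Legendre_def cong_0_iff split: if_splits)
    then obtain y where y: "[y ^ 2 = g] (mod int p)" by (auto simp: QuadRes_def)
    define z where "z = y mod int p"
    have z: "[z ^ 2 = g] (mod int p)" "0 \<le> z" "z < int p"
      using y assms by (auto simp: z_def cong_def power_mod)
    have "z \<noteq> 0" using z g \<open>\<not> int p dvd g\<close>
      by (metis cong_0_iff cong_sym power2_eq_square mult_zero_left)
    have odd: "odd p" using assms prime_odd_nat by blast
    define w where "w = (if z \<le> (int p - 1) div 2 then z else int p - z)"
    have w: "w \<in> {1..(int p - 1) div 2}"
    proof -
      obtain h where h: "p = 2 * h + 1" using odd by (elim oddE)
      show ?thesis using z \<open>z \<noteq> 0\<close> unfolding w_def h by (auto split: if_splits)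
    qed
    have "[w ^ 2 = g] (mod int p)"
    proof (cases "z \<le> (int p - 1) div 2")
      case False
      have "(int p - z) ^ 2 = z ^ 2 + int p * (int p - 2 * z)"
        by (simp add: power2_eq_square algebra_simps)
      then show ?thesis using False z unfolding w_def cong_def by simp
    qed (use z in \<open>simp add: w_def\<close>)
    then have "w ^ 2 mod int p = g" using g by (simp add: cong_def)
    then show "g \<in> (\<lambda>y. y ^ 2 mod int p) ` {1..(int p - 1) div 2}" using w by blast
  qed
  then have "card {1..<int p} \<le> card {1..(int p - 1) div 2}"
    by (meson card_image_le card_mono finite_atLeastAtMost_int finite_imageI le_trans)
  then show False using assms by simp
qed

text \<open>The Jacobi symbol, in the form valid for squarefree lower argument.\<close>

definition jac :: "int \<Rightarrow> nat \<Rightarrow> int" where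
  "jac a n = (\<Prod>p\<in>prime_factors n. Legendre a (int p))"

lemma jac_cong:
  assumes "[a = b] (mod int n)" shows "jac a n = jac b n"
proof -
  have "Legendre a (int p) = Legendre b (int p)" if "p \<in> prime_factors n" for p
    using that assms by (intro Legendre_cong) (meson cong_dvd_modulus in_prime_factors_imp_dvd of_nat_dvd_iff)
  then show ?thesis by (simp add: jac_def)
qed

lemma jac_prime: "prime p \<Longrightarrow> jac a p = Legendre a (int p)"
  by (simp add: jac_def prime_factorization_prime)

lemma odd_prime_factor_gt_2: "odd n \<Longrightarrow> p \<in> prime_factors n \<Longrightarrow> 2 < p" for p n :: nat
  by (metis in_prime_factors_iff dvd_trans le_neq_implies_less prime_ge_2_nat)

lemma jac_mult_left:
  assumes "odd n" shows "jac (a * b) n = jac a n * jac b n"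
proof -
  have "Legendre (a * b) (int p) = Legendre a (int p) * Legendre b (int p)" if "p \<in> prime_factors n" for p
    using that assms odd_prime_factor_gt_2 by (intro Legendre_mult) auto
  then show ?thesis by (simp add: jac_def prod.distrib)
qed

lemma jac_one_left: assumes "odd n" shows "jac 1 n = 1"
proof -
  have "Legendre 1 (int p) = 1" if "p \<in> prime_factors n" for p
    using that assms by (auto simp: Legendre_def QuadRes_def cong_def in_prime_factors_iff intro!: exI[of _ 1])
  then show ?thesis by (simp add: jac_def)
qed

lemma jac_prod_left: "odd n \<Longrightarrow> jac (\<Prod>i\<in>I. f i) n = (\<Prod>i\<in>I. jac (f i) n)"
  by (induction I rule: infinite_finite_induct) (auto simp: jac_one_left jac_mult_left)

lemma abs_jac_le_1: "\<bar>jac a n\<bar> \<le> 1"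
proof -
  have "\<bar>jac a n\<bar> = (\<Prod>p\<in>prime_factors n. \<bar>Legendre a (int p)\<bar>)" by (simp add: jac_def abs_prod)
  also have "\<dots> \<le> (\<Prod>p\<in>prime_factors n. 1)" using Legendre_values by (intro prod_mono) (auto simp: Legendre_def)
  finally show ?thesis by simp
qed

lemma jac_eq_0:
  assumes "n > 0" "\<not> coprime a (int n)" shows "jac a n = 0"
proof -
  have "\<not> is_unit (gcd a (int n))" using assms by (simp add: coprime_iff_gcd_eq_1)
  moreover have "gcd a (int n) \<noteq> 0" using assms by simp
  ultimately obtain p where "prime p" "p dvd gcd a (int n)" using prime_divisor_exists by blast
  then have p: "prime p" "p dvd a" "p dvd int n" by auto
  define q where "q = nat p"
  have q: "p = int q" "prime q" using p prime_gt_0_int[of p] by (simp_all add: q_def)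
  then have "q \<in> prime_factors n" using p assms by (simp add: in_prime_factors_iff)
  moreover have "Legendre a (int q) = 0" using p q by (simp add: Legendre_eq_0_iff)
  ultimately show ?thesis unfolding jac_def by (meson finite_set_mset prod_zero_iff)
qed

lemma jac_values:
  assumes "n > 0" "coprime a (int n)" shows "jac a n \<in> {-1, 1}"
proof -
  have "Legendre a (int p) \<in> {-1,1}" if "p \<in> prime_factors n" for p
  proof -
    have "\<not> int p dvd a" using that assms
      by (metis coprime_common_divisor in_prime_factors_iff int_dvd_int_iff not_prime_unit of_nat_1 prime_nat_int_transfer)
    then show ?thesis by (simp add: Legendre_def cong_0_iff)
  qed
  moreover have "(\<Prod>p\<in>A. f p) \<in> {-1, 1}" if "\<forall>p\<in>A. f p \<in> {-1, 1}"
    for A and f :: "nat \<Rightarrow> int"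
    using that by (induction A rule: infinite_finite_induct) auto
  ultimately show ?thesis unfolding jac_def by simp
qed

text \<open>Orthogonality in its simplest form: multiplication by \<open>g\<close> permutes the
  residues modulo \<open>q\<close> and reverses the sign of every value, so the sum equals its own
  negative.\<close>

lemma sum_period_zero:
  fixes \<psi> :: "nat \<Rightarrow> 'a::{idom, ring_char_0}"
  assumes q: "q > 0"
    and per: "\<And>a b. [a = b] (mod q) \<Longrightarrow> \<psi> a = \<psi> b"
    and mult: "\<And>a. \<psi> (g * a) = - \<psi> a"
    and g: "coprime g q"
  shows "(\<Sum>k<q. \<psi> k) = 0"
proof -
  have inj: "inj_on (\<lambda>k. (g * k) mod q) {..<q}"
  proof (rule inj_onI)
    fix a b assume ab: "a \<in> {..<q}" "b \<in> {..<q}" "(g * a) mod q = (g * b) mod q"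
    then have "[g * a = g * b] (mod q)" by (simp add: cong_def)
    then have "[a = b] (mod q)" using g by (simp add: cong_mult_lcancel_nat)
    then show "a = b" using ab by (simp add: cong_def)
  qed
  have "(\<lambda>k. (g * k) mod q) ` {..<q} = {..<q}"
    using inj q by (intro card_subset_eq) (auto simp: card_image)
  then have "bij_betw (\<lambda>k. (g * k) mod q) {..<q} {..<q}" using inj by (simp add: bij_betw_def)
  then have "(\<Sum>k<q. \<psi> k) = (\<Sum>k<q. \<psi> ((g * k) mod q))"
    using sum.reindex_bij_betw[of "\<lambda>k. (g * k) mod q" "{..<q}" "{..<q}" \<psi>] by simp
  also have "\<dots> = (\<Sum>k<q. - \<psi> k)"
  proof (intro sum.cong refl)
    fix k show "\<psi> ((g * k) mod q) = - \<psi> k"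
      using per[of "(g * k) mod q" "g * k"] mult[of k] by (simp add: cong_def)
  qed
  also have "\<dots> = - (\<Sum>k<q. \<psi> k)" by (simp add: sum_negf)
  finally show ?thesis by (metis eq_neg_iff_add_eq_0 mult_2 mult_eq_0_iff zero_neq_numeral)
qed

text \<open>Complete periods cancel, and fewer than \<open>q\<close> terms of absolute value at most
  1 remain.\<close>

lemma sum_period_bound:
  fixes \<psi> :: "nat \<Rightarrow> int"
  assumes q: "q > 0"
    and per: "\<And>a b. [a = b] (mod q) \<Longrightarrow> \<psi> a = \<psi> b"
    and zero: "(\<Sum>k<q. \<psi> k) = 0"
    and le1: "\<And>k. \<bar>\<psi> k\<bar> \<le> 1"
  shows "\<bar>\<Sum>k<K. \<psi> k\<bar> \<le> int q"
proof -
  have full: "(\<Sum>k<q * j + r. \<psi> k) = (\<Sum>k<r. \<psi> k)" for j r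
  proof (induction j)
    case (Suc j)
    have "(\<Sum>k<q * Suc j + r. \<psi> k) = (\<Sum>k<q. \<psi> k) + (\<Sum>k\<in>{q..<q + (q * j + r)}. \<psi> k)"
      by (subst sum.union_disjoint[symmetric]) (auto intro!: sum.cong)
    also have "(\<Sum>k\<in>{q..<q + (q * j + r)}. \<psi> k) = (\<Sum>k<q * j + r. \<psi> (q + k))"
      by (rule sum.reindex_bij_witness[of _ "\<lambda>k. q + k" "\<lambda>k. k - q"]) auto
    also have "\<dots> = (\<Sum>k<q * j + r. \<psi> k)"
      by (intro sum.cong refl per) (simp add: cong_def)
    finally show ?case using zero Suc by simp
  qed simp
  have "(\<Sum>k<K. \<psi> k) = (\<Sum>k<K mod q. \<psi> k)"
    using full[of "K div q" "K mod q"] by simp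
  also have "\<bar>\<dots>\<bar> \<le> (\<Sum>k<K mod q. \<bar>\<psi> k\<bar>)" by (rule sum_abs)
  also have "\<dots> \<le> (\<Sum>k<K mod q. 1)" by (intro sum_mono le1)
  also have "\<dots> \<le> int q" using q by (simp add: less_imp_le)
  finally show ?thesis .
qed

text \<open>Prepares the multiplier \<open>g\<close> for \<open>sum_period_zero\<close>: a
  nonresidue at one prime of \<open>n\<close> that is 1 modulo all the others.\<close>

lemma jac_twist:
  assumes "odd n" "n > 0" "coprime g n" "p \<in> prime_factors n"
    "\<And>r. r \<in> prime_factors n \<Longrightarrow> r \<noteq> p \<Longrightarrow> [g = 1] (mod r)"
    "Legendre (int g) (int p) = -1"
  shows "jac (int g) n = -1"
proof -
  have "jac (int g) n = Legendre (int g) (int p) * (\<Prod>r\<in>prime_factors n - {p}. Legendre (int g) (int r))"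
    unfolding jac_def using assms by (intro prod.remove) auto
  also have "(\<Prod>r\<in>prime_factors n - {p}. Legendre (int g) (int r)) = (\<Prod>r\<in>prime_factors n - {p}. 1)"
  proof (intro prod.cong refl)
    fix r assume r: "r \<in> prime_factors n - {p}"
    then have "[int g = 1] (mod int r)" using assms(5)[of r] by (metis DiffD1 DiffD2 cong_int_iff insertI1 of_nat_1)
    then have "Legendre (int g) (int r) = jac 1 r"
      using r by (subst jac_prime) (auto intro: Legendre_cong simp: in_prime_factors_iff)
    also have "\<dots> = 1" using r assms(1) by (intro jac_one_left) (auto simp: in_prime_factors_iff elim: dvd_trans)
    finally show "Legendre (int g) (int r) = 1" .
  qed
  finally show ?thesis using assms by simp
qed

lemma jac_one_cong:
  assumes "odd n" "\<And>r. r \<in> prime_factors n \<Longrightarrow> [g = 1] (mod r)" shows "jac (int g) n = 1"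
proof -
  have "Legendre (int g) (int r) = 1" if r: "r \<in> prime_factors n" for r
  proof -
    have "[int g = 1] (mod int r)" using assms(2)[of r] r by (metis cong_int_iff of_nat_1)
    then have "Legendre (int g) (int r) = jac 1 r"
      using r by (subst jac_prime) (auto intro: Legendre_cong simp: in_prime_factors_iff)
    also have "\<dots> = 1" using r assms(1) by (intro jac_one_left) (auto simp: in_prime_factors_iff elim: dvd_trans)
    finally show ?thesis .
  qed
  then show ?thesis by (simp add: jac_def)
qed

lemma ex_prime_dvd_only_one:
  fixes m n :: nat
  assumes "squarefree m" "squarefree n" "m \<noteq> n"
  shows "\<exists>p. prime p \<and> (p dvd m \<longleftrightarrow> \<not> p dvd n)"
proof (rule ccontr)
  assume "\<not> ?thesis"
  then have eq: "prime p \<Longrightarrow> p dvd m \<longleftrightarrow> p dvd n" for p by blast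
  have nz: "m \<noteq> 0" "n \<noteq> 0" using assms not_squarefree_0 by metis+
  have "multiplicity p m = multiplicity p n" if "prime p" for p
    using that eq[of p] assms nz squarefree_factorial_semiring'[of m] squarefree_factorial_semiring'[of n]
    by (metis in_prime_factors_iff not_dvd_imp_multiplicity_0)
  then show False using assms nz multiplicity_eq_nat by auto
qed

text \<open>The product is a nonprincipal character modulo \<open>m * n\<close>, because some prime
  divides exactly one of the two distinct squarefree moduli. The Chinese remainder theorem gives a
  \<open>g\<close> that is a nonresidue at this prime and 1 modulo the others, and multiplication by
  it reverses the sign.\<close>

lemma sum_jac_jac_bound:
  assumes "odd m" "squarefree m" "odd n" "squarefree n" "m \<noteq> n"
  shows "\<bar>\<Sum>k<K. jac (int k) m * jac (int k) n\<bar> \<le> int (m * n)"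
proof -
  have *: "\<bar>\<Sum>k<K. jac (int k) m * jac (int k) n\<bar> \<le> int (m * n)"
    if mn: "odd m" "squarefree m" "odd n" "squarefree n" "m \<noteq> n"
      and p: "prime p" "p dvd m" "\<not> p dvd n" for m n p :: nat
  proof (rule sum_period_bound)
    have pos: "m > 0" "n > 0" using mn odd_pos by blast+
    show "m * n > 0" using pos by simp
    show per: "jac (int a) m * jac (int a) n = jac (int b) m * jac (int b) n" if "[a = b] (mod m * n)" for a b
    proof -
      have "[a = b] (mod m)" "[a = b] (mod n)" using that cong_modulus_mult_nat[of a b m n] cong_modulus_mult_nat[of a b n m]
        by (auto simp: mult.commute)
      then show ?thesis using jac_cong[of "int a" "int b"] by (metis cong_int_iff)
    qed
    show "\<bar>jac (int k) m * jac (int k) n\<bar> \<le> 1" for k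
      using abs_jac_le_1[of k m] abs_jac_le_1[of k n] mult_mono[of "\<bar>jac (int k) m\<bar>" 1 "\<bar>jac (int k) n\<bar>" 1] by (simp add: abs_mult)
    show "(\<Sum>k<m * n. jac (int k) m * jac (int k) n) = 0"
    proof -
      obtain m' where m': "m = p * m'" using p by (elim dvdE)
      have "\<not> p dvd m'" using mn p m' squarefreeD[of m p]
        by (metis dvd_refl mult_dvd_mono nat_mult_1_right not_prime_1 power2_eq_square prime_nat_iff nat_dvd_1_iff_1)
      \<comment> \<open>\<open>m'\<close> and \<open>n\<close> may share primes. Only coprimality to
        \<open>p\<close> matters, since \<open>g\<close> is prescribed modulo \<open>p\<close> and
        modulo the product \<open>m' * n\<close>.\<close>
      then have cop: "coprime p (m' * n)" using p by (metis prime_dvd_mult_iff prime_imp_coprime)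
      have p2: "2 < p" using p mn by (metis dvd_trans le_neq_implies_less prime_ge_2_nat)
      obtain h where h: "Legendre h (int p) = -1" using ex_Legendre_minus1 p p2 by blast
      define h' where "h' = nat (h mod int p)"
      have h': "Legendre (int h') (int p) = -1"
      proof -
        have "int h' = h mod int p" using p prime_gt_0_nat unfolding h'_def by (simp add: pos_mod_sign)
        then show ?thesis using h Legendre_cong[of "int h'" h "int p"] by (simp add: cong_def)
      qed
      obtain g where g: "[g = h'] (mod p)" "[g = 1] (mod (m' * n))"
        using binary_chinese_remainder_nat[OF cop, of h' 1] by blast
      have gp: "Legendre (int g) (int p) = -1" using g(1) h' Legendre_cong by (metis cong_int_iff)
      have "\<not> int p dvd int g" using gp Legendre_eq_0_iff[of "int g" "int p"] by auto
      then have "coprime g p" using p by (meson coprime_commute int_dvd_int_iff prime_imp_coprime)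
      moreover have "coprime g (m' * n)" using g(2) by (metis cong_imp_coprime coprime_1_left cong_sym)
      ultimately have cg: "coprime g (m * n)" by (simp add: m' mult.assoc)
      have one: "[g = 1] (mod r)" if "r dvd m' * n" for r using g(2) that cong_dvd_modulus_nat by blast
      have "jac (int g) m = -1"
      proof (rule jac_twist)
        show "p \<in> prime_factors m" using p pos by (simp add: in_prime_factors_iff)
        show "[g = 1] (mod r)" if "r \<in> prime_factors m" "r \<noteq> p" for r
        proof -
          have "r dvd m'" using that p by (metis in_prime_factors_iff m' prime_dvd_mult_iff primes_dvd_imp_eq)
          then show ?thesis using one by simp
        qed
      qed (use mn pos cg gp in auto)
      moreover have "jac (int g) n = 1"
        using mn one by (intro jac_one_cong) (auto simp: in_prime_factors_iff)
      ultimately have "jac (int (g * a)) m * jac (int (g * a)) n = - (jac (int a) m * jac (int a) n)" for a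
        using mn by (simp add: jac_mult_left)
      then show ?thesis using sum_period_zero[of "m * n" "\<lambda>k. jac (int k) m * jac (int k) n" g] per pos cg by auto
    qed
  qed
  obtain p where p: "prime p" "p dvd m \<longleftrightarrow> \<not> p dvd n" using ex_prime_dvd_only_one assms by blast
  show ?thesis
  proof (cases "p dvd m")
    case True then show ?thesis using *[of m n p] assms p by simp
  next
    case False then show ?thesis using *[of n m p] assms p by (simp add: mult.commute)
  qed
qed

lemma prod_prime_factors_squarefree:
  fixes n :: nat
  assumes "squarefree n" shows "\<Prod>(prime_factors n) = n"
proof -
  have "n \<noteq> 0" using assms not_squarefree_0 by metis
  have "\<Prod>(prime_factors n) = (\<Prod>p\<in>prime_factors n. p ^ multiplicity p n)"
    using assms \<open>n \<noteq> 0\<close> by (intro prod.cong refl) (simp add: squarefree_factorial_semiring')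
  also have "\<dots> = n" using \<open>n \<noteq> 0\<close> by (simp add: prod_prime_factors)
  finally show ?thesis .
qed

section \<open>Quadratic reciprocity for Jacobi symbols\<close>

definition recip_sign :: "nat \<Rightarrow> nat \<Rightarrow> int" where
  "recip_sign m n = (if m mod 4 = 3 \<and> n mod 4 = 3 then -1 else 1)"

lemma recip_sign_mult:
  assumes "odd a" "odd b" shows "recip_sign (a * b) n = recip_sign a n * recip_sign b n"
proof -
  have r: "a mod 4 = 1 \<or> a mod 4 = 3" "b mod 4 = 1 \<or> b mod 4 = 3" using assms by presburger+
  have "(a * b) mod 4 = (a mod 4) * (b mod 4) mod 4" by (simp add: mod_mult_eq)
  then show ?thesis using r by (auto simp: recip_sign_def)
qed

lemma recip_sign_commute: "recip_sign a b = recip_sign b a" by (auto simp: recip_sign_def)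

lemma recip_sign_prod:
  "finite A \<Longrightarrow> \<forall>p\<in>A. odd (f p) \<Longrightarrow> recip_sign (prod f A) n = (\<Prod>p\<in>A. recip_sign (f p) n)"
proof (induction A rule: finite_induct)
  case (insert x A)
  have "odd (prod f A)" using insert by (auto simp: even_prod_iff)
  then show ?case using insert by (simp add: recip_sign_mult)
qed (simp add: recip_sign_def)

lemma Legendre_reciprocity:
  assumes "prime p" "2 < p" "prime q" "2 < q" "p \<noteq> q"
  shows "Legendre (int p) (int q) = Legendre (int q) (int p) * recip_sign p q"
proof -
  have odd: "odd p" "odd q" using assms prime_odd_nat by blast+
  have pm: "odd ((p - 1) div 2) = (p mod 4 = 3)" "odd ((q - 1) div 2) = (q mod 4 = 3)"
    using odd by presburger+
  have "Legendre (int p) (int q) * Legendre (int q) (int p) = recip_sign p q"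
    unfolding Quadratic_Reciprocity[OF assms] minus_one_power_iff even_mult_iff de_Morgan_disj using pm by (auto simp: recip_sign_def minus_one_power_iff)
  moreover have "Legendre (int q) (int p) \<in> {-1, 1}"
    using assms by (auto simp: Legendre_def cong_0_iff primes_dvd_imp_eq)
  ultimately show ?thesis by (auto simp: algebra_simps)
qed

text \<open>If \<open>m\<close> and \<open>n\<close> share a prime, both symbols vanish. Otherwise
  the symbol is a double product of Legendre symbols over pairs of distinct primes. The prime case
  applies to each pair, and the signs recombine because \<open>recip_sign\<close> is multiplicative
  in each argument.\<close>

lemma jac_reciprocity:
  assumes "odd m" "squarefree m" "odd n" "squarefree n"
  shows "jac (int m) n = jac (int n) m * recip_sign m n"
proof (cases "coprime m n")
  case False
  then have "\<not> coprime (int m) (int n)" "\<not> coprime (int n) (int m)" by (auto simp: coprime_commute)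
  moreover have "m > 0" "n > 0" using assms odd_pos by blast+
  ultimately show ?thesis by (simp add: jac_eq_0)
next
  case True
  have gt2: "2 < p" if "p \<in> prime_factors m \<union> prime_factors n" for p
    using that assms odd_prime_factor_gt_2 by blast
  have odds: "odd p" if "p \<in> prime_factors m \<union> prime_factors n" for p
    using that gt2[of p] prime_odd_nat by (auto simp: in_prime_factors_iff)
  have left: "jac (int a) b = (\<Prod>q\<in>prime_factors b. \<Prod>p\<in>prime_factors a. Legendre (int p) (int q))"
    if "squarefree a" "odd b" for a b
  proof -
    have "jac (int a) b = jac (\<Prod>p\<in>prime_factors a. int p) b"
      using prod_prime_factors_squarefree[OF that(1)] by (metis int_prod prod.cong of_nat_prod)
    also have "\<dots> = (\<Prod>p\<in>prime_factors a. jac (int p) b)" using that by (simp add: jac_prod_left)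
    also have "\<dots> = (\<Prod>q\<in>prime_factors b. \<Prod>p\<in>prime_factors a. Legendre (int p) (int q))"
      unfolding jac_def by (rule prod.swap)
    finally show ?thesis .
  qed
  have "jac (int m) n = (\<Prod>q\<in>prime_factors n. \<Prod>p\<in>prime_factors m. Legendre (int p) (int q))"
    using left assms by blast
  also have "\<dots> = (\<Prod>q\<in>prime_factors n. \<Prod>p\<in>prime_factors m. Legendre (int q) (int p) * recip_sign p q)"
  proof (intro prod.cong refl)
    fix q p assume qp: "q \<in> prime_factors n" "p \<in> prime_factors m"
    then have "p \<noteq> q" using True by (metis coprime_common_divisor_nat in_prime_factors_iff not_prime_1)
    then show "Legendre (int p) (int q) = Legendre (int q) (int p) * recip_sign p q"
      using qp gt2 by (intro Legendre_reciprocity) (auto simp: in_prime_factors_iff)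
  qed
  also have "\<dots> = (\<Prod>q\<in>prime_factors n. \<Prod>p\<in>prime_factors m. Legendre (int q) (int p)) *
      (\<Prod>q\<in>prime_factors n. \<Prod>p\<in>prime_factors m. recip_sign p q)"
    by (simp add: prod.distrib)
  also have "(\<Prod>q\<in>prime_factors n. \<Prod>p\<in>prime_factors m. Legendre (int q) (int p)) = jac (int n) m"
    using left[of n m] assms by (subst prod.swap) simp
  also have "(\<Prod>q\<in>prime_factors n. \<Prod>p\<in>prime_factors m. recip_sign p q) = (\<Prod>q\<in>prime_factors n. recip_sign q m)"
  proof (intro prod.cong refl)
    fix q assume "q \<in> prime_factors n"
    show "(\<Prod>p\<in>prime_factors m. recip_sign p q) = recip_sign q m"
      using recip_sign_prod[of "prime_factors m" "\<lambda>p. p" q] odds prod_prime_factors_squarefree[of m] assms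
      by (simp add: recip_sign_commute)
  qed
  also have "\<dots> = recip_sign n m"
    using recip_sign_prod[of "prime_factors n" "\<lambda>p. p" m] odds prod_prime_factors_squarefree[of n] assms by simp
  finally show ?thesis by (simp add: recip_sign_commute)
qed

section \<open>Moments of the divisor function\<close>

definition tau :: "nat \<Rightarrow> real" where "tau k = real (card {d. d dvd k})"

lemma tau_mono: "d dvd k \<Longrightarrow> k > 0 \<Longrightarrow> tau d \<le> tau k"
  unfolding tau_def of_nat_le_iff by (intro card_mono) (auto intro: dvd_trans)

lemma tau_submult:
  assumes "a > 0" "b > 0" shows "tau (a * b) \<le> tau a * tau b"
proof -
  have "{d. d dvd a * b} \<subseteq> (\<lambda>(x, y). x * y) ` ({d. d dvd a} \<times> {d. d dvd b})"
  proof
    fix d assume "d \<in> {d. d dvd a * b}"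
    then obtain x y where "d = x * y" "x dvd a" "y dvd b" using division_decomp by blast
    then show "d \<in> (\<lambda>(x, y). x * y) ` ({d. d dvd a} \<times> {d. d dvd b})" by force
  qed
  then have "card {d. d dvd a * b} \<le> card ((\<lambda>(x, y). x * y) ` ({d. d dvd a} \<times> {d. d dvd b}))"
    using assms by (intro card_mono) auto
  also have "\<dots> \<le> card ({d. d dvd a} \<times> {d. d dvd b})" using assms by (intro card_image_le) auto
  finally show ?thesis unfolding tau_def by (metis card_cartesian_product of_nat_le_iff of_nat_mult)
qed

lemma mult_le_imp_left_le: "a * b \<le> K \<Longrightarrow> Suc 0 \<le> b \<Longrightarrow> a \<le> K" for a b K :: nat
  by (metis Suc_le_eq dual_order.trans dvd_imp_le dvd_triv_left le_0_eq linorder_not_le mult_is_0 nat_0_less_mult_iff not_gr0 zero_le)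

lemma sum_divisor_pairs:
  fixes F :: "nat \<Rightarrow> nat \<Rightarrow> 'a::comm_monoid_add"
  shows "(\<Sum>k=1..K. \<Sum>d | d dvd k. F d (k div d)) = (\<Sum>a=1..K. \<Sum>b=1..K div a. F a b)"
proof -
  have "(\<Sum>k=1..K. \<Sum>d | d dvd k. F d (k div d)) = (\<Sum>(k, d)\<in>(SIGMA k:{1..K}. {d. d dvd k}). F d (k div d))"
    by (rule sum.Sigma) auto
  also have "\<dots> = (\<Sum>(a, b)\<in>(SIGMA a:{1..K}. {1..K div a}). F a b)"
    by (rule sum.reindex_bij_witness[of _ "\<lambda>(a, b). (a * b, a)" "\<lambda>(k, d). (d, k div d)"])
       (auto simp: less_eq_div_iff_mult_less_eq mult.commute div_le_mono
          dest: dvd_imp_le intro!: Nat.gr0I elim!: dvdE dest: mult_le_imp_left_le)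
  also have "\<dots> = (\<Sum>a=1..K. \<Sum>b=1..K div a. F a b)" by (rule sum.Sigma[symmetric]) auto
  finally show ?thesis .
qed

text \<open>Writing one factor \<open>tau k\<close> as a sum over divisors \<open>d\<close> and
  using submultiplicativity for the others bounds the sum by the square of the preceding one; hence
  the exponent doubles with each \<open>j\<close>.\<close>

lemma sum_tau_power_div_le:
  "(\<Sum>k=1..K. tau k ^ j / real k) \<le> harm K ^ (2 ^ j)"
proof (induction j)
  case 0 show ?case by (simp add: harm_def divide_inverse)
next
  case (Suc j)
  have "(\<Sum>k=1..K. tau k ^ Suc j / real k) = (\<Sum>k=1..K. \<Sum>d | d dvd k. tau k ^ j / real k)"
    by (simp add: tau_def)
  also have "\<dots> \<le> (\<Sum>k=1..K. \<Sum>d | d dvd k. (tau d ^ j / real d) * (tau (k div d) ^ j / real (k div d)))"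
  proof (intro sum_mono)
    fix k d assume k: "k \<in> {1..K}" and d: "d \<in> {d. d dvd k}"
    then obtain b where b: "k = d * b" by blast
    then have pos: "d > 0" "b > 0" using k by (auto intro!: Nat.gr0I)
    have "tau k ^ j \<le> (tau d * tau b) ^ j" using tau_submult[OF pos] b by (intro power_mono) (auto simp: tau_def)
    then show "tau k ^ j / real k \<le> (tau d ^ j / real d) * (tau (k div d) ^ j / real (k div d))"
      using pos by (simp add: b power_mult_distrib divide_right_mono)
  qed
  also have "\<dots> = (\<Sum>a=1..K. \<Sum>b=1..K div a. (tau a ^ j / real a) * (tau b ^ j / real b))"
    by (rule sum_divisor_pairs)
  also have "\<dots> \<le> (\<Sum>a=1..K. \<Sum>b=1..K. (tau a ^ j / real a) * (tau b ^ j / real b))"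
    by (intro sum_mono sum_mono2) (auto simp: tau_def intro: order_trans[OF _ div_le_dividend])
  also have "\<dots> = (\<Sum>k=1..K. tau k ^ j / real k) ^ 2" by (simp add: power2_eq_square sum_product)
  also have "\<dots> \<le> (harm K ^ (2 ^ j)) ^ 2" using Suc by (intro power_mono sum_nonneg) (auto simp: tau_def)
  also have "\<dots> = harm K ^ (2 ^ Suc j)" by (simp add: power_mult[symmetric] mult.commute)
  finally show ?case .
qed

text \<open>Again one factor \<open>tau k\<close> opens into a sum over divisors. The complementary
  divisor is summed by the induction hypothesis, the divisor itself by the bound with weights
  \<open>1 / k\<close>, and the exponents add up to \<open>(2 ^ j - 1) + 2 ^ j\<close>.\<close>

lemma sum_tau_power_le:
  "(\<Sum>k=1..K. tau k ^ j) \<le> real K * harm K ^ (2 ^ j - 1)"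
proof (induction j arbitrary: K)
  case (Suc j)
  have "(\<Sum>k=1..K. tau k ^ Suc j) = (\<Sum>k=1..K. \<Sum>d | d dvd k. tau k ^ j)"
    by (simp add: tau_def)
  also have "\<dots> \<le> (\<Sum>k=1..K. \<Sum>d | d dvd k. tau d ^ j * tau (k div d) ^ j)"
  proof (intro sum_mono)
    fix k d assume k: "k \<in> {1..K}" and d: "d \<in> {d. d dvd k}"
    then obtain b where b: "k = d * b" by blast
    then have pos: "d > 0" "b > 0" using k by (auto intro!: Nat.gr0I)
    have "tau k ^ j \<le> (tau d * tau b) ^ j" using tau_submult[OF pos] b by (intro power_mono) (auto simp: tau_def)
    then show "tau k ^ j \<le> tau d ^ j * tau (k div d) ^ j"
      using pos by (simp add: b power_mult_distrib)
  qed
  also have "\<dots> = (\<Sum>a=1..K. tau a ^ j * (\<Sum>b=1..K div a. tau b ^ j))"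
    by (subst sum_divisor_pairs) (simp add: sum_distrib_left)
  also have "\<dots> \<le> (\<Sum>a=1..K. tau a ^ j * (real K / real a * harm K ^ (2 ^ j - 1)))"
  proof (intro sum_mono mult_left_mono)
    fix a assume a: "a \<in> {1..K}"
    have "(\<Sum>b=1..K div a. tau b ^ j) \<le> real (K div a) * harm (K div a) ^ (2 ^ j - 1)" by (rule Suc)
    also have "\<dots> \<le> real K / real a * harm K ^ (2 ^ j - 1)"
      by (intro mult_mono power_mono harm_mono harm_nonneg) (auto simp: of_nat_div_le_of_nat harm_nonneg)
    finally show "(\<Sum>b=1..K div a. tau b ^ j) \<le> real K / real a * harm K ^ (2 ^ j - 1)" .
  qed (simp add: tau_def)
  also have "\<dots> = real K * harm K ^ (2 ^ j - 1) * (\<Sum>a=1..K. tau a ^ j / real a)"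
    by (simp add: sum_distrib_left mult_ac)
  also have "\<dots> \<le> real K * harm K ^ (2 ^ j - 1) * harm K ^ (2 ^ j)"
    by (intro mult_left_mono sum_tau_power_div_le) (auto simp: harm_nonneg)
  also have "\<dots> = real K * harm K ^ ((2 ^ j - 1) + 2 ^ j)" by (simp only: power_add mult.assoc)
  also have "(2 ^ j - 1) + 2 ^ j = 2 ^ Suc j - (1::nat)" using one_le_power[of "2::nat" j] by simp
  finally show ?case .
qed simp

text \<open>The coefficients of the square of the sum of \<open>\<alpha> d * \<psi> d\<close> over
  \<open>d \<le> D\<close>, for completely multiplicative \<open>\<psi>\<close>. The cutoff applies
  to both divisors, so the support ends at \<open>D^2\<close>.\<close>

definition self_conv :: "(nat \<Rightarrow> real) \<Rightarrow> nat \<Rightarrow> nat \<Rightarrow> real" where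
  "self_conv \<alpha> D k = (\<Sum>d | d dvd k. if d \<in> {1..D} \<and> k div d \<in> {1..D} then \<alpha> d * \<alpha> (k div d) else 0)"

lemma self_conv_sum:
  fixes \<psi> :: "nat \<Rightarrow> real"
  assumes mult: "\<And>a b. \<psi> (a * b) = \<psi> a * \<psi> b"
  shows "(\<Sum>k=1..D^2. self_conv \<alpha> D k * \<psi> k) = (\<Sum>d=1..D. \<alpha> d * \<psi> d) ^ 2"
proof -
  have "(\<Sum>k=1..D^2. self_conv \<alpha> D k * \<psi> k) = (\<Sum>k=1..D^2. \<Sum>d | d dvd k.
      if d \<in> {1..D} \<and> k div d \<in> {1..D} then \<alpha> d * \<psi> d * (\<alpha> (k div d) * \<psi> (k div d)) else 0)"
    unfolding self_conv_def sum_distrib_right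
    by (intro sum.cong refl) (auto simp: mult[symmetric] mult_ac)
  also have "\<dots> = (\<Sum>a=1..D^2. \<Sum>b=1..D^2 div a. if a \<in> {1..D} \<and> b \<in> {1..D} then \<alpha> a * \<psi> a * (\<alpha> b * \<psi> b) else 0)"
    by (rule sum_divisor_pairs)
  also have "\<dots> = (\<Sum>a=1..D. \<Sum>b=1..D^2 div a. if a \<in> {1..D} \<and> b \<in> {1..D} then \<alpha> a * \<psi> a * (\<alpha> b * \<psi> b) else 0)"
    by (rule sum.mono_neutral_right) (auto simp: power2_eq_square)
  also have "\<dots> = (\<Sum>a=1..D. \<Sum>b=1..D. \<alpha> a * \<psi> a * (\<alpha> b * \<psi> b))"
  proof (rule sum.cong[OF refl])
    fix a assume a: "a \<in> {1..D}"
    then have Da: "D * a \<le> D^2" by (simp add: power2_eq_square)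
    then have "D \<le> D^2 div a" using a by (simp add: less_eq_div_iff_mult_less_eq)
    then show "(\<Sum>b=1..D^2 div a. if a \<in> {1..D} \<and> b \<in> {1..D} then \<alpha> a * \<psi> a * (\<alpha> b * \<psi> b) else 0)
        = (\<Sum>b=1..D. \<alpha> a * \<psi> a * (\<alpha> b * \<psi> b))"
      using a by (intro sum.mono_neutral_cong_right) auto
  qed
  also have "\<dots> = (\<Sum>d=1..D. \<alpha> d * \<psi> d) ^ 2" by (simp add: power2_eq_square sum_product)
  finally show ?thesis .
qed

lemma self_conv_bound:
  assumes "\<And>d. d > 0 \<Longrightarrow> \<bar>\<alpha> d\<bar> \<le> tau d ^ i" "k > 0"
  shows "\<bar>self_conv \<alpha> D k\<bar> \<le> tau k ^ (2 * i + 1)"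
proof -
  have "\<bar>self_conv \<alpha> D k\<bar> \<le> (\<Sum>d | d dvd k. tau k ^ (2 * i))"
    unfolding self_conv_def
  proof (rule order_trans[OF sum_abs], intro sum_mono)
    fix d assume d: "d \<in> {d. d dvd k}"
    then obtain b where b: "k = d * b" by blast
    then have pos: "d > 0" "b > 0" using assms by (auto intro!: Nat.gr0I)
    have "\<bar>\<alpha> d\<bar> \<le> tau k ^ i" "\<bar>\<alpha> b\<bar> \<le> tau k ^ i"
      using b assms(2) order_trans[OF assms(1)[OF pos(1)] power_mono[OF tau_mono[of d k]]]
        order_trans[OF assms(1)[OF pos(2)] power_mono[OF tau_mono[of b k]]] by (auto simp: tau_def)
    then have "\<bar>\<alpha> d\<bar> * \<bar>\<alpha> b\<bar> \<le> tau k ^ i * tau k ^ i"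
      by (intro mult_mono) (auto simp: tau_def)
    then show "\<bar>if d \<in> {1..D} \<and> k div d \<in> {1..D} then \<alpha> d * \<alpha> (k div d) else 0\<bar> \<le> tau k ^ (2 * i)"
      using b pos by (auto simp: abs_mult power_add[symmetric] mult_2 tau_def)
  qed
  then show ?thesis by (simp add: tau_def)
qed

section \<open>Bilinear sums of Jacobi symbols\<close>

abbreviation J :: "nat \<Rightarrow> nat \<Rightarrow> real" where "J d e \<equiv> real_of_int (jac (int d) e)"

definition oddsqf :: "nat \<Rightarrow> nat set" where "oddsqf E = {e \<in> {1..E}. odd e \<and> squarefree e}"

lemma finite_oddsqf [simp]: "finite (oddsqf E)" by (simp add: oddsqf_def)
lemma card_oddsqf: "card (oddsqf E) \<le> E" using card_mono[of "{1..E}" "oddsqf E"] by (simp add: oddsqf_def subset_iff)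

lemma abs_J_le_1: "\<bar>J d e\<bar> \<le> 1" using abs_jac_le_1[of d e] by linarith

text \<open>After opening the square, the diagonal \<open>m = n\<close> gives at most
  \<open>K\<close> for each of at most \<open>E\<close> moduli, and each off-diagonal sum over
  \<open>k\<close> is a character sum bounded by its period, at most \<open>E^2\<close>.\<close>

lemma sum_J_sq_le:
  "(\<Sum>k=1..K. (\<Sum>e\<in>oddsqf E. J k e) ^ 2) \<le> real E * real K + 2 * real E ^ 4"
proof -
  have *: "(\<Sum>k=1..K. J k m * J k n) \<le> (if m = n then real K else 0) + 2 * real E ^ 2"
    if mn: "m \<in> oddsqf E" "n \<in> oddsqf E" for m n
  proof (cases "m = n")
    case True
    have "(\<Sum>k=1..K. J k m * J k n) \<le> (\<Sum>k=1..K. 1)"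
      using abs_J_le_1 True by (intro sum_mono) (metis abs_le_square_iff abs_one one_power2 power2_eq_square)
    then show ?thesis using True by (simp add: add_increasing2)
  next
    case False
    have "\<bar>\<Sum>k<Suc K. jac (int k) m * jac (int k) n\<bar> \<le> int (m * n)"
      using mn False by (intro sum_jac_jac_bound) (auto simp: oddsqf_def)
    \<comment> \<open>The period bound counts from \<open>k = 0\<close>. Removing this term costs at
      most 1, which the second \<open>E^2\<close> absorbs.\<close>
    also have "(\<Sum>k<Suc K. jac (int k) m * jac (int k) n) = jac 0 m * jac 0 n + (\<Sum>k=1..K. jac (int k) m * jac (int k) n)"
      by (subst sum.lessThan_Suc_shift) (simp add: sum.atLeast1_atMost_eq)
    finally have "\<bar>(\<Sum>k=1..K. jac (int k) m * jac (int k) n)\<bar> \<le> int (m * n) + \<bar>jac 0 m * jac 0 n\<bar>" by linarith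
    also have "\<bar>jac 0 m * jac 0 n\<bar> \<le> 1" using abs_jac_le_1[of 0 m] abs_jac_le_1[of 0 n] mult_mono[of "\<bar>jac 0 m\<bar>" 1 "\<bar>jac 0 n\<bar>" 1] by (simp add: abs_mult)
    finally have "real_of_int (\<Sum>k=1..K. jac (int k) m * jac (int k) n) \<le> real_of_int (int (m * n) + 1)"
      unfolding of_int_le_iff by linarith
    moreover have "real m * real n \<le> real E * real E"
      using mn by (auto simp: oddsqf_def intro!: mult_mono)
    moreover have "1 * 1 \<le> real E * real E"
      using mn by (intro mult_mono) (auto simp: oddsqf_def)
    ultimately show ?thesis using False by (simp add: power2_eq_square)
  qed
  have "(\<Sum>k=1..K. (\<Sum>e\<in>oddsqf E. J k e) ^ 2) = (\<Sum>m\<in>oddsqf E. \<Sum>n\<in>oddsqf E. \<Sum>k=1..K. J k m * J k n)"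
  proof -
    have "(\<Sum>k=1..K. (\<Sum>e\<in>oddsqf E. J k e) ^ 2) = (\<Sum>k=1..K. \<Sum>m\<in>oddsqf E. \<Sum>n\<in>oddsqf E. J k m * J k n)"
      by (simp add: power2_eq_square sum_product)
    also have "\<dots> = (\<Sum>m\<in>oddsqf E. \<Sum>k=1..K. \<Sum>n\<in>oddsqf E. J k m * J k n)" by (rule sum.swap)
    also have "\<dots> = (\<Sum>m\<in>oddsqf E. \<Sum>n\<in>oddsqf E. \<Sum>k=1..K. J k m * J k n)"
      by (intro sum.cong[OF refl] sum.swap)
    finally show ?thesis .
  qed
  also have "\<dots> \<le> (\<Sum>m\<in>oddsqf E. \<Sum>n\<in>oddsqf E. (if m = n then real K else 0) + 2 * real E ^ 2)"
    by (intro sum_mono *)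
  also have "\<dots> = (\<Sum>m\<in>oddsqf E. real K + real (card (oddsqf E)) * (2 * real E ^ 2))"
    by (intro sum.cong refl) (simp add: sum.distrib)
  also have "\<dots> = real (card (oddsqf E)) * (real K + real (card (oddsqf E)) * (2 * real E ^ 2))" by simp
  also have "\<dots> \<le> real E * (real K + real E * (2 * real E ^ 2))"
    using card_oddsqf[of E] by (intro mult_mono add_mono) auto
  finally show ?thesis by (simp add: algebra_simps power4_eq_xxxx power2_eq_square)
qed

text \<open>The fourth power of the sum over \<open>d\<close> is a sum over \<open>k \<le> D^4\<close>. After Cauchy's inequality in \<open>k\<close>, this
  range is long compared with the period \<open>e e'\<close> of \<open>k \<mapsto> J k e * J k e'\<close>.\<close>

lemma rectangle_bound:
  fixes \<alpha> :: "nat \<Rightarrow> real"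
  assumes \<alpha>: "\<And>d. \<bar>\<alpha> d\<bar> \<le> 1" and E: "E \<le> 2 * D" and D: "D \<ge> 1"
  shows "(\<Sum>e\<in>oddsqf E. \<bar>\<Sum>d=1..D. \<alpha> d * J d e\<bar>) ^ 8 \<le> 17 * harm (D ^ 4) ^ 63 * real D ^ 8 * real E ^ 7"
proof -
  define G where "G e = (\<Sum>d=1..D. \<alpha> d * J d e)" for e
  define c where "c = self_conv (self_conv \<alpha> D) (D ^ 2)"
  have c: "\<bar>c k\<bar> \<le> tau k ^ 3" if "k > 0" for k
  proof -
    have "\<bar>self_conv \<alpha> D k\<bar> \<le> tau k ^ 1" if "k > 0" for k
      using self_conv_bound[of \<alpha> 0 k D] \<alpha> that by simp
    then show ?thesis using self_conv_bound[of "self_conv \<alpha> D" 1 k "D ^ 2"] that by (simp add: c_def)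
  qed
  have G4: "G e ^ 4 = (\<Sum>k=1..D^4. c k * J k e)" if "e \<in> oddsqf E" for e
  proof -
    have m: "J (a * b) e = J a e * J b e" for a b using that by (simp add: jac_mult_left oddsqf_def)
    have "(\<Sum>k=1..D^4. c k * J k e) = (\<Sum>k=1..(D^2)^2. c k * J k e)" by simp
    also have "\<dots> = (G e ^ 2) ^ 2"
      unfolding c_def G_def self_conv_sum[of "\<lambda>d. J d e", OF m] ..
    finally show ?thesis by simp
  qed
  define K where "K = D ^ 4"
  have S4: "(\<Sum>e\<in>oddsqf E. G e ^ 4) = (\<Sum>k=1..K. c k * (\<Sum>e\<in>oddsqf E. J k e))"
    by (simp add: G4 K_def sum_distrib_left) (rule sum.swap)
  have "(\<Sum>e\<in>oddsqf E. G e ^ 4) ^ 2 \<le> (\<Sum>k=1..K. (c k)\<^sup>2) * (\<Sum>k=1..K. (\<Sum>e\<in>oddsqf E. J k e)\<^sup>2)"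
    unfolding S4 by (rule Cauchy_Schwarz_ineq_sum)
  also have "\<dots> \<le> (real K * harm K ^ 63) * (17 * real E * real K)"
  proof (intro mult_mono)
    \<comment> \<open>The two convolutions give \<open>c\<close> the size \<open>tau^3\<close>, so
      its square needs the sixth moment of \<open>tau\<close>; this is the origin of 63 = 2^6 -
      1.\<close>
    have "(\<Sum>k=1..K. (c k)\<^sup>2) \<le> (\<Sum>k=1..K. tau k ^ 6)"
    proof (intro sum_mono)
      fix k assume "k \<in> {1..K}"
      then have "\<bar>c k\<bar> ^ 2 \<le> (tau k ^ 3) ^ 2" by (intro power_mono c) auto
      then show "(c k)\<^sup>2 \<le> tau k ^ 6" by (simp add: power_mult[symmetric])
    qed
    also have "\<dots> \<le> real K * harm K ^ (2 ^ 6 - 1)" by (rule sum_tau_power_le)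
    finally show "(\<Sum>k=1..K. (c k)\<^sup>2) \<le> real K * harm K ^ 63" by simp
    \<comment> \<open>Here \<open>E \<le> 2 * D\<close> is used: the off-diagonal part
      \<open>2 * E^4\<close> is then at most \<open>16 * E * K\<close>, a constant multiple of the
      diagonal part.\<close>
    have "real E ^ 3 \<le> (2 * real D) ^ 3" using E by (intro power_mono) auto
    also have "\<dots> \<le> 8 * real D ^ 4" using D by (simp add: power_mult_distrib power_increasing)
    finally have "2 * real E * real E ^ 3 \<le> 2 * real E * (8 * real D ^ 4)" by (intro mult_left_mono) auto
    then have "real E * real K + 2 * real E ^ 4 \<le> 17 * real E * real K"
      by (simp add: K_def power4_eq_xxxx power3_eq_cube algebra_simps)
    then show "(\<Sum>k=1..K. (\<Sum>e\<in>oddsqf E. J k e)\<^sup>2) \<le> 17 * real E * real K"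
      using sum_J_sq_le[where E=E and K=K] by linarith
  qed (auto simp: sum_nonneg harm_nonneg)
  finally have S4b: "(\<Sum>e\<in>oddsqf E. G e ^ 4) ^ 2 \<le> (real K * harm K ^ 63) * (17 * real E * real K)" .
  have cs: "(\<Sum>e\<in>oddsqf E. f e) ^ 2 \<le> real E * (\<Sum>e\<in>oddsqf E. f e ^ 2)" for f :: "nat \<Rightarrow> real"
  proof -
    have "(\<Sum>e\<in>oddsqf E. 1 * f e) ^ 2 \<le> (\<Sum>e\<in>oddsqf E. 1\<^sup>2) * (\<Sum>e\<in>oddsqf E. (f e)\<^sup>2)"
      by (rule Cauchy_Schwarz_ineq_sum)
    also have "\<dots> \<le> real E * (\<Sum>e\<in>oddsqf E. (f e)\<^sup>2)"
      using card_oddsqf[of E] by (intro mult_right_mono) (auto simp: sum_nonneg)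
    finally show ?thesis by simp
  qed
  \<comment> \<open>Cauchy's inequality in \<open>e\<close>, applied twice, passes from the first to
    the fourth moment: A^8 is at most E^6 C^2.\<close>
  define A where "A = (\<Sum>e\<in>oddsqf E. \<bar>G e\<bar>)"
  define B where "B = (\<Sum>e\<in>oddsqf E. G e ^ 2)"
  define C where "C = (\<Sum>e\<in>oddsqf E. G e ^ 4)"
  have nn: "A \<ge> 0" "B \<ge> 0" "C \<ge> 0" by (auto simp: A_def B_def C_def sum_nonneg)
  have AB: "A ^ 2 \<le> real E * B" using cs[of "\<lambda>e. \<bar>G e\<bar>"] by (simp add: A_def B_def)
  have BC: "B ^ 2 \<le> real E * C" using cs[of "\<lambda>e. (G e)^2"] by (simp add: B_def C_def power_mult[symmetric])
  have "A ^ 8 = (A ^ 2) ^ 4" by (simp add: power_mult[symmetric])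
  also have "\<dots> \<le> (real E * B) ^ 4" using AB by (intro power_mono) auto
  also have "\<dots> = real E ^ 4 * (B ^ 2) ^ 2" by (simp add: power_mult_distrib power_mult[symmetric])
  also have "\<dots> \<le> real E ^ 4 * (real E * C) ^ 2" using BC nn by (intro mult_left_mono power_mono) auto
  also have "\<dots> = real E ^ 6 * C ^ 2" by (simp add: power_mult_distrib power_add[symmetric])
  also have "\<dots> \<le> real E ^ 6 * ((real K * harm K ^ 63) * (17 * real E * real K))"
    using S4b by (intro mult_left_mono) (auto simp: C_def)
  also have "\<dots> = 17 * harm K ^ 63 * (real K * real K) * (real E ^ 6 * real E)" by (simp add: mult_ac)
  also have "real K * real K = real D ^ 8" by (simp add: K_def power_add[symmetric])
  also have "real E ^ 6 * real E = real E ^ 7" by (simp add: power_Suc2[symmetric] del: power_Suc)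
  finally show ?thesis by (simp add: A_def G_def K_def)
qed

lemma harm_le_ln: "n > 0 \<Longrightarrow> harm n \<le> 1 + ln (real n)"
  using euler_mascheroni_sequence_decreasing[of 1 n] by (simp add: harm_def)

lemma harm_ge_1: "n > 0 \<Longrightarrow> (harm n :: real) \<ge> 1"
  using harm_mono[of 1 n, where 'a=real] by (simp add: harm_def)

text \<open>An eighth root. The constant 17 is enlarged to 2^8 and the exponent 63 to 64, which
  makes the root exact.\<close>

lemma rectangle_bound':
  fixes \<alpha> :: "nat \<Rightarrow> real"
  assumes \<alpha>: "\<And>d. \<bar>\<alpha> d\<bar> \<le> 1" and E: "E \<le> 2 * D" and D: "D \<ge> 1"
  shows "(\<Sum>e\<in>oddsqf E. \<bar>\<Sum>d=1..D. \<alpha> d * J d e\<bar>) \<le> 2 * harm (D ^ 4) ^ 8 * real D * real E powr (7/8)"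
proof (rule power_le_imp_le_base[where n = 7])
  have H: "harm (D ^ 4) \<ge> (1::real)" using D by (intro harm_ge_1) auto
  have "(\<Sum>e\<in>oddsqf E. \<bar>\<Sum>d=1..D. \<alpha> d * J d e\<bar>) ^ 8 \<le> 17 * harm (D ^ 4) ^ 63 * real D ^ 8 * real E ^ 7"
    using rectangle_bound assms by blast
  also have "\<dots> \<le> 256 * harm (D ^ 4) ^ 64 * real D ^ 8 * real E ^ 7"
    using H by (intro mult_right_mono mult_mono power_increasing) auto
  also have "\<dots> = (2 * harm (D ^ 4) ^ 8 * real D * real E powr (7/8)) ^ 8"
  proof (cases "E = 0")
    case False
    have "(real E powr (7/8)) ^ 8 = real E powr 7" using False by (simp add: powr_power)
    also have "\<dots> = real E ^ 7" using False by (simp add: powr_numeral)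
    finally show ?thesis by (simp add: power_mult_distrib power_mult[symmetric])
  qed simp
  finally show "(\<Sum>e\<in>oddsqf E. \<bar>\<Sum>d=1..D. \<alpha> d * J d e\<bar>) ^ Suc 7
      \<le> (2 * harm (D ^ 4) ^ 8 * real D * real E powr (7/8)) ^ Suc 7" by simp
qed (auto simp: harm_nonneg)

text \<open>The length \<open>t e\<close> of the inner sum may now vary with \<open>e\<close>. The
  range \<open>1..D\<close> is cut into about \<open>E^(1/16)\<close> intervals of length
  \<open>l\<close>. On a full interval the rectangle bound applies, with \<open>\<alpha>\<close> set
  to 0 outside it, and the incomplete last interval is bounded trivially by \<open>l\<close>. This
  choice of \<open>l\<close> balances the two losses: \<open>E^(1/16) * E^(7/8)\<close> and
  \<open>E / E^(1/16)\<close> are both \<open>E^(15/16)\<close>.\<close>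

lemma block_bound:
  fixes \<alpha> :: "nat \<Rightarrow> real" and t :: "nat \<Rightarrow> nat"
  assumes \<alpha>: "\<And>d. \<bar>\<alpha> d\<bar> \<le> 1" and E: "E \<le> 2 * D" and D: "D \<ge> 1" and E1: "E \<ge> 1"
    and t: "\<And>e. e \<in> A \<Longrightarrow> t e \<le> D" and A: "A \<subseteq> oddsqf E"
  shows "(\<Sum>e\<in>A. \<bar>\<Sum>d=1..t e. \<alpha> d * J d e\<bar>) \<le> 5 * harm (D ^ 4) ^ 8 * real D * real E powr (15/16)"
proof -
  define x where "x = real E powr (1/16)"
  define l where "l = nat \<lceil>real D / x\<rceil>"
  define R where "R = 2 * harm (D ^ 4) ^ 8 * real D * real E powr (7/8)"
  have H: "harm (D ^ 4) \<ge> (1::real)" using D by (intro harm_ge_1) auto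
  have x1: "x \<ge> 1" unfolding x_def using E1 by (intro ge_one_powr_ge_zero) auto
  have xE: "x \<le> real E" unfolding x_def using E1 powr_mono[of "1/16" 1 "real E"] by simp
  have l_ge: "real l \<ge> real D / x" unfolding l_def by linarith
  have l_le: "real l \<le> real D / x + 1"

  proof -
    have "0 \<le> real D / x" using x1 by simp
    then have "real l = of_int \<lceil>real D / x\<rceil>" unfolding l_def by simp
    then show ?thesis by linarith
  qed
  have l1: "l \<ge> 1"
  proof -
    have "real D / x > 0" using D x1 by simp
    then have "real l > 0" using l_ge by linarith
    then show ?thesis by simp
  qed
  have finA: "finite A" by (rule finite_subset[OF A finite_oddsqf])
  define S where "S i e = (\<Sum>d\<in>{i * l<..Suc i * l}. \<alpha> d * J d e)" for i e
  have S: "(\<Sum>e\<in>A. \<bar>S i e\<bar>) \<le> R" if "i < D div l" for i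
  proof -
    have "Suc i * l \<le> D"
      using that l1 less_eq_div_iff_mult_less_eq[of l "Suc i" D] Suc_leI by simp
    then have sub: "{i * l<..Suc i * l} \<subseteq> {1..D}" by auto
    define \<alpha>' where "\<alpha>' d = (if d \<in> {i * l<..Suc i * l} then \<alpha> d else 0)" for d
    have "S i e = (\<Sum>d=1..D. \<alpha>' d * J d e)" for e
      unfolding S_def \<alpha>'_def using sub by (intro sum.mono_neutral_cong_left) auto
    then have "(\<Sum>e\<in>A. \<bar>S i e\<bar>) = (\<Sum>e\<in>A. \<bar>\<Sum>d=1..D. \<alpha>' d * J d e\<bar>)" by simp
    also have "\<dots> \<le> (\<Sum>e\<in>oddsqf E. \<bar>\<Sum>d=1..D. \<alpha>' d * J d e\<bar>)" using A by (intro sum_mono2) auto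
    also have "\<dots> \<le> R" unfolding R_def using \<alpha> E D by (intro rectangle_bound') (auto simp: \<alpha>'_def)
    finally show ?thesis .
  qed
  have split: "(\<Sum>d\<in>{0<..q * l}. f d) = (\<Sum>i<q. \<Sum>d\<in>{i * l<..Suc i * l}. f d)" for f :: "nat \<Rightarrow> real" and q
  proof (induction q)
    case (Suc q)
    have "{0<..Suc q * l} = {0<..q * l} \<union> {q * l<..Suc q * l}" by auto
    then have "(\<Sum>d\<in>{0<..Suc q * l}. f d) = (\<Sum>d\<in>{0<..q * l}. f d) + (\<Sum>d\<in>{q * l<..Suc q * l}. f d)"
      by (simp add: sum.union_disjoint del: mult_Suc)
    then show ?case using Suc by simp
  qed simp
  have one: "\<bar>\<Sum>d=1..t e. \<alpha> d * J d e\<bar> \<le> (\<Sum>i<D div l. \<bar>S i e\<bar>) + real l" if e: "e \<in> A" for e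
  proof -
    define q where "q = t e div l"
    have "t e = q * l + t e mod l" unfolding q_def by simp
    moreover have "t e mod l < l" using l1 by simp
    ultimately have ql: "q * l \<le> t e" "t e < q * l + l" by linarith+
    have "{1..t e} = {0<..q * l} \<union> {q * l<..t e}" using ql by auto
    then have "(\<Sum>d=1..t e. \<alpha> d * J d e) = (\<Sum>d\<in>{0<..q * l}. \<alpha> d * J d e) + (\<Sum>d\<in>{q * l<..t e}. \<alpha> d * J d e)"
      by (simp add: sum.union_disjoint)
    also have "(\<Sum>d\<in>{0<..q * l}. \<alpha> d * J d e) = (\<Sum>i<q. S i e)" by (simp add: split S_def del: mult_Suc)
    finally have "\<bar>\<Sum>d=1..t e. \<alpha> d * J d e\<bar> \<le> \<bar>\<Sum>i<q. S i e\<bar> + \<bar>\<Sum>d\<in>{q * l<..t e}. \<alpha> d * J d e\<bar>" by linarith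
    moreover have "\<bar>\<Sum>i<q. S i e\<bar> \<le> (\<Sum>i<D div l. \<bar>S i e\<bar>)"
    proof -
      have "q \<le> D div l" unfolding q_def using t[OF e] by (rule div_le_mono)
      then have "(\<Sum>i<q. \<bar>S i e\<bar>) \<le> (\<Sum>i<D div l. \<bar>S i e\<bar>)" by (intro sum_mono2) auto
      then show ?thesis using sum_abs[of "\<lambda>i. S i e" "{..<q}"] by linarith
    qed
    moreover have "\<bar>\<Sum>d\<in>{q * l<..t e}. \<alpha> d * J d e\<bar> \<le> real l"
    proof -
      have "\<bar>\<Sum>d\<in>{q * l<..t e}. \<alpha> d * J d e\<bar> \<le> (\<Sum>d\<in>{q * l<..t e}. 1)"
      proof (rule order_trans[OF sum_abs], intro sum_mono)
        fix d show "\<bar>\<alpha> d * J d e\<bar> \<le> 1"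
          using \<alpha>[of d] abs_J_le_1[of d e] mult_mono[of "\<bar>\<alpha> d\<bar>" 1 "\<bar>J d e\<bar>" 1] by (simp add: abs_mult)
      qed
      also have "\<dots> = real (t e - q * l)" by simp
      also have "\<dots> \<le> real l" using ql unfolding of_nat_le_iff by linarith
      finally show ?thesis .
    qed
    ultimately show ?thesis by linarith
  qed
  have "(\<Sum>e\<in>A. \<bar>\<Sum>d=1..t e. \<alpha> d * J d e\<bar>) \<le> (\<Sum>e\<in>A. (\<Sum>i<D div l. \<bar>S i e\<bar>) + real l)"
    by (intro sum_mono one)
  also have "\<dots> = (\<Sum>i<D div l. \<Sum>e\<in>A. \<bar>S i e\<bar>) + real (card A) * real l"
    by (simp add: sum.distrib sum.swap[of _ A])
  also have "\<dots> \<le> (\<Sum>i<D div l. R) + real E * real l"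
    using S card_mono[OF finite_oddsqf A] card_oddsqf[of E] by (intro add_mono sum_mono mult_right_mono) auto
  also have "\<dots> = real (D div l) * R + real E * real l" by simp
  also have "\<dots> \<le> x * R + real E * (3 * real D / x)"
  proof (intro add_mono mult_right_mono mult_left_mono)
    have "real (D div l) \<le> real D / real l" by (rule of_nat_div_le_of_nat)
    also have "\<dots> \<le> x" using l_ge l1 x1 by (simp add: field_simps)
    finally show "real (D div l) \<le> x" .
    have "1 \<le> 2 * real D / x" using xE E x1 by (simp add: field_simps)
    then show "real l \<le> 3 * real D / x" using l_le by (simp add: add_divide_distrib[symmetric])
    show "R \<ge> 0" using H by (simp add: R_def)
    show "real E \<ge> 0" by simp
  qed
  also have "x * R = 2 * harm (D ^ 4) ^ 8 * real D * real E powr (15/16)"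
    unfolding R_def x_def by (simp add: powr_add[symmetric])
  also have "real E * (3 * real D / x) = 3 * real D * real E powr (15/16)"
  proof -
    have "real E = real E powr (15/16) * x" unfolding x_def using E1 by (simp add: powr_add[symmetric])
    then show ?thesis using x1 by (simp add: field_simps)
  qed
  also have "3 * real D * real E powr (15/16) \<le> 3 * harm (D ^ 4) ^ 8 * real D * real E powr (15/16)"
    using H by (intro mult_right_mono) (auto simp: one_le_power)
  finally show ?thesis by (simp add: algebra_simps)
qed

text \<open>Dyadic blocks in \<open>e\<close> reduce the hyperbola to \<open>block_bound\<close>.
  For \<open>e\<close> between \<open>2^j\<close> and \<open>2^(j+1)\<close> the inner length is at
  most \<open>D = Y div 2^j\<close>, and \<open>e * e \<le> Y\<close> supplies the hypothesis
  \<open>E \<le> 2 * D\<close>. As \<open>D * E \<le> 2 * Y\<close>, the saving over the trivial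
  bound is \<open>E^(-1/16)\<close>, at most \<open>T^(-1/16)\<close>.\<close>

lemma hyperbola_half:
  fixes \<alpha> \<beta> :: "nat \<Rightarrow> real"
  assumes \<alpha>: "\<And>d. \<bar>\<alpha> d\<bar> \<le> 1" and \<beta>: "\<And>d. \<bar>\<beta> d\<bar> \<le> 1" and Y: "Y \<ge> 1" and T: "T \<ge> 1"
  shows "\<bar>\<Sum>e\<in>{e \<in> oddsqf Y. T < real e \<and> e * e \<le> Y}. \<beta> e * (\<Sum>d=1..Y div e. \<alpha> d * J d e)\<bar>
       \<le> 10 * (1 + 4 * ln (real Y)) ^ 9 * real Y * T powr (-1/16)"
proof -
  define S where "S = {e \<in> oddsqf Y. T < real e \<and> e * e \<le> Y}"
  define G where "G e = \<bar>\<Sum>d=1..Y div e. \<alpha> d * J d e\<bar>" for e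
  define L where "L = 1 + 4 * ln (real Y)"
  define B where "B = 10 * L ^ 8 * real Y * T powr (-1/16)"
  have L1: "L \<ge> 1" using Y by (simp add: L_def)
  have finS: "finite S" by (auto simp: S_def)
  have cell: "(\<Sum>e\<in>{e \<in> S. floor_log e = j}. G e) \<le> B" for j
  proof (cases "{e \<in> S. floor_log e = j} = {}")
    case True then show ?thesis using L1 by (simp add: True B_def)
  next
    case False
    then obtain e0 where e0: "e0 \<in> S" "floor_log e0 = j" by blast
    have rng: "2 ^ j \<le> e" "e < 2 ^ Suc j" if "e \<in> S" "floor_log e = j" for e
      using that floor_log_exp2_le[of e] floor_log_exp2_gt[of e] by (auto simp: S_def oddsqf_def)
    define D where "D = Y div 2 ^ j"
    define E where "E = (2::nat) ^ Suc j"
    have "e0 \<le> Y div e0" using e0 by (auto simp: S_def oddsqf_def less_eq_div_iff_mult_less_eq)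
    also have "\<dots> \<le> D" unfolding D_def using rng[OF e0] by (intro div_le_mono2) auto
    finally have D_ge: "2 ^ j \<le> D" using rng[OF e0] by linarith
    have "(\<Sum>e\<in>{e \<in> S. floor_log e = j}. G e) \<le> 5 * harm (D ^ 4) ^ 8 * real D * real E powr (15/16)"
      unfolding G_def
    proof (rule block_bound)
      show "E \<le> 2 * D" "E \<ge> 1" using D_ge by (auto simp: E_def)
      show "1 \<le> D" using D_ge one_le_power[of "2::nat" j] by linarith
      show "Y div e \<le> D" if "e \<in> {e \<in> S. floor_log e = j}" for e
        unfolding D_def using that rng by (intro div_le_mono2) auto
      show "{e \<in> S. floor_log e = j} \<subseteq> oddsqf E" using rng by (fastforce simp: S_def oddsqf_def E_def)
    qed (use \<alpha> in auto)
    also have "\<dots> \<le> 5 * L ^ 8 * (2 * real Y * T powr (-1/16))"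
    proof -
      have Dpos: "D > 0" using D_ge by (metis gr0I le_zero_eq power_not_zero zero_neq_numeral)
      have "harm (D ^ 4) \<le> 1 + ln (real (D ^ 4))" using Dpos by (intro harm_le_ln) auto
      also have "\<dots> = 1 + 4 * ln (real D)" using Dpos by (simp add: ln_realpow)
      also have "\<dots> \<le> L"
      proof -
        have "real D \<le> real Y" by (simp add: D_def)
        then have "ln (real D) \<le> ln (real Y)" using Dpos Y by simp
        then show ?thesis by (simp add: L_def)
      qed
      finally have HL: "harm (D ^ 4) \<le> L" .
      have "real D * real E powr (15/16) = real D * real E * real E powr (-1/16)"
      proof -
        have "real E powr (15/16) = real E powr 1 * real E powr (-1/16)" by (subst powr_add[symmetric]) simp
        then show ?thesis by (simp add: E_def)
      qed
      also have "\<dots> \<le> (2 * real Y) * T powr (-1/16)"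
      proof -
        have "D * 2 ^ j \<le> Y" unfolding D_def by (simp add: div_times_less_eq_dividend)
        then have "D * E \<le> 2 * Y" by (simp add: E_def)
        then have 1: "real D * real E \<le> 2 * real Y" by (metis of_nat_le_iff of_nat_mult of_nat_numeral)
        have "e0 < E" using rng[OF e0] by (simp add: E_def)
        then have "real e0 < real E" by simp
        then have "T \<le> real E" using e0 by (simp add: S_def)
        then have 2: "real E powr (-1/16) \<le> T powr (-1/16)" using T by (intro powr_mono2') auto
        show ?thesis by (rule mult_mono[OF 1 2]) auto
      qed
      finally have "real D * real E powr (15/16) \<le> 2 * real Y * T powr (-1/16)" .
      moreover have "5 * harm (D ^ 4) ^ 8 \<le> 5 * L ^ 8" using HL by (intro mult_left_mono power_mono) (auto simp: harm_nonneg)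
      ultimately have "5 * harm (D ^ 4) ^ 8 * (real D * real E powr (15/16)) \<le> 5 * L ^ 8 * (2 * real Y * T powr (-1/16))"
        using L1 by (intro mult_mono[of "5 * harm (D ^ 4) ^ 8"]) auto
      then show ?thesis by (simp add: mult.assoc)
    qed
    finally show ?thesis by (simp add: B_def)
  qed
  have "\<bar>\<Sum>e\<in>S. \<beta> e * (\<Sum>d=1..Y div e. \<alpha> d * J d e)\<bar> \<le> (\<Sum>e\<in>S. G e)"
  proof (rule order_trans[OF sum_abs], intro sum_mono)
    fix e show "\<bar>\<beta> e * (\<Sum>d=1..Y div e. \<alpha> d * J d e)\<bar> \<le> G e"
      using mult_right_mono[OF \<beta>[of e], of "G e"] by (simp add: G_def abs_mult)
  qed
  also have "(\<Sum>e\<in>S. G e) = (\<Sum>j\<in>{..floor_log Y}. \<Sum>e\<in>{e \<in> S. floor_log e = j}. G e)"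
    by (rule sum.group[symmetric]) (auto simp: finS S_def oddsqf_def intro!: monoD[OF floor_log_mono])
  also have "\<dots> \<le> (\<Sum>j\<in>{..floor_log Y}. B)" by (intro sum_mono cell)
  also have "\<dots> = (1 + real (floor_log Y)) * B" by simp
  \<comment> \<open>The number of dyadic blocks accounts for the ninth factor \<open>L\<close>; the
    other eight come from \<open>harm (D ^ 4) ^ 8\<close>.\<close>
  also have "\<dots> \<le> L * B"
  proof (intro mult_right_mono)
    have "real (2 ^ floor_log Y) \<le> real Y" using floor_log_exp2_le[of Y] Y unfolding of_nat_le_iff by simp
    then have "ln (real (2 ^ floor_log Y)) \<le> ln (real Y)" using Y by (subst ln_le_cancel_iff) auto
    then have "real (floor_log Y) * ln 2 \<le> ln (real Y)" by (simp add: ln_realpow)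
    moreover have "real (floor_log Y) * (1/2) \<le> real (floor_log Y) * ln 2"
      using ln2_ge_two_thirds by (intro mult_left_mono) auto
    moreover have "ln (real Y) \<ge> 0" using Y by simp
    ultimately show "1 + real (floor_log Y) \<le> L" unfolding L_def by linarith
  qed (use L1 in \<open>auto simp: B_def\<close>)
  also have "L * B = 10 * L ^ 9 * real Y * T powr (-1/16)" by (simp add: B_def eval_nat_numeral)
  finally show ?thesis unfolding S_def L_def .
qed

lemma abs_mult_le_1: "\<bar>x\<bar> \<le> 1 \<Longrightarrow> \<bar>y\<bar> \<le> 1 \<Longrightarrow> \<bar>x * y\<bar> \<le> (1::real)"
  by (simp add: abs_mult mult_le_one)

lemma hyperbola_half_pairs:
  fixes \<alpha> \<beta> :: "nat \<Rightarrow> real"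
  assumes \<alpha>: "\<And>d. \<bar>\<alpha> d\<bar> \<le> 1" and \<beta>: "\<And>d. \<bar>\<beta> d\<bar> \<le> 1" and Y: "Y \<ge> 1" and T: "T \<ge> 1"
  shows "\<bar>\<Sum>(d, e)\<in>{(d, e). d \<in> oddsqf Y \<and> e \<in> oddsqf Y \<and> T < real d \<and> T < real e \<and> d * e \<le> Y \<and> e * e \<le> Y}. \<alpha> d * \<beta> e * J d e\<bar>
       \<le> 10 * (1 + 4 * ln (real Y)) ^ 9 * real Y * T powr (-1/16)"
proof -
  define \<alpha>' where "\<alpha>' d = (if d \<in> oddsqf Y \<and> T < real d then \<alpha> d else 0)" for d
  let ?P = "{(d, e). d \<in> oddsqf Y \<and> e \<in> oddsqf Y \<and> T < real d \<and> T < real e \<and> d * e \<le> Y \<and> e * e \<le> Y}"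
  let ?S = "{e \<in> oddsqf Y. T < real e \<and> e * e \<le> Y}"
  have "(\<Sum>e\<in>?S. \<beta> e * (\<Sum>d=1..Y div e. \<alpha>' d * J d e)) = (\<Sum>e\<in>?S. \<Sum>d=1..Y div e. \<alpha>' d * \<beta> e * J d e)"
    by (simp add: sum_distrib_left mult_ac)
  also have "\<dots> = (\<Sum>(e, d)\<in>(SIGMA e:?S. {1..Y div e}). \<alpha>' d * \<beta> e * J d e)"
    by (rule sum.Sigma) auto
  also have "\<dots> = (\<Sum>(e, d)\<in>{(e, d). (d, e) \<in> ?P}. \<alpha> d * \<beta> e * J d e)"
  proof (rule sum.mono_neutral_cong_right)
    show "finite (SIGMA e:?S. {1..Y div e})" by auto
    show "{(e, d). (d, e) \<in> ?P} \<subseteq> (SIGMA e:?S. {1..Y div e})"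
      by (auto simp: less_eq_div_iff_mult_less_eq oddsqf_def)
    show "\<forall>i\<in>(SIGMA e:?S. {1..Y div e}) - {(e, d). (d, e) \<in> ?P}. (case i of (e, d) \<Rightarrow> \<alpha>' d * \<beta> e * J d e) = 0"
    proof
      fix i assume i: "i \<in> (SIGMA e:?S. {1..Y div e}) - {(e, d). (d, e) \<in> ?P}"
      obtain e d where ed: "i = (e, d)" by (cases i)
      have "e \<ge> 1" using i ed by (auto simp: oddsqf_def)
      then have "\<not> (d \<in> oddsqf Y \<and> T < real d)" using i ed by (auto simp: less_eq_div_iff_mult_less_eq)
      then show "(case i of (e, d) \<Rightarrow> \<alpha>' d * \<beta> e * J d e) = 0" by (auto simp: ed \<alpha>'_def)
    qed
  qed (auto simp: \<alpha>'_def)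
  also have "\<dots> = (\<Sum>(d, e)\<in>?P. \<alpha> d * \<beta> e * J d e)"
    by (rule sum.reindex_bij_witness[of _ "\<lambda>(d, e). (e, d)" "\<lambda>(e, d). (d, e)"]) auto
  finally have "(\<Sum>(d, e)\<in>?P. \<alpha> d * \<beta> e * J d e) = (\<Sum>e\<in>?S. \<beta> e * (\<Sum>d=1..Y div e. \<alpha>' d * J d e))" ..
  moreover have "\<bar>\<Sum>e\<in>?S. \<beta> e * (\<Sum>d=1..Y div e. \<alpha>' d * J d e)\<bar> \<le> 10 * (1 + 4 * ln (real Y)) ^ 9 * real Y * T powr (-1/16)"
    using \<alpha> \<beta> Y T by (intro hyperbola_half) (auto simp: \<alpha>'_def)
  ultimately show ?thesis by simp
qed

text \<open>As \<open>d * e \<le> Y\<close>, one of \<open>d * d\<close> and \<open>e * e\<close> is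
  at most \<open>Y\<close>. The pairs with \<open>e * e \<le> Y\<close> are covered directly. For
  the others reciprocity exchanges the two variables, which is harmless because both coefficient
  sequences are arbitrary; the exchange costs a factor 2, so 10 becomes 30.\<close>

theorem bilinear_bound:
  fixes \<alpha> \<beta> :: "nat \<Rightarrow> real"
  assumes \<alpha>: "\<And>d. \<bar>\<alpha> d\<bar> \<le> 1" and \<beta>: "\<And>d. \<bar>\<beta> d\<bar> \<le> 1" and Y: "Y \<ge> 1" and T: "T \<ge> 1"
  shows "\<bar>\<Sum>(d, e)\<in>{(d, e). d \<in> oddsqf Y \<and> e \<in> oddsqf Y \<and> T < real d \<and> T < real e \<and> d * e \<le> Y}. \<alpha> d * \<beta> e * J d e\<bar>
       \<le> 30 * (1 + 4 * ln (real Y)) ^ 9 * real Y * T powr (-1/16)"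
proof -
  define B where "B = 10 * (1 + 4 * ln (real Y)) ^ 9 * real Y * T powr (-1/16)"
  define P where "P = {(d, e). d \<in> oddsqf Y \<and> e \<in> oddsqf Y \<and> T < real d \<and> T < real e \<and> d * e \<le> Y}"
  define P1 where "P1 = {(d, e). (d, e) \<in> P \<and> e * e \<le> Y}"
  define P2 where "P2 = {(d, e). (d, e) \<in> P \<and> \<not> e * e \<le> Y}"
  have finP: "finite P" by (rule finite_subset[of _ "oddsqf Y \<times> oddsqf Y"]) (auto simp: P_def)
  have split: "P = P1 \<union> P2" "P1 \<inter> P2 = {}" by (auto simp: P1_def P2_def)
  have fin: "finite P1" "finite P2" using finP split by auto
  have S: "(\<Sum>(d, e)\<in>P. \<alpha> d * \<beta> e * J d e) = (\<Sum>(d, e)\<in>P1. \<alpha> d * \<beta> e * J d e) + (\<Sum>(d, e)\<in>P2. \<alpha> d * \<beta> e * J d e)"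
    unfolding split(1) using fin split(2) by (rule sum.union_disjoint)
  have P1_eq: "P1 = {(d, e). d \<in> oddsqf Y \<and> e \<in> oddsqf Y \<and> T < real d \<and> T < real e \<and> d * e \<le> Y \<and> e * e \<le> Y}"
    by (auto simp: P1_def P_def)
  have half: "\<bar>\<Sum>(d, e)\<in>P1. f d * g e * J d e\<bar> \<le> B" if "\<And>d. \<bar>f d\<bar> \<le> 1" "\<And>d. \<bar>g d\<bar> \<le> 1" for f g :: "nat \<Rightarrow> real"
    unfolding P1_eq B_def using that Y T by (intro hyperbola_half_pairs) auto
  \<comment> \<open>The reciprocity sign is not a function of \<open>d\<close> times a function of
    \<open>e\<close>. In terms of \<open>ch\<close> it is the combination
    \<open>(1 + ch e + ch d - ch e * ch d) / 2\<close> of four such products, each of which can be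
    absorbed into the coefficients.\<close>
  define ch where "ch n = (if n mod 4 = 3 then -1 else 1 :: real)" for n :: nat
  have ch1: "\<bar>ch n\<bar> \<le> 1" for n by (simp add: ch_def)
  \<comment> \<open>The value 0 for \<open>e * e \<le> Y\<close> lets the exchanged sum over
    \<open>P2\<close> extend to all of \<open>P1\<close> without adding anything.\<close>
  define \<beta>' where "\<beta>' e = (if e * e \<le> Y then 0 else \<beta> e)" for e
  have \<beta>'1: "\<bar>\<beta>' e\<bar> \<le> 1" for e using \<beta> by (simp add: \<beta>'_def)
  have small: "d * d \<le> Y" if "(d, e) \<in> P2" for d e
  proof (rule ccontr)
    assume dd: "\<not> d * d \<le> Y"
    have e:  "\<not> e * e \<le> Y" "d * e \<le> Y" using that by (auto simp: P2_def P_def)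
    then have "d * e < d * d" using dd by linarith
    then have "e \<le> d" by simp
    then have "e * e \<le> d * e" by simp
    with e show False by linarith
  qed
  have "(\<Sum>(d, e)\<in>P2. \<alpha> d * \<beta> e * J d e) = (\<Sum>(d, e)\<in>P2. \<beta>' e * \<alpha> d * (J e d * ((1 + ch e + ch d - ch e * ch d) / 2)))"
  proof (intro sum.cong refl, clarify)
    fix d e assume de: "(d, e) \<in> P2"
    then have "jac (int d) e = jac (int e) d * recip_sign d e"
      by (intro jac_reciprocity) (auto simp: P2_def P_def oddsqf_def)
    then have "J d e = J e d * ((1 + ch e + ch d - ch e * ch d) / 2)"
      by (simp add: recip_sign_def ch_def)
    then show "\<alpha> d * \<beta> e * J d e = \<beta>' e * \<alpha> d * (J e d * ((1 + ch e + ch d - ch e * ch d) / 2))"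
      using de by (simp add: P2_def \<beta>'_def)
  qed
  also have "\<dots> = (\<Sum>(e, d)\<in>P1. \<beta>' e * \<alpha> d * (J e d * ((1 + ch e + ch d - ch e * ch d) / 2)))"
  proof -
    have "(\<Sum>(d, e)\<in>P2. \<beta>' e * \<alpha> d * (J e d * ((1 + ch e + ch d - ch e * ch d) / 2)))
       = (\<Sum>(e, d)\<in>{(e, d). (d, e) \<in> P2}. \<beta>' e * \<alpha> d * (J e d * ((1 + ch e + ch d - ch e * ch d) / 2)))"
      by (rule sum.reindex_bij_witness[of _ "\<lambda>(d, e). (e, d)" "\<lambda>(e, d). (d, e)"]) auto
    also have "\<dots> = (\<Sum>(e, d)\<in>P1. \<beta>' e * \<alpha> d * (J e d * ((1 + ch e + ch d - ch e * ch d) / 2)))"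
    proof (rule sum.mono_neutral_left[OF fin(1)])
      show "{(e, d). (d, e) \<in> P2} \<subseteq> P1"
      proof clarify
        fix e d assume de: "(d, e) \<in> P2"
        then have "d * e \<le> Y" by (simp add: P2_def P_def)
        then have "e * d \<le> Y" by (simp add: mult.commute)
        then show "(e, d) \<in> P1" using small[OF de] de by (simp add: P1_def P2_def P_def)
      qed
      show "\<forall>i\<in>P1 - {(e, d). (d, e) \<in> P2}. (case i of (e, d) \<Rightarrow> \<beta>' e * \<alpha> d * (J e d * ((1 + ch e + ch d - ch e * ch d) / 2))) = 0"
      proof
        fix i assume i: "i \<in> P1 - {(e, d). (d, e) \<in> P2}"
        obtain e d where ed: "i = (e, d)" by (cases i)
        have "(e, d) \<in> P" "(d, e) \<notin> P2" using i by (auto simp: ed P1_def)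
        then have "e * e \<le> Y" by (auto simp: P2_def P_def mult.commute)
        then show "(case i of (e, d) \<Rightarrow> \<beta>' e * \<alpha> d * (J e d * ((1 + ch e + ch d - ch e * ch d) / 2))) = 0"
          by (simp add: ed \<beta>'_def)
      qed
    qed
    finally show ?thesis .
  qed
  also have "\<dots> = (\<Sum>(e, d)\<in>P1. (\<beta>' e * \<alpha> d * J e d + (\<beta>' e * ch e) * \<alpha> d * J e d
      + \<beta>' e * (\<alpha> d * ch d) * J e d - (\<beta>' e * ch e) * (\<alpha> d * ch d) * J e d) / 2)"
    by (intro sum.cong refl, clarify) (simp add: algebra_simps)
  also have "\<dots> = ((\<Sum>(e, d)\<in>P1. \<beta>' e * \<alpha> d * J e d) + (\<Sum>(e, d)\<in>P1. (\<beta>' e * ch e) * \<alpha> d * J e d)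
      + (\<Sum>(e, d)\<in>P1. \<beta>' e * (\<alpha> d * ch d) * J e d) - (\<Sum>(e, d)\<in>P1. (\<beta>' e * ch e) * (\<alpha> d * ch d) * J e d)) / 2"
    by (simp add: case_prod_unfold sum.distrib sum_subtractf sum_divide_distrib[symmetric])
  finally have P2: "(\<Sum>(d, e)\<in>P2. \<alpha> d * \<beta> e * J d e) = \<dots>" .
  have avg: "\<bar>w\<bar> \<le> B \<Longrightarrow> \<bar>x\<bar> \<le> B \<Longrightarrow> \<bar>y\<bar> \<le> B \<Longrightarrow> \<bar>z\<bar> \<le> B \<Longrightarrow> \<bar>(w + x + y - z) / 2\<bar> \<le> 2 * B" for w x y z
    by (simp add: abs_le_iff)
  have "\<bar>\<Sum>(e, d)\<in>P1. \<beta>' e * \<alpha> d * J e d\<bar> \<le> B" by (intro half \<beta>'1 \<alpha>)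
  moreover have "\<bar>\<Sum>(e, d)\<in>P1. (\<beta>' e * ch e) * \<alpha> d * J e d\<bar> \<le> B" by (intro half abs_mult_le_1 \<beta>'1 \<alpha> ch1)
  moreover have "\<bar>\<Sum>(e, d)\<in>P1. \<beta>' e * (\<alpha> d * ch d) * J e d\<bar> \<le> B" by (intro half abs_mult_le_1 \<beta>'1 \<alpha> ch1)
  moreover have "\<bar>\<Sum>(e, d)\<in>P1. (\<beta>' e * ch e) * (\<alpha> d * ch d) * J e d\<bar> \<le> B" by (intro half abs_mult_le_1 \<beta>'1 \<alpha> ch1)
  ultimately have "\<bar>\<Sum>(d, e)\<in>P2. \<alpha> d * \<beta> e * J d e\<bar> \<le> 2 * B" unfolding P2 by (rule avg)
  moreover have "\<bar>\<Sum>(d, e)\<in>P1. \<alpha> d * \<beta> e * J d e\<bar> \<le> B" by (intro half \<alpha> \<beta>)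
  ultimately have "\<bar>\<Sum>(d, e)\<in>P. \<alpha> d * \<beta> e * J d e\<bar> \<le> 3 * B" unfolding S by linarith
  then show ?thesis by (simp add: P_def B_def)
qed

section \<open>Two-descent on soluble forms\<close>

lemma prime_dvd_mult_square:
  fixes p u s :: int
  assumes "prime p" "p dvd u * s ^ 2" "\<not> p dvd u" shows "p dvd s"
proof -
  have "p dvd s ^ 2" using assms prime_dvd_mult_iff by blast
  then show ?thesis using assms(1) prime_dvd_power by blast
qed

lemma int_prime_obtain:
  fixes p :: int
  assumes "prime p" "p > 2"
  shows "\<exists>q. p = int q \<and> prime q \<and> 2 < q"
proof -
  have "p = int (nat p)" "prime (nat p)" "2 < nat p" using assms by auto
  then show ?thesis by blast
qed

text \<open>After division by the greatest common divisor neither \<open>s'\<close> nor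
  \<open>t'\<close> is divisible by \<open>p\<close>, since \<open>p\<close> dividing one would
  divide the other. Then \<open>u * v\<close> times the unit square \<open>s'^2\<close> is the unit
  square \<open>(v * t')^2\<close>.\<close>

lemma sq_ratio_Legendre:
  fixes u v s t p :: int
  assumes p: "prime p" "p > 2" and eq: "u * s ^ 2 = v * t ^ 2" and u: "\<not> p dvd u" and v: "\<not> p dvd v" and s: "s \<noteq> 0"
  shows "Legendre (u * v) p = 1"
proof -
  define g where "g = gcd s t"
  have g: "g \<noteq> 0" using s by (simp add: g_def)
  obtain s' t' where st: "s = s' * g" "t = t' * g" "coprime s' t'"
    using gcd_coprime_exists[of s t] g unfolding g_def by blast
  have eq': "u * s' ^ 2 = v * t' ^ 2"
  proof -
    have "u * s' ^ 2 * g ^ 2 = v * t' ^ 2 * g ^ 2" using eq st by (simp add: power_mult_distrib mult_ac)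
    then show ?thesis using g by simp
  qed
  have pt: "\<not> p dvd t'"
  proof
    assume pt: "p dvd t'"
    then have "p dvd u * s' ^ 2" unfolding eq' by (simp add: power2_eq_square)
    then have "p dvd s'" using p u by (auto intro: prime_dvd_mult_square)
    with pt st p show False by (meson coprime_common_divisor not_prime_unit)
  qed
  have ps: "\<not> p dvd s'"
  proof
    assume "p dvd s'"
    then have "p dvd v * t' ^ 2" unfolding eq'[symmetric] by (simp add: power2_eq_square)
    then have "p dvd t'" using p v by (auto intro: prime_dvd_mult_square)
    with pt show False by simp
  qed
  obtain q where q: "p = int q" "prime q" "2 < q"
    using int_prime_obtain[OF p] by blast
  have "u * v * s' ^ 2 = (v * t') ^ 2" using eq' by (simp add: power_mult_distrib power2_eq_square mult_ac)
  moreover have "Legendre ((v * t') ^ 2) p = 1"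
    using p v pt by (intro Legendre_square) (auto simp: prime_dvd_mult_iff)
  moreover have "Legendre (s' ^ 2) p = 1" using p ps by (intro Legendre_square)
  ultimately show ?thesis using Legendre_mult[OF q(2,3), of "u * v" "s' ^ 2"] q by simp
qed

text \<open>The two sides would have odd and even exponent at \<open>p\<close>. Coprime
  \<open>s'\<close> and \<open>t'\<close> replace the computation with exponents.\<close>

lemma odd_valuation_contra:
  fixes u v s t p :: int
  assumes p: "prime p" and eq: "p * u * s ^ 2 = v * t ^ 2" and u: "\<not> p dvd u" and v: "\<not> p dvd v" and s: "s \<noteq> 0"
  shows False
proof -
  define g where "g = gcd s t"
  have g: "g \<noteq> 0" using s by (simp add: g_def)
  obtain s' t' where st: "s = s' * g" "t = t' * g" "coprime s' t'"
    using gcd_coprime_exists[of s t] g unfolding g_def by blast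
  have eq': "p * u * s' ^ 2 = v * t' ^ 2"
  proof -
    have "p * u * s' ^ 2 * g ^ 2 = v * t' ^ 2 * g ^ 2" using eq st by (simp add: power_mult_distrib mult_ac)
    then show ?thesis using g by simp
  qed
  have "p dvd v * t' ^ 2" unfolding eq'[symmetric] by simp
  then have pt: "p dvd t'" using p v by (auto intro: prime_dvd_mult_square)
  then obtain t'' where t'': "t' = p * t''" by blast
  have "p * (u * s' ^ 2) = p * (p * v * t'' ^ 2)" using eq' by (simp add: t'' power_mult_distrib power2_eq_square mult_ac)
  then have "u * s' ^ 2 = p * v * t'' ^ 2" using p by (simp add: prime_gt_0_int)
  then have "p dvd u * s' ^ 2" by simp
  then have "p dvd s'" using p u by (auto intro: prime_dvd_mult_square)
  with pt st p show False by (meson coprime_common_divisor not_prime_unit)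
qed

lemma odd_valuation_contra_1:
  fixes u w p :: int
  assumes p: "prime p" and eq: "p * u = w ^ 2" and u: "\<not> p dvd u"
  shows False
  using odd_valuation_contra[OF p, of u 1 1 w] eq u p by (auto dest: not_prime_unit)

lemma squarefree_prime_quotient:
  fixes u u' p :: int
  assumes p: "prime p" and "squarefree u" "u = p * u'"
  shows "\<not> p dvd u'"
proof
  assume "p dvd u'"
  then obtain k where "u' = p * k" by blast
  then have "p ^ 2 dvd u" using assms by (simp add: power2_eq_square)
  then have "p dvd 1" using squarefreeD[OF assms(2)] by blast
  then show False using p not_prime_unit by blast
qed

text \<open>Here \<open>a f(x, y) = A1 A2\<close> for a form \<open>f\<close> with leading coefficient \<open>a\<close>, and \<open>b\<close> is the square
  class of \<open>A1\<close>.\<close>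

locale two_descent =
  fixes N a b x y z w A1 A2 :: int
  assumes a: "squarefree a" and b: "squarefree b" and xy: "coprime x y" and z: "z \<noteq> 0"
    and A1: "A1 = a * x ^ 2 + N * y ^ 2" and A2: "A2 = a * x ^ 2 + 2 * N * y ^ 2"
    and eq: "a * z ^ 2 = A1 * A2" and w: "b * A1 = w ^ 2"
begin

lemma a0: "a \<noteq> 0" and b0: "b \<noteq> 0" using a b not_squarefree_0 by metis+

lemma A0: "A1 \<noteq> 0" "A2 \<noteq> 0" using eq a0 z by auto

lemma baz: "b * a * z ^ 2 = A2 * w ^ 2"
  using eq w by (metis mult.assoc mult.commute)

lemma not_both: assumes "prime p" "p dvd x" "p dvd y" shows False
  using assms xy by (meson coprime_common_divisor not_prime_unit)

text \<open>A prime that divides \<open>b\<close> but not \<open>a\<close> must divide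
  \<open>A1\<close> and \<open>A2\<close>, by parity of its exponent in \<open>b * A1 = w^2\<close>
  and in \<open>baz\<close>. It then divides the difference \<open>N * y^2\<close>, and if it is
  prime to \<open>N\<close>, it divides \<open>y\<close> and next \<open>x\<close>.\<close>

lemma b_support:
  assumes p: "prime p" and pN: "\<not> p dvd N" and pa: "\<not> p dvd a" shows "\<not> p dvd b"
proof
  assume "p dvd b"
  then obtain b' where b': "b = p * b'" by blast
  have pb': "\<not> p dvd b'" using squarefree_prime_quotient[OF p b b'] .
  have d1: "p dvd A1"
  proof (rule ccontr)
    assume "\<not> p dvd A1"
    then have "\<not> p dvd b' * A1" using pb' p by (simp add: prime_dvd_mult_iff)
    moreover have "p * (b' * A1) = w ^ 2" using w b' by (simp add: mult.assoc)
    ultimately show False using odd_valuation_contra_1 p by blast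
  qed
  have d2: "p dvd A2"
  proof (rule ccontr)
    assume A2: "\<not> p dvd A2"
    have "\<not> p dvd b' * a" using pb' pa p by (simp add: prime_dvd_mult_iff)
    moreover have "p * (b' * a) * z ^ 2 = A2 * w ^ 2" using baz b' by (simp add: mult.assoc)
    ultimately show False using odd_valuation_contra p A2 z by blast
  qed
  have "N * y ^ 2 = A2 - A1" by (simp add: A1 A2)
  then have d3: "p dvd N * y ^ 2" using d1 d2 by simp
  then have py: "p dvd y" using prime_dvd_mult_square[OF p _ pN] by blast
  have "a * x ^ 2 = A1 - N * y ^ 2" by (simp add: A1)
  then have "p dvd a * x ^ 2" using d1 d3 by simp
  then have "p dvd x" using prime_dvd_mult_square[OF p _ pa] by blast
  with py show False using not_both p by blast
qed

end

locale two_descent_at = two_descent +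
  fixes p N' :: int
  assumes p: "prime p" "p > 2" and N: "N = p * N'" and pN': "\<not> p dvd N'"
begin

lemma Leg_mult: "Legendre (u * v) p = Legendre u p * Legendre v p"
proof -
  obtain q where q: "p = int q" "prime q" "2 < q"
    using int_prime_obtain[OF p] by blast
  then show ?thesis using Legendre_mult by blast
qed

lemma Leg_sq: "\<not> p dvd u \<Longrightarrow> Legendre u p * Legendre u p = 1"
  using Legendre_square[OF p(1), of u] Leg_mult[of u u] by (simp add: power2_eq_square)

lemma Leg_cong: "p dvd u - v \<Longrightarrow> Legendre u p = Legendre v p"
  by (rule Legendre_cong) (simp add: cong_iff_dvd_diff)

lemma p_dvd_mult: "p dvd u * v \<longleftrightarrow> p dvd u \<or> p dvd v" using p prime_dvd_mult_iff by blast
lemma p_dvd_sq: "p dvd u ^ 2 \<longleftrightarrow> p dvd u" by (simp add: power2_eq_square p_dvd_mult)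
lemma p0: "p \<noteq> 0" using p by auto
lemma not_p_dvd_1: "\<not> p dvd 1" "\<not> p dvd -1" "\<not> p dvd 2"
proof -
  show "\<not> p dvd 1" using p not_prime_unit by blast
  then show "\<not> p dvd -1" by simp
  show "\<not> p dvd 2" using p zdvd_imp_le[of p 2] by auto
qed
lemma p_abs: "\<bar>p\<bar> \<noteq> 1" using p by simp
lemma sqf_quot: assumes "squarefree u" "u = p * u'" shows "\<not> p dvd u'"
  using squarefree_prime_quotient[OF p(1) assms] .
lemma Leg_cancel: "\<not> p dvd u \<Longrightarrow> Legendre u p * (Legendre u p * v) = v"
  by (simp add: mult.assoc[symmetric] Leg_sq)
lemma Leg_of_square: "u = v ^ 2 \<Longrightarrow> \<not> p dvd u \<Longrightarrow> Legendre u p = 1"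
  using Legendre_square[OF p(1), of v] p_dvd_sq by simp
lemma unit_diff: "p dvd u - v \<Longrightarrow> \<not> p dvd v \<Longrightarrow> \<not> p dvd u"
  using dvd_diff[of p u "u - v"] by auto

text \<open>The two alternatives for \<open>b\<close> are two kinds of points. If \<open>p\<close>
  does not divide \<open>x\<close>, both factors are congruent to the unit \<open>a * x^2\<close>,
  and \<open>b\<close> is a unit. If \<open>p\<close> divides \<open>x\<close>, both factors contain
  \<open>p\<close> exactly once, with cofactors congruent to \<open>N' * y^2\<close> and
  \<open>2 * N' * y^2\<close>, and \<open>p\<close> divides \<open>b\<close>.\<close>

lemma case_a_unit:
  assumes pa: "\<not> p dvd a"
  shows "(\<not> p dvd b \<longrightarrow> Legendre a p = 1 \<and> Legendre b p = 1) \<and>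
    (\<forall>b'. b = p * b' \<longrightarrow> Legendre (2 * a) p = 1 \<and> Legendre (b' * N') p = 1)"
proof (cases "p dvd x")
  case False
  have "p dvd A1 - a * x ^ 2" "p dvd A2 - a * x ^ 2" by (auto simp: A1 A2 N)
  moreover have u: "\<not> p dvd a * x ^ 2" using False pa by (simp add: p_dvd_mult p_dvd_sq)
  ultimately have uA: "\<not> p dvd A1" "\<not> p dvd A2" using unit_diff by blast+
  have LA: "Legendre A1 p = Legendre a p" "Legendre A2 p = Legendre a p"
    using Leg_cong[of A1 "a * x ^ 2"] Leg_cong[of A2 "a * x ^ 2"] Leg_mult[of a "x^2"] Legendre_square[OF p(1) False]
      \<open>p dvd A1 - a * x ^ 2\<close> \<open>p dvd A2 - a * x ^ 2\<close> by auto
  have pb: "\<not> p dvd b"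
  proof
    assume "p dvd b"
    then obtain b' where b': "b = p * b'" by blast
    have "\<not> p dvd b'" using sqf_quot[OF b b'] .
    then show False using odd_valuation_contra_1[of p "b' * A1" w] p uA w b'
      by (simp add: p_dvd_mult mult.assoc)
  qed
  have "Legendre (b * A1) p = 1" using uA pb by (intro Leg_of_square[OF w]) (simp add: p_dvd_mult)
  moreover have "Legendre (a * (A1 * A2)) p = 1"
    using uA pa z by (intro sq_ratio_Legendre[OF p, of _ z _ 1]) (simp_all add: p_dvd_mult eq)
  ultimately have "Legendre b p * Legendre a p = 1" "Legendre a p * (Legendre a p * Legendre a p) = 1"
    by (simp_all add: Leg_mult LA)
  then have "Legendre a p = 1 \<and> Legendre b p = 1" using Leg_sq[OF pa] by simp
  then show ?thesis using pb by auto
next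
  case True
  then have py: "\<not> p dvd y" using not_both p by blast
  obtain x' where x': "x = p * x'" using True by blast
  define C1 where "C1 = a * p * x' ^ 2 + N' * y ^ 2"
  define C2 where "C2 = a * p * x' ^ 2 + 2 * N' * y ^ 2"
  have AC: "A1 = p * C1" "A2 = p * C2" by (auto simp: A1 A2 C1_def C2_def N x' algebra_simps power2_eq_square)
  have d: "p dvd C1 - N' * y ^ 2" "p dvd C2 - 2 * N' * y ^ 2" by (auto simp: C1_def C2_def)
  have "\<not> p dvd N' * y ^ 2" "\<not> p dvd 2 * N' * y ^ 2" using py pN' not_p_dvd_1 by (auto simp: p_dvd_mult p_dvd_sq)
  then have uC: "\<not> p dvd C1" "\<not> p dvd C2" using d unit_diff by blast+
  have LC: "Legendre C1 p = Legendre N' p" "Legendre C2 p = Legendre 2 p * Legendre N' p"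
    using Leg_cong[OF d(1)] Leg_cong[OF d(2)] Legendre_square[OF p(1) py] by (simp_all add: Leg_mult)
  have "p dvd b"
  proof (rule ccontr)
    assume "\<not> p dvd b"
    then show False using odd_valuation_contra_1[of p "b * C1" w] p uC w AC
      by (simp add: p_dvd_mult mult_ac)
  qed
  moreover have "Legendre (2 * a) p = 1 \<and> Legendre (b' * N') p = 1" if b': "b = p * b'" for b'
  proof -
    have pb': "\<not> p dvd b'" using sqf_quot[OF b b'] .
    have "Legendre (b' * C1 * 1) p = 1"
    proof (rule sq_ratio_Legendre[OF p, of _ p _ w])
      show "b' * C1 * p ^ 2 = 1 * w ^ 2" using w by (simp add: AC b' power2_eq_square mult_ac)
    qed (use uC pb' p0 p_abs in \<open>auto simp: p_dvd_mult\<close>)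
    moreover have "Legendre (a * (C1 * C2)) p = 1"
    proof (rule sq_ratio_Legendre[OF p, of _ z _ p])
      show "a * z ^ 2 = C1 * C2 * p ^ 2" using eq by (simp add: AC power2_eq_square mult_ac)
    qed (use uC pa z in \<open>auto simp: p_dvd_mult\<close>)
    ultimately show ?thesis by (simp add: Leg_mult LC mult_ac Leg_cancel[OF pN'])
  qed
  ultimately show ?thesis by auto
qed

text \<open>Now both factors are divisible by \<open>p\<close> at every point, with cofactors
  \<open>C1\<close> and \<open>C2\<close>. By parity in \<open>a' * z^2 = p * (C1 * C2)\<close>, the
  prime divides one of these; it divides only one, as they differ by the unit
  \<open>N' * y^2\<close>. The vanishing cofactor fixes the class of \<open>a'\<close>, and
  \<open>p\<close> divides \<open>b\<close> exactly if this cofactor is \<open>C2\<close>.\<close>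

lemma case_a_div:
  assumes a': "a = p * a'"
  shows "(\<not> p dvd b \<longrightarrow> Legendre (- b) p = 1 \<and> Legendre (- (a' * N')) p = 1) \<and>
    (\<forall>b'. b = p * b' \<longrightarrow> Legendre (- 2 * (a' * N')) p = 1 \<and> Legendre (- (b' * N')) p = 1)"
proof -
  have pa': "\<not> p dvd a'" using sqf_quot[OF a a'] .
  define C1 where "C1 = a' * x ^ 2 + N' * y ^ 2"
  define C2 where "C2 = a' * x ^ 2 + 2 * N' * y ^ 2"
  have AC: "A1 = p * C1" "A2 = p * C2" by (auto simp: A1 A2 C1_def C2_def N a' algebra_simps)
  have eqC: "a' * z ^ 2 = p * (C1 * C2)"
  proof -
    have "p * (a' * z ^ 2) = p * (p * (C1 * C2))" using eq by (simp add: AC a' mult_ac)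
    then show ?thesis using p0 by simp
  qed
  define e where "e = Legendre (-1) p"
  have L1: "e * e = 1" unfolding e_def using Leg_sq not_p_dvd_1 by blast
  have neg: "Legendre (- u) p = e * Legendre u p" for u using Leg_mult[of "-1" u] by (simp add: e_def)
  have one: "p dvd C1 \<or> p dvd C2"
  proof (rule ccontr)
    assume "\<not> (p dvd C1 \<or> p dvd C2)"
    then show False using odd_valuation_contra[of p "C1 * C2" 1 a' z] eqC pa' p
      by (simp add: p_dvd_mult)
  qed
  have py: "\<not> p dvd y"
  proof
    assume py: "p dvd y"
    then have "p dvd N' * y ^ 2" "p dvd 2 * N' * y ^ 2" by (simp_all add: p_dvd_mult p_dvd_sq)
    then have "p dvd a' * x ^ 2" using one by (auto simp: C1_def C2_def dvd_add_left_iff)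
    then have "p dvd x" using pa' by (simp add: p_dvd_mult p_dvd_sq)
    with py show False using not_both p by blast
  qed
  have uN: "\<not> p dvd N' * y ^ 2" using py pN' by (simp add: p_dvd_mult p_dvd_sq)
  have Ly: "Legendre (y ^ 2) p = 1" using Legendre_square[OF p(1) py] .
  show ?thesis
  proof (cases "p dvd C1")
    case True
    have "C2 - N' * y ^ 2 = C1" by (simp add: C1_def C2_def algebra_simps)
    then have "p dvd C2 - N' * y ^ 2" using True by simp
    then have uC2: "\<not> p dvd C2" and LC2: "Legendre C2 p = Legendre (N' * y ^ 2) p"
      using uN by (rule unit_diff, intro Leg_cong)
    then have LC2: "Legendre C2 p = Legendre N' p" by (simp add: Leg_mult Ly)
    have px: "\<not> p dvd x"
    proof
      assume "p dvd x"
      then have "p dvd a' * x ^ 2" by (simp add: p_dvd_mult p_dvd_sq)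
      then show False using True uN by (simp add: C1_def dvd_add_right_iff)
    qed
    have "Legendre (a' * x ^ 2) p = Legendre (- (N' * y ^ 2)) p" using True by (intro Leg_cong) (simp add: C1_def)
    then have La: "Legendre a' p = e * Legendre N' p"
      using Legendre_square[OF p(1) px] by (simp add: Leg_mult Ly neg)
    have pb: "\<not> p dvd b"
    proof
      assume "p dvd b"
      then obtain b' where b': "b = p * b'" by blast
      have "\<not> p dvd b'" using sqf_quot[OF b b'] .
      moreover have "p * (b' * a') * z ^ 2 = C2 * w ^ 2"
      proof -
        have "p * (p * (b' * a') * z ^ 2) = p * (C2 * w ^ 2)" using baz by (simp add: b' a' AC mult_ac)
        then show ?thesis using p0 by simp
      qed
      ultimately show False using odd_valuation_contra[of p "b' * a'" z C2 w] p pa' uC2 z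
        by (simp add: p_dvd_mult)
    qed
    have "Legendre (b * a' * C2) p = 1"
    proof (rule sq_ratio_Legendre[OF p, of _ z _ w])
      have "p * (b * a' * z ^ 2) = p * (C2 * w ^ 2)" using baz by (simp add: a' AC mult_ac)
      then show "b * a' * z ^ 2 = C2 * w ^ 2" using p0 by simp
    qed (use pb pa' uC2 z in \<open>auto simp: p_dvd_mult\<close>)
    then have "Legendre b p * (e * (Legendre N' p * Legendre N' p)) = 1"
      by (simp add: Leg_mult LC2 La mult_ac)
    then have "Legendre (- b) p = 1" using Leg_sq[OF pN'] by (simp add: neg mult_ac)
    moreover have "Legendre (- (a' * N')) p = 1"

    proof -
      have "Legendre (- (a' * N')) p = (e * e) * (Legendre N' p * Legendre N' p)"
        by (simp add: neg Leg_mult La mult_ac)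
      then show ?thesis using L1 Leg_sq[OF pN'] by simp
    qed
    ultimately show ?thesis using pb by auto
  next
    case False
    then have C2: "p dvd C2" using one by simp
    have "C1 - - (N' * y ^ 2) = C2" by (simp add: C1_def C2_def algebra_simps)
    then have "p dvd C1 - - (N' * y ^ 2)" using C2 by simp
    then have LC1: "Legendre C1 p = e * Legendre N' p"
      using Leg_cong[of C1 "- (N' * y ^ 2)"] by (simp add: Leg_mult Ly neg)
    have px: "\<not> p dvd x"
    proof
      assume "p dvd x"
      then have "p dvd a' * x ^ 2" by (simp add: p_dvd_mult p_dvd_sq)
      then have "p dvd 2 * N' * y ^ 2" using C2 by (simp add: C2_def dvd_add_right_iff)
      then show False using uN not_p_dvd_1 by (simp add: p_dvd_mult)
    qed
    have "Legendre (a' * x ^ 2) p = Legendre (- (2 * N' * y ^ 2)) p" using C2 by (intro Leg_cong) (simp add: C2_def)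
    then have La: "Legendre a' p = e * (Legendre 2 p * Legendre N' p)"
      using Legendre_square[OF p(1) px] by (simp add: Leg_mult Ly neg)
    have L2: "Legendre 2 p * Legendre 2 p = 1" using Leg_sq not_p_dvd_1 by blast
    have "p dvd b"
    proof (rule ccontr)
      assume "\<not> p dvd b"
      then show False using odd_valuation_contra_1[of p "b * C1" w] p False w AC
        by (simp add: p_dvd_mult mult_ac)
    qed
    moreover have "Legendre (- 2 * (a' * N')) p = 1 \<and> Legendre (- (b' * N')) p = 1" if b': "b = p * b'" for b'
    proof
      have pb': "\<not> p dvd b'" using sqf_quot[OF b b'] .
      have "Legendre (b' * C1 * 1) p = 1"
      proof (rule sq_ratio_Legendre[OF p, of _ p _ w])
        show "b' * C1 * p ^ 2 = 1 * w ^ 2" using w by (simp add: AC b' power2_eq_square mult_ac)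
      qed (use False pb' p0 p_abs in \<open>auto simp: p_dvd_mult\<close>)
      then show "Legendre (- (b' * N')) p = 1" by (simp add: Leg_mult LC1 neg mult_ac)
      have "Legendre (- 2 * (a' * N')) p = (e * e) * (Legendre 2 p * Legendre 2 p) * (Legendre N' p * Legendre N' p)"
        using Leg_mult[of "-2" "a' * N'"] neg[of 2] by (simp add: Leg_mult La mult_ac)
      then show "Legendre (- 2 * (a' * N')) p = 1" using L1 L2 Leg_sq[OF pN'] by simp
    qed
    ultimately show ?thesis by auto
  qed
qed

end

section \<open>From rational points to primitive integral points\<close>

lemma rat_square_int_imp_int:
  fixes r :: rat
  assumes "r ^ 2 = of_int k" shows "\<exists>n. r = of_int n"
proof -
  obtain p q where pq: "quotient_of r = (p, q)" by fastforce
  then have q: "q > 0" "coprime p q" and r: "r = of_int p / of_int q"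
    using quotient_of_denom_pos quotient_of_coprime quotient_of_div by blast+
  have "(of_int (p ^ 2) :: rat) = of_int (k * q ^ 2)"
    using assms q by (simp add: r power_divide field_simps)
  then have "p ^ 2 = k * q ^ 2" unfolding of_int_eq_iff .
  then have "q ^ 2 dvd p ^ 2" by simp
  then have "q dvd p" by simp
  then have "is_unit q" using q(2) by (meson coprime_common_divisor dvd_refl)
  then have "q = 1" using q by simp
  then show ?thesis using r by auto
qed

text \<open>The form is homogeneous of degree 4: the common denominator and the content of
  \<open>(x, y)\<close> combine to one scaling factor, whose square scales \<open>z\<close>. The new
  \<open>z\<close> is rational with integral square, hence integral.\<close>

lemma soluble_imp_int_solution:
  assumes "soluble a B c"
  shows "\<exists>x y z :: int. coprime x y \<and> z ^ 2 = quartic a B c x y"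
proof -
  obtain x y z :: rat where nz: "(x, y) \<noteq> (0, 0)" and eq: "z ^ 2 = quartic a B c x y"
    using assms unfolding soluble_def by blast
  obtain x1 x2 where x12: "quotient_of x = (x1, x2)" by fastforce
  obtain y1 y2 where y12: "quotient_of y = (y1, y2)" by fastforce
  have pos: "x2 > 0" "y2 > 0" using x12 y12 quotient_of_denom_pos by blast+
  have xq: "x = of_int x1 / of_int x2" "y = of_int y1 / of_int y2" using x12 y12 quotient_of_div by blast+
  define X where "X = x1 * y2"
  define Y where "Y = y1 * x2"
  define D where "D = x2 * y2"
  have D: "D > 0" using pos by (simp add: D_def)
  have xX: "x = of_int X / of_int D" "y = of_int Y / of_int D" using pos by (simp_all add: xq X_def Y_def D_def)
  define g where "g = gcd X Y"
  have g: "g \<noteq> 0" using nz xX by (auto simp: g_def)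
  obtain X' Y' where XY: "X = X' * g" "Y = Y' * g" "coprime X' Y'"
    using gcd_coprime_exists[of X Y] g unfolding g_def by blast
  define r where "r = z * (of_int D / of_int g) ^ 2"
  have g': "(of_int g :: rat) \<noteq> 0" and D': "(of_int D :: rat) \<noteq> 0" using g D by auto
  have xs: "x * (of_int D / of_int g) = of_int X'" "y * (of_int D / of_int g) = of_int Y'"
    using g' D' by (simp_all add: xX XY)
  have "r ^ 2 = z ^ 2 * (of_int D / of_int g) ^ 4" by (simp add: r_def power_mult_distrib power_mult[symmetric])
  also have "\<dots> = quartic a B c (x * (of_int D / of_int g)) (y * (of_int D / of_int g))"
  proof -
    have "quartic a B c x y * k ^ 4 = quartic a B c (x * k) (y * k)" for k :: rat
      by (simp add: quartic_def algebra_simps power2_eq_square power4_eq_xxxx)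
    then show ?thesis unfolding eq .
  qed
  also have "\<dots> = of_int (quartic a B c X' Y')" unfolding xs by (simp add: quartic_def)
  finally obtain n where n: "r = of_int n" using rat_square_int_imp_int by blast
  have "(of_int (n ^ 2) :: rat) = of_int (quartic a B c X' Y')"
    using \<open>r ^ 2 = _\<close> n \<open>z ^ 2 * _ = _\<close> \<open>quartic a B c (x * _) _ = _\<close> by simp
  then have "n ^ 2 = quartic a B c X' Y'" unfolding of_int_eq_iff .
  then show ?thesis using XY by blast
qed

lemma squarefree_eq_of_square_ratio:
  fixes a a' s t :: int
  assumes "squarefree a" "squarefree a'" and eq: "a * s ^ 2 = a' * t ^ 2" and s: "s \<noteq> 0"
  shows "a = a'"
proof -
  define g where "g = gcd s t"
  have g: "g \<noteq> 0" using s by (simp add: g_def)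
  obtain s' t' where st: "s = s' * g" "t = t' * g" "coprime s' t'"
    using gcd_coprime_exists[of s t] g unfolding g_def by blast
  have eq': "a * s' ^ 2 = a' * t' ^ 2"
  proof -
    have "a * s' ^ 2 * g ^ 2 = a' * t' ^ 2 * g ^ 2" using eq st by (simp add: power_mult_distrib mult_ac)
    then show ?thesis using g by simp
  qed
  have cop: "coprime (s' ^ 2) (t' ^ 2)" using st by simp
  have "t' ^ 2 dvd a * s' ^ 2" unfolding eq' by simp
  then have "t' ^ 2 dvd a" using cop by (simp add: coprime_dvd_mult_left_iff coprime_commute)
  then have t1: "t' dvd 1" using squarefreeD[OF assms(1)] by blast
  have "s' ^ 2 dvd a' * t' ^ 2" unfolding eq'[symmetric] by simp
  then have "s' ^ 2 dvd a'" using cop by (simp add: coprime_dvd_mult_left_iff)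
  then have s1: "s' dvd 1" using squarefreeD[OF assms(2)] by blast
  have "\<bar>s'\<bar> ^ 2 = 1" "\<bar>t'\<bar> ^ 2 = 1" using s1 t1 by simp_all
  then have "s' ^ 2 = 1" "t' ^ 2 = 1" by simp_all
  then show ?thesis using eq' by simp
qed

section \<open>Encoding of the descent parameters\<close>

definition unit2 :: "int set" where "unit2 = {1, -1, 2, -2}"

lemma unit2_I:
  fixes u :: int
  assumes u: "squarefree u" and odd: "\<And>p. prime p \<Longrightarrow> p dvd u \<Longrightarrow> p = 2"
  shows "u \<in> unit2"
proof -
  have u0: "u \<noteq> 0" using u not_squarefree_0 by metis
  have unit: "v \<in> {1, -1}" if "v \<noteq> 0" "\<And>p. prime p \<Longrightarrow> \<not> p dvd v" for v :: int
  proof -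
    have "is_unit v" using that prime_divisor_exists[of v] by blast
    then show ?thesis by (auto simp: abs_if split: if_splits)
  qed
  show ?thesis
  proof (cases "2 dvd u")
    case True
    then obtain v where v: "u = 2 * v" by blast
    have v2: "\<not> 2 dvd v" using squarefree_prime_quotient[of 2 u v] u v by simp
    have "v \<in> {1, -1}"
    proof (rule unit)
      show "v \<noteq> 0" using u0 v by simp
      fix p :: int assume p: "prime p"
      show "\<not> p dvd v"
      proof
        assume pv: "p dvd v"
        then have "p dvd u" by (simp add: v)
        then have "p = 2" using odd p by blast
        then show False using pv v2 by simp
      qed
    qed
    then show ?thesis by (auto simp: v unit2_def)
  next
    case False
    have "u \<in> {1, -1}" using u0 odd False by (intro unit) blast+
    then show ?thesis by (auto simp: unit2_def)
  qed
qed

lemma prod_primes_dvd: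
  assumes "finite A" "\<And>q. q \<in> A \<Longrightarrow> prime q \<and> int q dvd u" shows "(\<Prod>q\<in>A. int q) dvd u"
  using assms
proof (induction A rule: finite_induct)
  case (insert q A)
  have "coprime (int q) (\<Prod>r\<in>A. int r)"
  proof (rule prod_coprime_right)
    fix r assume "r \<in> A"
    then show "coprime (int q) (int r)" using insert by (metis coprime_int_iff insertI1 insertI2 primes_coprime)
  qed
  then show ?case using insert by (simp add: divides_mult)
qed simp

lemma squarefree_factorization:
  fixes u :: int
  assumes u: "squarefree u" and m: "m > 0" and supp: "\<And>p. prime p \<Longrightarrow> p dvd u \<Longrightarrow> p = 2 \<or> p dvd int m"
  shows "\<exists>\<alpha>\<in>unit2. u = \<alpha> * (\<Prod>q\<in>{q \<in> prime_factors m. int q dvd u}. int q)"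
proof -
  define d where "d = (\<Prod>q\<in>{q \<in> prime_factors m. int q dvd u}. int q)"
  have "d dvd u" unfolding d_def by (rule prod_primes_dvd) (auto simp: in_prime_factors_iff)
  then obtain \<alpha> where \<alpha>: "u = \<alpha> * d" by (metis dvdE mult.commute)
  have "\<alpha> \<in> unit2"
  proof (rule unit2_I)
    show "squarefree \<alpha>" using u \<alpha> squarefree_mono[of \<alpha> u] by simp
    fix p :: int assume p: "prime p" "p dvd \<alpha>"
    show "p = 2"
    proof (rule ccontr)
      assume "p \<noteq> 2"
      have pu: "p dvd u" using p \<alpha> by simp
      then have pm: "p dvd int m" using supp p \<open>p \<noteq> 2\<close> by blast
      define q where "q = nat p"
      have q: "p = int q" "prime q" using p prime_gt_0_int[of p] by (simp_all add: q_def)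
      have "q \<in> {q \<in> prime_factors m. int q dvd u}" using q pm pu m by (simp add: in_prime_factors_iff)
      then have "p dvd d" unfolding d_def q by (intro dvd_prodI) auto
      moreover obtain \<alpha>' where \<alpha>': "\<alpha> = p * \<alpha>'" using p by blast
      ultimately show False using squarefree_prime_quotient[OF p(1) u, of "\<alpha>' * d"] \<alpha> by (simp add: mult.assoc)
    qed
  qed
  then show ?thesis using \<alpha> unfolding d_def by blast
qed

text \<open>The pair \<open>i\<close> says whether \<open>p\<close> divides \<open>a\<close> and
  \<open>b\<close>. Over the types (no, no), (no, yes), (yes, no), (yes, yes) the descent requires
  the symbols of \<open>a\<close>, \<open>2 * a\<close>, \<open>- (a' * N')\<close>,
  \<open>- 2 * (a' * N')\<close> to be 1, and also those of \<open>b\<close>,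
  \<open>b' * N'\<close>, \<open>- b\<close>, \<open>- (b' * N')\<close>. \<open>scoef1\<close> and
  \<open>scoef2\<close> are the constants in these expressions.\<close>

definition scoef1 :: "int \<Rightarrow> int \<Rightarrow> bool \<times> bool \<Rightarrow> int" where
  "scoef1 \<nu> \<alpha> i = (if fst i then - \<nu> else 1) * (if snd i then 2 else 1) * \<alpha>"

definition scoef2 :: "int \<Rightarrow> int \<Rightarrow> bool \<times> bool \<Rightarrow> int" where
  "scoef2 \<nu> \<beta> i = (if fst i then -1 else 1) * (if snd i then \<nu> else 1) * \<beta>"

definition sym1 :: "nat set \<Rightarrow> int \<Rightarrow> int \<Rightarrow> (nat \<Rightarrow> bool \<times> bool) \<Rightarrow> nat \<Rightarrow> int" where
  "sym1 P \<nu> \<alpha> t p = Legendre (scoef1 \<nu> \<alpha> (t p) * (\<Prod>q\<in>{q \<in> P. fst (t q) \<noteq> fst (t p)}. int q)) (int p)"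

definition sym2 :: "nat set \<Rightarrow> int \<Rightarrow> int \<Rightarrow> (nat \<Rightarrow> bool \<times> bool) \<Rightarrow> nat \<Rightarrow> int" where
  "sym2 P \<nu> \<beta> t p = Legendre (scoef2 \<nu> \<beta> (t p) * (\<Prod>q\<in>{q \<in> P. snd (t q) \<noteq> snd (t p)}. int q)) (int p)"

text \<open>Here \<open>N = \<nu> m\<close>, \<open>t p\<close> records whether the prime \<open>p\<close> divides \<open>a\<close> and \<open>b\<close>, and \<open>\<alpha>\<close> and \<open>\<beta>\<close> are
  what remains of \<open>a\<close> and \<open>b\<close> outside the primes dividing \<open>m\<close>.\<close>

definition Sel :: "int \<Rightarrow> nat \<Rightarrow> int \<Rightarrow> int \<Rightarrow> (nat \<Rightarrow> bool \<times> bool) set" where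
  "Sel \<nu> m \<alpha> \<beta> = {t \<in> prime_factors m \<rightarrow>\<^sub>E UNIV. \<forall>p\<in>prime_factors m.
      sym1 (prime_factors m) \<nu> \<alpha> t p = 1 \<and> sym2 (prime_factors m) \<nu> \<beta> t p = 1}"

lemma finite_Sel [simp]: "finite (Sel \<nu> m \<alpha> \<beta>)"
  unfolding Sel_def by (rule finite_subset[of _ "prime_factors m \<rightarrow>\<^sub>E UNIV"]) (auto intro: finite_PiE)

text \<open>Applied to \<open>a' * N'\<close>: the primes other than \<open>p\<close> that divide
  \<open>a\<close> occur twice and drop out, which leaves the primes of \<open>P\<close> prime to
  \<open>a\<close>. Thus for every type the symbol involves just the primes whose status differs
  from that of \<open>p\<close>, the uniform shape of \<open>sym1\<close> and
  \<open>sym2\<close>.\<close>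

lemma Legendre_complement:
  assumes P: "finite P" "\<And>q. q \<in> P \<Longrightarrow> prime q" and B: "B \<subseteq> P" and p: "p \<in> B" "2 < p"
  shows "Legendre (k * ((\<Prod>q\<in>B - {p}. int q) * (\<Prod>q\<in>P - {p}. int q))) (int p)
    = Legendre (k * (\<Prod>q\<in>P - B. int q)) (int p)"
proof -
  have pp: "prime p" using p P B by blast
  define D where "D = (\<Prod>q\<in>B - {p}. int q)"
  have fin: "finite B" using B P finite_subset by blast
  have "P - {p} = (B - {p}) \<union> (P - B)" using B p by blast
  then have split: "(\<Prod>q\<in>P - {p}. int q) = D * (\<Prod>q\<in>P - B. int q)"
    unfolding D_def using P fin by (simp add: prod.union_disjoint Int_Diff) (subst prod.union_disjoint, auto)
  have "\<not> int p dvd D"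
  proof
    assume "int p dvd D"
    then obtain q where q: "q \<in> B - {p}" "int p dvd int q"
      unfolding D_def using pp fin by (metis finite_Diff prime_dvd_prod_iff prime_nat_int_transfer)
    then have "p dvd q" by simp
    then show False using q pp P B by (metis DiffD1 DiffD2 primes_dvd_imp_eq singletonI subsetD)
  qed
  then have sq: "Legendre (D ^ 2) (int p) = 1" using pp by (intro Legendre_square) auto
  have "k * (D * (\<Prod>q\<in>P - {p}. int q)) = (k * (\<Prod>q\<in>P - B. int q)) * D ^ 2"
    by (simp add: split power2_eq_square mult_ac)
  then have "Legendre (k * (D * (\<Prod>q\<in>P - {p}. int q))) (int p) = Legendre ((k * (\<Prod>q\<in>P - B. int q)) * D ^ 2) (int p)"
    by (rule arg_cong)
  also have "\<dots> = Legendre (k * (\<Prod>q\<in>P - B. int q)) (int p)"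
    using Legendre_mult[OF pp p(2), of "k * (\<Prod>q\<in>P - B. int q)" "D ^ 2"] sq by simp
  finally show ?thesis unfolding D_def .
qed

text \<open>Collects the local conditions at all primes of \<open>m\<close>. The sign and the prime
  2 are left to \<open>\<alpha>\<close> and \<open>\<beta>\<close>, each with four possible values,
  so that the only unbounded datum is the type function \<open>t\<close>.\<close>

lemma two_descent_Sel:
  assumes "two_descent (\<nu> * int m) a b x y z w A1 A2"
    and \<nu>: "\<nu> \<in> unit2" and m: "odd m" "squarefree m"
    and aN: "a dvd 2 * (\<nu> * int m) ^ 2"
  shows "\<exists>\<alpha>\<in>unit2. \<exists>\<beta>\<in>unit2. \<exists>t\<in>Sel \<nu> m \<alpha> \<beta>. a = \<alpha> * (\<Prod>q\<in>{q \<in> prime_factors m. fst (t q)}. int q)"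
proof -
  interpret two_descent "\<nu> * int m" a b x y z w A1 A2 by fact
  define P where "P = prime_factors m"
  have m0: "m > 0" using m odd_pos by blast
  have P: "finite P" "prime p" "2 < p" if "p \<in> P" for p
    using that m odd_prime_factor_gt_2 by (auto simp: P_def in_prime_factors_iff)
  have finP: "finite P" by (simp add: P_def)
  have \<nu>2: "p dvd \<nu> \<Longrightarrow> p = 2" if "prime p" for p :: int
  proof -
    assume "p dvd \<nu>"
    then have "p dvd 2" using \<nu> that by (auto simp: unit2_def)
    then show "p = 2" using that primes_dvd_imp_eq[of p 2] by simp
  qed
  have supp_N: "p = 2 \<or> p dvd int m" if "prime p" "p dvd \<nu> * int m" for p
    using that \<nu>2 prime_dvd_mult_iff by blast
  have supp_a: "p = 2 \<or> p dvd int m" if "prime p" "p dvd a" for p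
  proof -
    have "p dvd 2 * (\<nu> * int m) ^ 2" using that aN dvd_trans by blast
    then have "p dvd 2 \<or> p dvd \<nu> * int m" using that by (metis prime_dvd_mult_iff prime_dvd_power)
    then show ?thesis using supp_N that primes_dvd_imp_eq[of p 2] by auto
  qed
  have supp_b: "p = 2 \<or> p dvd int m" if "prime p" "p dvd b" for p
    using that b_support supp_a supp_N by blast
  define A where "A = {q \<in> P. int q dvd a}"
  define B where "B = {q \<in> P. int q dvd b}"
  obtain \<alpha> where \<alpha>: "\<alpha> \<in> unit2" "a = \<alpha> * (\<Prod>q\<in>A. int q)"
    using squarefree_factorization[OF a m0 supp_a] unfolding A_def P_def by blast
  obtain \<beta> where \<beta>: "\<beta> \<in> unit2" "b = \<beta> * (\<Prod>q\<in>B. int q)"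
    using squarefree_factorization[OF b m0 supp_b] unfolding B_def P_def by blast
  define t where "t = (\<lambda>q\<in>P. (q \<in> A, q \<in> B))"
  have sub: "A \<subseteq> P" "B \<subseteq> P" by (auto simp: A_def B_def)
  have finAB: "finite A" "finite B" using sub finP finite_subset by blast+
  have sets: "{q \<in> P. fst (t q)} = A" "{q \<in> P. snd (t q)} = B" "{q \<in> P. \<not> fst (t q)} = P - A" "{q \<in> P. \<not> snd (t q)} = P - B"
    using sub by (auto simp: t_def)
  have m_prod: "int m = (\<Prod>q\<in>P. int q)"
  proof -
    have "int m = int (\<Prod>P)" using prod_prime_factors_squarefree[OF m(2)] by (simp only: P_def)
    then show ?thesis by simp
  qed
  have cond: "sym1 P \<nu> \<alpha> t p = 1 \<and> sym2 P \<nu> \<beta> t p = 1" if pP: "p \<in> P" for p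
  proof -
    note pp = P(2)[OF pP] P(3)[OF pP]
    define N' where "N' = \<nu> * (\<Prod>q\<in>P - {p}. int q)"
    have N': "\<nu> * int m = int p * N'" unfolding N'_def m_prod using finP pP by (simp add: prod.remove mult_ac)
    have pN': "\<not> int p dvd N'"
    proof
      assume "int p dvd N'"
      moreover have "\<not> int p dvd \<nu>" using \<nu>2[of "int p"] pp by auto
      ultimately have "int p dvd (\<Prod>q\<in>P - {p}. int q)" using pp by (simp add: N'_def prime_dvd_mult_iff)
      then obtain q where q: "q \<in> P - {p}" "int p dvd int q"
        using pp finP by (metis finite_Diff prime_dvd_prod_iff prime_nat_int_transfer)
      then have "p dvd q" by simp
      then show False using q pp P(2) by (metis DiffD1 DiffD2 primes_dvd_imp_eq singletonI)
    qed
    interpret two_descent_at "\<nu> * int m" a b x y z w A1 A2 "int p" N'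
      by unfold_locales (use pp N' pN' in auto)
    have quot: "p \<in> X \<Longrightarrow> X \<subseteq> P \<Longrightarrow> (\<Prod>q\<in>X. int q) = int p * (\<Prod>q\<in>X - {p}. int q)" for X
      using finP by (meson finite_subset prod.remove)
    have compl: "p \<in> X \<Longrightarrow> X \<subseteq> P \<Longrightarrow> Legendre (k * ((\<gamma> * (\<Prod>q\<in>X - {p}. int q)) * N')) (int p)
        = Legendre (k * \<nu> * \<gamma> * (\<Prod>q\<in>P - X. int q)) (int p)" for X k \<gamma>
      using Legendre_complement[OF finP P(2), of X p "k * \<nu> * \<gamma>"] pp by (simp add: N'_def mult_ac)
    have tp: "t p = (p \<in> A, p \<in> B)" using pP by (simp add: t_def)
    show ?thesis
    proof (cases "p \<in> A")
      case False
      then have pa: "\<not> int p dvd a" using pP by (simp add: A_def)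
      show ?thesis
      proof (cases "p \<in> B")
        case False2: False
        then have "\<not> int p dvd b" using pP by (simp add: B_def)
        then have "Legendre a (int p) = 1" "Legendre b (int p) = 1" using case_a_unit[OF pa] by blast+
        then show ?thesis using False False2 by (simp add: sym1_def sym2_def tp scoef1_def scoef2_def sets \<alpha> \<beta>)
      next
        case True
        have b': "b = int p * (\<beta> * (\<Prod>q\<in>B - {p}. int q))" using quot[OF True sub(2)] \<beta> by simp
        have "Legendre (2 * a) (int p) = 1" "Legendre (1 * ((\<beta> * (\<Prod>q\<in>B - {p}. int q)) * N')) (int p) = 1"
          using case_a_unit[OF pa] b' by auto
        then show ?thesis using False True compl[OF True sub(2), of 1 \<beta>]
          by (simp add: sym1_def sym2_def tp scoef1_def scoef2_def sets \<alpha> mult.assoc)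
      qed
    next
      case True
      have a': "a = int p * (\<alpha> * (\<Prod>q\<in>A - {p}. int q))" using quot[OF True sub(1)] \<alpha> by simp
      show ?thesis
      proof (cases "p \<in> B")
        case False
        then have "\<not> int p dvd b" using pP by (simp add: B_def)
        then have "Legendre (- b) (int p) = 1" "Legendre (-1 * ((\<alpha> * (\<Prod>q\<in>A - {p}. int q)) * N')) (int p) = 1"
          using case_a_div[OF a'] by auto
        then show ?thesis using False True compl[OF True sub(1), of "-1" \<alpha>]
          by (simp add: sym1_def sym2_def tp scoef1_def scoef2_def sets \<beta> mult.assoc)
      next
        case True2: True
        have b': "b = int p * (\<beta> * (\<Prod>q\<in>B - {p}. int q))" using quot[OF True2 sub(2)] \<beta> by simp
        have "Legendre (- 2 * ((\<alpha> * (\<Prod>q\<in>A - {p}. int q)) * N')) (int p) = 1"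
          "Legendre (- 1 * ((\<beta> * (\<Prod>q\<in>B - {p}. int q)) * N')) (int p) = 1"
          using case_a_div[OF a'] b' by auto
        then show ?thesis using True True2 compl[OF True sub(1), of "-2" \<alpha>] compl[OF True2 sub(2), of "-1" \<beta>]
          by (simp add: sym1_def sym2_def tp scoef1_def scoef2_def sets mult_ac)
      qed
    qed
  qed
  have "t \<in> Sel \<nu> m \<alpha> \<beta>" unfolding Sel_def P_def[symmetric] using cond by (auto simp: t_def)
  moreover have "a = \<alpha> * (\<Prod>q\<in>{q \<in> prime_factors m. fst (t q)}. int q)" using \<alpha> sets unfolding P_def by simp
  ultimately show ?thesis using \<alpha> \<beta> by blast
qed

text \<open>Treats the points with \<open>A1 = 0\<close> or \<open>A2 = 0\<close>, which have no
  descent parameter \<open>b\<close>. They force \<open>a\<close> into the square class of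
  \<open>- k\<close>, with \<open>k = N\<close> or \<open>k = 2 * N\<close>, and a square class
  contains only one squarefree integer.\<close>

lemma card_exceptional:
  assumes k: "(k::int) \<noteq> 0"
  shows "finite {a. squarefree a \<and> (\<exists>x y. coprime x y \<and> a * x ^ 2 + k * y ^ 2 = 0)} \<and>
    card {a. squarefree a \<and> (\<exists>x y. coprime x y \<and> a * x ^ 2 + k * y ^ 2 = 0)} \<le> 1"
proof -
  define E where "E = {a. squarefree a \<and> (\<exists>x y. coprime x y \<and> a * x ^ 2 + k * y ^ 2 = 0)}"
  have "a = a'" if aE: "a \<in> E" "a' \<in> E" for a a'
  proof -
    obtain x y where xy: "coprime x y" "a * x ^ 2 + k * y ^ 2 = 0" using aE by (auto simp: E_def)
    obtain x' y' where xy': "coprime x' y'" "a' * x' ^ 2 + k * y' ^ 2 = 0" using aE by (auto simp: E_def)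
    have sq: "squarefree a" "squarefree a'" using aE by (auto simp: E_def)
    have nz: "a \<noteq> 0" "a' \<noteq> 0" using sq not_squarefree_0 by metis+
    have y0: "y \<noteq> 0" using xy nz by auto
    have x0: "x \<noteq> 0" using xy y0 k by auto
    have y0': "y' \<noteq> 0" using xy' nz by auto
    have "a * x ^ 2 = - k * y ^ 2" "a' * x' ^ 2 = - k * y' ^ 2" using xy xy' by linarith+
    then have "(a * x ^ 2) * y' ^ 2 = (a' * x' ^ 2) * y ^ 2" by simp
    then have "a * (x * y') ^ 2 = a' * (x' * y) ^ 2" by (simp add: power_mult_distrib mult.assoc)
    then show "a = a'" by (rule squarefree_eq_of_square_ratio[OF sq]) (use x0 y0' in simp)
  qed
  then have "E = {} \<or> (\<exists>a. E = {a})" by blast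
  then show ?thesis unfolding E_def[symmetric] by auto
qed

text \<open>A form is determined by \<open>a\<close>, and \<open>a\<close> by a triple (\<alpha>,
  \<beta>, t), so counting triples gives an upper bound. The summand 2 is for the exceptional values
  of \<open>a\<close>, one for each factor that may vanish.\<close>

lemma card_formsF_sol_le:
  assumes \<nu>: "\<nu> \<in> unit2" and m: "odd m" "squarefree m" and N: "N = \<nu> * int m"
  shows "card (formsF_sol (3 * N) (2 * N ^ 2)) \<le> 2 + (\<Sum>\<alpha>\<in>unit2. \<Sum>\<beta>\<in>unit2. card (Sel \<nu> m \<alpha> \<beta>))"
proof -
  define S where "S = formsF_sol (3 * N) (2 * N ^ 2)"
  define E where "E k = {a. squarefree a \<and> (\<exists>x y. coprime x y \<and> a * x ^ 2 + k * y ^ 2 = 0)}" for k :: int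
  define G where "G = (SIGMA \<alpha>:unit2. SIGMA \<beta>:unit2. Sel \<nu> m \<alpha> \<beta>)"
  define g where "g \<alpha>\<beta>t = (case \<alpha>\<beta>t of (\<alpha>, \<beta>, t) \<Rightarrow> \<alpha> * (\<Prod>q\<in>{q \<in> prime_factors m. fst (t q)}. int q))" for \<alpha>\<beta>t :: "int \<times> int \<times> (nat \<Rightarrow> bool \<times> bool)"
  have fu: "finite unit2" by (simp add: unit2_def)
  have N0: "N \<noteq> 0" using \<nu> m odd_pos[of m] by (auto simp: N unit2_def)
  have finG: "finite G" unfolding G_def using fu by auto
  have inj: "inj_on fst S"
  proof (rule inj_onI)
    fix u v assume uv: "u \<in> S" "v \<in> S" "fst u = fst v"
    then have "fst u * snd u = 2 * N ^ 2" "fst u * snd v = 2 * N ^ 2" "fst u \<noteq> 0"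
      by (auto simp: S_def formsF_sol_def formsF_def)
    then have "snd u = snd v" by (metis mult_left_cancel)
    then show "u = v" using uv by (simp add: prod_eq_iff)
  qed
  have sub: "fst ` S \<subseteq> E N \<union> E (2 * N) \<union> g ` G"
  proof
    fix a assume "a \<in> fst ` S"
    then obtain c where ac: "(a, c) \<in> S" by force
    have a: "a * c = 2 * N ^ 2" "a \<noteq> 0" "\<And>p. prime p \<Longrightarrow> multiplicity p a \<le> 1" and sol: "soluble a (3 * N) c"
      using ac by (auto simp: S_def formsF_sol_def formsF_def)
    have sqf: "squarefree a" using a by (simp add: squarefree_factorial_semiring'')
    obtain x y z :: int where xyz: "coprime x y" "z ^ 2 = quartic a (3 * N) c x y"
      using soluble_imp_int_solution[OF sol] by blast
    define A1 where "A1 = a * x ^ 2 + N * y ^ 2"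
    define A2 where "A2 = a * x ^ 2 + 2 * N * y ^ 2"
    have "a * z ^ 2 = a * (a * x ^ 4 + 3 * N * x ^ 2 * y ^ 2) + (a * c) * y ^ 4"
      unfolding xyz by (simp add: quartic_def algebra_simps)
    also have "\<dots> = A1 * A2" unfolding a(1) A1_def A2_def
      by (simp add: algebra_simps power2_eq_square power4_eq_xxxx)
    finally have eq: "a * z ^ 2 = A1 * A2" .
    show "a \<in> E N \<union> E (2 * N) \<union> g ` G"
    proof (cases "A1 = 0 \<or> A2 = 0")
      case True
      then show ?thesis using sqf xyz(1) unfolding E_def A1_def A2_def by blast
    next
      case False
      define b where "b = squarefree_part A1"
      define w where "w = b * square_part A1"
      have dec: "A1 = b * square_part A1 ^ 2" unfolding b_def by (rule squarefree_decompose)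
      have "b * A1 = b * (b * square_part A1 ^ 2)" using dec by (rule arg_cong)
      then have bw: "b * A1 = w ^ 2" by (simp add: w_def power2_eq_square mult_ac)
      have "squarefree b" unfolding b_def by (rule squarefree_squarefree_part)
      moreover have "z \<noteq> 0" using eq False by auto
      ultimately have "two_descent (\<nu> * int m) a b x y z w A1 A2"
        using sqf xyz(1) eq bw unfolding N[symmetric] by unfold_locales (simp_all add: A1_def A2_def)
      moreover have "a dvd 2 * (\<nu> * int m) ^ 2" using a(1) unfolding N[symmetric] by (metis dvd_triv_left)
      ultimately obtain \<alpha> \<beta> t where "\<alpha> \<in> unit2" "\<beta> \<in> unit2" "t \<in> Sel \<nu> m \<alpha> \<beta>"
        "a = \<alpha> * (\<Prod>q\<in>{q \<in> prime_factors m. fst (t q)}. int q)"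
        using two_descent_Sel[OF _ \<nu> m] by blast
      then have "(\<alpha>, \<beta>, t) \<in> G" "a = g (\<alpha>, \<beta>, t)" by (simp_all add: G_def g_def)
      then show ?thesis by blast
    qed
  qed
  have E: "finite (E N)" "card (E N) \<le> 1" "finite (E (2 * N))" "card (E (2 * N)) \<le> 1"
    using card_exceptional[of N] card_exceptional[of "2 * N"] N0 by (simp_all add: E_def)
  have "card S = card (fst ` S)" using inj by (simp add: card_image)
  also have "\<dots> \<le> card (E N \<union> E (2 * N) \<union> g ` G)" using sub E finG by (intro card_mono) auto
  also have "\<dots> \<le> card (E N \<union> E (2 * N)) + card (g ` G)" by (rule card_Un_le)
  also have "\<dots> \<le> (card (E N) + card (E (2 * N))) + card G"
    using finG by (intro add_mono card_Un_le card_image_le)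
  also have "\<dots> \<le> 2 + card G" using E by simp
  also have "card G = (\<Sum>\<alpha>\<in>unit2. \<Sum>\<beta>\<in>unit2. card (Sel \<nu> m \<alpha> \<beta>))"
    unfolding G_def using fu by (simp add: card_SigmaI)
  finally show ?thesis by (simp add: S_def)
qed

section \<open>Primes congruent to 3 or 5 modulo 8\<close>

definition chi8 :: "nat \<Rightarrow> real" where
  "chi8 n = (if n mod 8 \<in> {1, 7} then 1 else if n mod 8 \<in> {3, 5} then -1 else 0)"

lemma less_8_cases: "(r::nat) < 8 \<Longrightarrow> r = 0 \<or> r = 1 \<or> r = 2 \<or> r = 3 \<or> r = 4 \<or> r = 5 \<or> r = 6 \<or> r = 7"
  by arith

lemma mod_8_cases: "(n::nat) mod 8 = 0 \<or> n mod 8 = 1 \<or> n mod 8 = 2 \<or> n mod 8 = 3 \<or> n mod 8 = 4 \<or> n mod 8 = 5 \<or> n mod 8 = 6 \<or> n mod 8 = 7"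
  by (rule less_8_cases) simp

lemma chi8_mult: "chi8 (a * b) = chi8 a * chi8 b"
proof -
  have m: "(a * b) mod 8 = ((a mod 8) * (b mod 8)) mod 8" by (simp add: mod_mult_eq)
  show ?thesis unfolding chi8_def m
    using mod_8_cases[of a] mod_8_cases[of b] by (elim disjE) simp_all
qed

lemma chi8_1: "chi8 1 = 1" by (simp add: chi8_def)

lemma chi8_power: "chi8 (a ^ n) = chi8 a ^ n"
  by (induction n) (simp_all add: chi8_mult chi8_1[simplified])

lemma sum_chi8_le: "(\<Sum>b=1..B. chi8 b) \<le> 1"
proof -
  define g where "g r = (if r \<in> {1, 2} then 1 else if r \<in> {5, 6} then -1 else 0 :: real)" for r :: nat
  have "(\<Sum>b=1..B. chi8 b) = g (B mod 8)"
  proof (induction B)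
    case (Suc B)
    have "g (B mod 8) + chi8 (Suc B) = g (Suc B mod 8)"
      unfolding chi8_def g_def mod_Suc using mod_8_cases[of B] by (elim disjE) simp_all
    then show ?case using Suc by simp
  qed (simp add: g_def)
  then show ?thesis by (simp add: g_def)
qed

text \<open>Abel summation: the partial sums of \<open>chi8\<close> never exceed 1 and the
  differences of \<open>f\<close> are nonnegative, so replacing the partial sums by 1 leaves a sum
  that telescopes to \<open>f 1\<close>.\<close>

lemma sum_chi8_decreasing_le:
  fixes f :: "nat \<Rightarrow> real"
  assumes dec: "\<And>b. b \<ge> 1 \<Longrightarrow> f (Suc b) \<le> f b" and nn: "\<And>b. f b \<ge> 0"
  shows "(\<Sum>b=1..B. chi8 b * f b) \<le> f 1"
proof -
  define X where "X B = (\<Sum>b=1..B. chi8 b)" for B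
  have abel: "(\<Sum>b=1..B. chi8 b * f b) = X B * f (Suc B) + (\<Sum>b=1..B. X b * (f b - f (Suc b)))" for B
    by (induction B) (simp_all add: X_def algebra_simps)
  have tele: "f (Suc B) + (\<Sum>b=1..B. f b - f (Suc b)) = f 1" for B
    by (induction B) simp_all
  have "X B * f (Suc B) \<le> 1 * f (Suc B)" unfolding X_def by (intro mult_right_mono sum_chi8_le nn)
  moreover have "(\<Sum>b=1..B. X b * (f b - f (Suc b))) \<le> (\<Sum>b=1..B. 1 * (f b - f (Suc b)))"
    unfolding X_def using dec by (intro sum_mono mult_right_mono sum_chi8_le) auto
  ultimately show ?thesis using abel[of B] tele[of B] by simp
qed

text \<open>As \<open>chi8 n\<close> is the symbol (2 / n), the character of the quadratic field
  generated by the square root of 2, \<open>rchi n\<close> is the number of ideals of norm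
  \<open>n\<close> in that field.\<close>

definition rchi :: "nat \<Rightarrow> real" where "rchi n = (\<Sum>d | d dvd n. chi8 d)"

lemma rchi_prime_power_mult:
  assumes p: "prime p" and m: "m > 0" "\<not> p dvd m"
  shows "rchi (p ^ a * m) = (\<Sum>i\<le>a. chi8 p ^ i) * rchi m"
proof -
  have p0: "p > 0" using p prime_gt_0_nat by blast
  have cop: "coprime p d" if "d dvd m" for d using that p m by (meson dvd_trans prime_imp_coprime)
  have inj: "inj_on (\<lambda>(i, d). p ^ i * d) ({..a} \<times> {d. d dvd m})"
  proof (rule inj_onI, clarify)
    fix i d j e assume *: "d dvd m" "e dvd m" "p ^ i * d = p ^ j * e"
    have nd: "\<not> p dvd d" "\<not> p dvd e" "d > 0" "e > 0" using * m by (auto dest: dvd_trans intro!: Nat.gr0I)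
    have mult: "multiplicity p (p ^ i * d) = i" if "\<not> p dvd d" "d > 0" for i d
      using that p p0 by (simp add: prime_elem_multiplicity_mult_distrib not_dvd_imp_multiplicity_0)
    have "i = j" using mult[OF nd(1,3), of i] mult[OF nd(2,4), of j] *(3) by simp
    then show "i = j \<and> d = e" using *(3) p0 by simp
  qed
  have img: "{d. d dvd p ^ a * m} = (\<lambda>(i, d). p ^ i * d) ` ({..a} \<times> {d. d dvd m})"
  proof (intro equalityI subsetI)
    fix x assume "x \<in> {d. d dvd p ^ a * m}"
    then obtain u v where uv: "x = u * v" "u dvd p ^ a" "v dvd m" using division_decomp by blast
    then obtain i where "i \<le> a" "u = p ^ i" using divides_primepow_nat[OF p] by blast
    then show "x \<in> (\<lambda>(i, d). p ^ i * d) ` ({..a} \<times> {d. d dvd m})" using uv by force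
  qed (auto intro: mult_dvd_mono le_imp_power_dvd)
  have "rchi (p ^ a * m) = (\<Sum>(i, d)\<in>{..a} \<times> {d. d dvd m}. chi8 (p ^ i * d))"
    unfolding rchi_def img by (subst sum.reindex[OF inj]) (simp add: case_prod_unfold)
  also have "\<dots> = (\<Sum>i\<le>a. \<Sum>d | d dvd m. chi8 p ^ i * chi8 d)"
    by (simp add: sum.cartesian_product chi8_mult chi8_power)
  also have "\<dots> = (\<Sum>i\<le>a. chi8 p ^ i) * rchi m" by (simp add: rchi_def sum_product)
  finally show ?thesis .
qed

lemma rchi_1: "rchi 1 = 1" by (simp add: rchi_def chi8_1[simplified])

lemma sum_powers_chi8_nonneg: "(\<Sum>i\<le>a. chi8 p ^ i) \<ge> 0"
proof -
  have alt: "(\<Sum>i\<le>a. (-1) ^ i :: real) = (if even a then 1 else 0)" by (induction a) auto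
  have "chi8 p = 1 \<or> chi8 p = -1 \<or> chi8 p = 0" by (simp add: chi8_def)
  then consider "chi8 p = 1" | "chi8 p = -1" | "chi8 p = 0" by blast
  then show ?thesis
  proof cases
    case 2 then show ?thesis using alt by simp
  qed (auto intro: sum_nonneg)
qed

text \<open>By multiplicativity only prime powers matter, and there the value is a sum of successive
  powers of 1, -1 or 0, starting with 1.\<close>

lemma rchi_nonneg: "n > 0 \<Longrightarrow> rchi n \<ge> 0"
proof (induction n rule: less_induct)
  case (less n)
  show ?case
  proof (cases "n = 1")
    case True then show ?thesis using rchi_1 by simp
  next
    case False
    then obtain p where p: "prime p" "p dvd n" using prime_factor_nat by blast
    obtain m where m: "n = p ^ multiplicity p n * m" "\<not> p dvd m"
      using multiplicity_decompose'[of n p] less.prems p by (metis not_prime_unit gr_implies_not0)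
    have mult: "multiplicity p n > 0" using p less.prems by (simp add: prime_multiplicity_gt_zero_iff)
    have m0: "m > 0" using m less.prems by (cases m) auto
    have "1 < p ^ multiplicity p n" using prime_gt_1_nat[OF p(1)] mult by (intro one_less_power)
    then have "1 * m < p ^ multiplicity p n * m" using m0 by (intro mult_strict_right_mono) auto
    then have "m < n" using m(1) by simp
    then have "rchi m \<ge> 0" using less.IH m0 by blast
    then show ?thesis using rchi_prime_power_mult[OF p(1) m0 m(2), of "multiplicity p n"] m(1)
      sum_powers_chi8_nonneg by (metis mult_nonneg_nonneg)
  qed
qed

lemma rchi_sum_complement: "n > 0 \<Longrightarrow> rchi n = (\<Sum>d | d dvd n. chi8 (n div d))"
  unfolding rchi_def by (rule sum.reindex_bij_witness[of _ "\<lambda>d. n div d" "\<lambda>d. n div d"]) auto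

text \<open>The mean value theorem bounds each term from the second on by a difference of
  consecutive values of \<open>m powr (-\<delta>)\<close>, divided by \<open>\<delta>\<close>, and
  these differences telescope.\<close>

lemma sum_powr_le:
  assumes \<delta>: "\<delta> > 0" shows "(\<Sum>m=1..N. real m powr (-1 - \<delta>)) \<le> 1 + 1 / \<delta>"
proof -
  have step: "real (Suc m) powr (-1 - \<delta>) \<le> (real m powr (-\<delta>) - real (Suc m) powr (-\<delta>)) / \<delta>" if "m \<ge> 1" for m
  proof -
    have "\<exists>z::real. real m < z \<and> z < real (Suc m) \<and> real (Suc m) powr (-\<delta>) - real m powr (-\<delta>)
        = (real (Suc m) - real m) * (-\<delta> * z powr (-\<delta> - 1))"
      using that by (intro MVT2) (auto intro!: derivative_eq_intros)
    then obtain z where z: "real m < z" "z < real (Suc m)"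
      "real (Suc m) powr (-\<delta>) - real m powr (-\<delta>) = -\<delta> * z powr (-\<delta> - 1)" by auto
    have "real (Suc m) powr (-\<delta> - 1) \<le> z powr (-\<delta> - 1)" using z that \<delta> by (intro powr_mono2') auto
    then have "\<delta> * real (Suc m) powr (-\<delta> - 1) \<le> \<delta> * z powr (-\<delta> - 1)" using \<delta> by (intro mult_left_mono) auto
    also have "\<dots> = real m powr (-\<delta>) - real (Suc m) powr (-\<delta>)" using z(3) by linarith
    finally have "real (Suc m) powr (-\<delta> - 1) \<le> (real m powr (-\<delta>) - real (Suc m) powr (-\<delta>)) / \<delta>"
      using \<delta> by (simp add: pos_le_divide_eq mult.commute)
    moreover have "-\<delta> - 1 = -1 - \<delta>" by simp
    ultimately show ?thesis by (simp only:)
  qed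
  have "(\<Sum>m=1..Suc N. real m powr (-1 - \<delta>)) \<le> 1 + (1 - real (Suc N) powr (-\<delta>)) / \<delta>" for N
  proof (induction N)
    case (Suc N)
    have "(\<Sum>m=1..Suc (Suc N). real m powr (-1 - \<delta>)) \<le> 1 + (1 - real (Suc N) powr (-\<delta>)) / \<delta>
        + (real (Suc N) powr (-\<delta>) - real (Suc (Suc N)) powr (-\<delta>)) / \<delta>"
      using Suc step[of "Suc N"] by simp
    also have "\<dots> = 1 + (1 - real (Suc (Suc N)) powr (-\<delta>)) / \<delta>" using \<delta> by (simp add: field_simps)
    finally show ?case .
  qed simp
  moreover have "(1 - real (Suc M) powr (-\<delta>)) / \<delta> \<le> 1 / \<delta>" for M using \<delta> by (intro divide_right_mono) auto
  ultimately show ?thesis using \<delta> by (cases N) (auto intro: order_trans[OF _ add_left_mono])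
qed

text \<open>A truncated product zeta(1 + \<delta>) L(1 + \<delta>, chi8). For each cutoff the inner
  sum, twisted by the character, is at most its first term 1, so only the zeta factor
  contributes.\<close>

lemma sum_rchi_le:
  assumes \<delta>: "\<delta> > 0" shows "(\<Sum>n=1..N. rchi n * real n powr (-1 - \<delta>)) \<le> 1 + 1 / \<delta>"
proof -
  define f where "f n = real n powr (-1 - \<delta>)" for n
  have "(\<Sum>n=1..N. rchi n * f n) = (\<Sum>n=1..N. \<Sum>d | d dvd n. f d * (chi8 (n div d) * f (n div d)))"
  proof (rule sum.cong[OF refl])
    fix n assume n: "n \<in> {1..N}"
    have "rchi n * f n = (\<Sum>d | d dvd n. chi8 (n div d) * f n)"
      using rchi_sum_complement[of n] n by (simp add: sum_distrib_right)
    also have "\<dots> = (\<Sum>d | d dvd n. f d * (chi8 (n div d) * f (n div d)))"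
    proof (rule sum.cong[OF refl])
      fix d assume "d \<in> {d. d dvd n}"
      then have "real n = real d * real (n div d)" by (metis dvd_mult_div_cancel mem_Collect_eq of_nat_mult)
      then have "f n = f d * f (n div d)" by (simp add: f_def powr_mult)
      then show "chi8 (n div d) * f n = f d * (chi8 (n div d) * f (n div d))" by simp
    qed
    finally show "rchi n * f n = (\<Sum>d | d dvd n. f d * (chi8 (n div d) * f (n div d)))" .
  qed
  also have "\<dots> = (\<Sum>a=1..N. f a * (\<Sum>b=1..N div a. chi8 b * f b))"
    by (subst sum_divisor_pairs) (simp add: sum_distrib_left)
  also have "\<dots> \<le> (\<Sum>a=1..N. f a * 1)"
  proof (intro sum_mono mult_left_mono)
    fix a
    have "(\<Sum>b=1..N div a. chi8 b * f b) \<le> f 1"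
      using \<delta> by (intro sum_chi8_decreasing_le) (auto simp: f_def intro!: powr_mono2')
    then show "(\<Sum>b=1..N div a. chi8 b * f b) \<le> 1" by (simp add: f_def)
  qed (simp add: f_def)
  also have "\<dots> \<le> 1 + 1 / \<delta>" using sum_powr_le[OF \<delta>, of N] by (simp add: f_def)
  finally show ?thesis by (simp add: f_def)
qed

lemma prod_one_plus_eq_sum_Pow:
  fixes f :: "'a \<Rightarrow> 'b::comm_semiring_1"
  assumes "finite A" shows "(\<Prod>x\<in>A. 1 + f x) = (\<Sum>B\<in>Pow A. prod f B)"
  using assms
proof (induction A rule: finite_induct)
  case (insert x A)
  have "(\<Sum>B\<in>Pow (insert x A). prod f B) = (\<Sum>B\<in>Pow A. prod f B) + (\<Sum>B\<in>insert x ` Pow A. prod f B)"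
    unfolding Pow_insert using insert by (intro sum.union_disjoint) auto
  also have "(\<Sum>B\<in>insert x ` Pow A. prod f B) = (\<Sum>B\<in>Pow A. prod f (insert x B))"
    using insert by (intro sum.reindex_cong[of "insert x"] inj_onI) auto
  also have "\<dots> = (\<Sum>B\<in>Pow A. f x * prod f B)"
    using insert by (intro sum.cong refl prod.insert) (auto dest: finite_subset)
  finally show ?case using insert by (simp add: algebra_simps sum_distrib_left sum.distrib)
qed simp

lemma inj_on_prod_primes:
  assumes P: "finite P" "\<And>p. p \<in> P \<Longrightarrow> prime p" shows "inj_on (\<lambda>A. \<Prod>A :: nat) (Pow P)"
proof -
  have mem: "p \<in> A \<longleftrightarrow> p dvd \<Prod>A" if A: "A \<subseteq> P" and pP: "p \<in> P" for A p
  proof -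
    have fin: "finite A" using A P finite_subset by blast
    show ?thesis
    proof
      assume "p \<in> A" then show "p dvd \<Prod>A" using dvd_prodI[OF fin, of p "\<lambda>x. x"] by simp
    next
      assume "p dvd \<Prod>A"
      then obtain q where "q \<in> A" "p dvd q" using P(2)[OF pP] fin by (auto simp: prime_dvd_prod_iff)
      then show "p \<in> A" using P(2) pP A primes_dvd_imp_eq by blast
    qed
  qed
  show ?thesis
  proof (rule inj_onI)
    fix A B assume "A \<in> Pow P" "B \<in> Pow P" and eq: "\<Prod>A = \<Prod>B"
    then have s: "A \<subseteq> P" "B \<subseteq> P" by auto
    have "p \<in> A \<longleftrightarrow> p \<in> B" if "p \<in> P" for p using mem[OF s(1) that] mem[OF s(2) that] eq by simp
    then show "A = B" using s by blast
  qed
qed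

text \<open>This replaces the nonvanishing of \<open>L(1, chi8)\<close> by an upper bound for the primes with \<open>chi8 p = 1\<close>:
  there \<open>rchi\<close> takes the value 2, while its Dirichlet series has at most a simple pole at 1.\<close>

lemma prod_split_primes_le:
  assumes \<delta>: "\<delta> > 0" and P: "finite P" "\<And>p. p \<in> P \<Longrightarrow> prime p \<and> p mod 8 \<in> {1, 7::nat}"
  shows "(\<Prod>p\<in>P. 1 + 2 * real p powr (-1 - \<delta>)) \<le> 1 + 1 / \<delta>"
proof -
  have pos: "p > 0" if "p \<in> P" for p using P(2)[OF that] prime_gt_0_nat by blast
  have r: "rchi (\<Prod>A) = 2 ^ card A" if "A \<subseteq> P" for A
  proof -
    have "finite A" using that P finite_subset by blast
    then show ?thesis using that
    proof (induction A rule: finite_induct)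
      case empty then show ?case using rchi_1 by simp
    next
      case (insert p A)
      have p: "prime p" "p mod 8 \<in> {1, 7}" using insert P by auto
      have "\<not> p dvd \<Prod>A"
      proof
        assume "p dvd \<Prod>A"
        then obtain q where "q \<in> A" "p dvd q" using p insert.hyps by (auto simp: prime_dvd_prod_iff)
        then show False using P(2) p insert by (metis insert_subset primes_dvd_imp_eq subsetD)
      qed
      moreover have "\<Prod>A > 0" using insert pos by (intro prod_pos) auto
      ultimately have "rchi (p ^ 1 * \<Prod>A) = (\<Sum>i\<le>1. chi8 p ^ i) * rchi (\<Prod>A)"
        using p by (intro rchi_prime_power_mult)
      also have "(\<Sum>i\<le>1. chi8 p ^ i) = 2" using p by (simp add: chi8_def)
      finally show ?case using insert by simp
    qed
  qed
  define N where "N = \<Prod>P"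
  have N0: "N > 0" unfolding N_def using pos by (intro prod_pos) auto
  have "(\<Prod>p\<in>P. 1 + 2 * real p powr (-1 - \<delta>)) = (\<Sum>A\<in>Pow P. \<Prod>p\<in>A. 2 * real p powr (-1 - \<delta>))"
    using P by (intro prod_one_plus_eq_sum_Pow)
  also have "\<dots> = (\<Sum>A\<in>Pow P. rchi (\<Prod>A) * real (\<Prod>A) powr (-1 - \<delta>))"
  proof (rule sum.cong[OF refl])
    fix A assume A: "A \<in> Pow P"
    have "(\<Prod>p\<in>A. real p powr (-1 - \<delta>)) = (\<Prod>p\<in>A. real p) powr (-1 - \<delta>)" by (rule prod_powr_distrib[symmetric])
    then show "(\<Prod>p\<in>A. 2 * real p powr (-1 - \<delta>)) = rchi (\<Prod>A) * real (\<Prod>A) powr (-1 - \<delta>)"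
      using r[of A] A by (simp add: prod.distrib)
  qed
  also have "\<dots> = (\<Sum>n\<in>(\<lambda>A. \<Prod>A) ` Pow P. rchi n * real n powr (-1 - \<delta>))"
    using P sum.reindex[OF inj_on_prod_primes[of P], of "\<lambda>n. rchi n * real n powr (-1 - \<delta>)"] by (simp add: o_def)
  \<comment> \<open>The products of distinct subsets are distinct integers up to \<open>N\<close>,
    and nonnegativity of \<open>rchi\<close> allows all other integers to be added.\<close>
  also have "\<dots> \<le> (\<Sum>n=1..N. rchi n * real n powr (-1 - \<delta>))"
  proof (rule sum_mono2)
    show "(\<lambda>A. \<Prod>A) ` Pow P \<subseteq> {1..N}"
    proof clarify
      fix A assume A: "A \<subseteq> P"
      have "\<Prod>A dvd N" unfolding N_def using P A by (intro prod_dvd_prod_subset) auto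
      then show "\<Prod>A \<in> {1..N}" using N0 dvd_imp_le[of "\<Prod>A" N] by (auto intro!: Suc_leI Nat.gr0I)
    qed
  qed (auto intro!: mult_nonneg_nonneg rchi_nonneg)
  also have "\<dots> \<le> 1 + 1 / \<delta>" by (rule sum_rchi_le[OF \<delta>])
  finally show ?thesis .
qed

section \<open>Reciprocal sums over primes\<close>

lemma sum_inverse_squares_le: "(\<Sum>k=1..y. 1 / real k ^ 2) \<le> 2"
proof -
  have "(\<Sum>k=1..Suc y. 1 / real k ^ 2) \<le> 2 - 1 / real (Suc y)" for y
  proof (induction y)
    case (Suc y)
    have "1 / real (Suc (Suc y)) ^ 2 \<le> 1 / real (Suc y) - 1 / real (Suc (Suc y))"
      by (simp add: divide_simps power2_eq_square)
    then show ?case using Suc by simp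
  qed simp
  then have *: "(\<Sum>k=1..Suc z. 1 / real k ^ 2) \<le> 2" for z
    by (rule order_trans) simp
  show ?thesis
  proof (cases y)
    case (Suc z)
    show ?thesis unfolding Suc by (rule *)
  qed simp
qed

definition sqfree_upto :: "nat \<Rightarrow> nat set" where "sqfree_upto x = {n \<in> {1..x}. squarefree n}"

lemma finite_sqfree_upto [simp]: "finite (sqfree_upto x)" by (simp add: sqfree_upto_def)

definition primes_upto :: "nat \<Rightarrow> nat set" where "primes_upto y = {p. prime p \<and> p \<le> y}"

lemma finite_primes_upto [simp]: "finite (primes_upto y)"
  by (rule finite_subset[of _ "{..y}"]) (auto simp: primes_upto_def)

text \<open>Each \<open>n\<close> is uniquely \<open>m * k^2\<close> with \<open>m\<close>
  squarefree, and the sum of \<open>1 / k^2\<close> is at most 2.\<close>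

lemma harm_le_sum_sqfree: "harm y \<le> 2 * (\<Sum>m\<in>sqfree_upto y. 1 / real m)"
proof -
  define g where "g n = (square_part n, squarefree_part n)" for n :: nat
  define F where "F = (\<lambda>(k, m). 1 / real k ^ 2 * (1 / real m))"
  have dec: "n = squarefree_part n * square_part n ^ 2" for n :: nat by (rule squarefree_decompose)
  have inj: "inj_on g {1..y}"
    by (rule inj_onI) (metis g_def prod.inject dec)
  have sub: "g ` {1..y} \<subseteq> {1..y} \<times> sqfree_upto y"
  proof (rule image_subsetI)
    fix n assume n: "n \<in> {1..y}"
    then have nz: "n \<noteq> 0" by simp
    have sq0: "square_part n \<noteq> 0" using nz by simp
    have d: "square_part n dvd n" "squarefree_part n dvd n"
      using dec[of n] by (metis dvd_mult dvd_power dvd_triv_left zero_less_numeral)+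
    then have "square_part n \<le> n" "squarefree_part n \<le> n" using nz by (auto intro: dvd_imp_le)
    moreover have "1 \<le> square_part n" using sq0 by linarith
    ultimately show "g n \<in> {1..y} \<times> sqfree_upto y"
      using n squarefree_part_nonzero[of n] by (auto simp: g_def sqfree_upto_def simp del: squarefree_part_nonzero)
  qed
  have "harm y = (\<Sum>n=1..y. F (g n))"
    unfolding harm_def
  proof (rule sum.cong[OF refl])
    fix n assume "n \<in> {1..y}"
    have "real n = real (squarefree_part n) * real (square_part n) ^ 2"
      by (subst dec) simp
    then show "inverse (real n) = F (g n)" by (simp add: F_def g_def divide_inverse mult.commute)
  qed
  also have "\<dots> = (\<Sum>i\<in>g ` {1..y}. F i)" by (rule sum.reindex[OF inj, unfolded o_def, symmetric])
  also have "\<dots> \<le> (\<Sum>i\<in>{1..y} \<times> sqfree_upto y. F i)"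
    using sub by (intro sum_mono2) (auto simp: F_def)
  also have "\<dots> = (\<Sum>k=1..y. 1 / real k ^ 2) * (\<Sum>m\<in>sqfree_upto y. 1 / real m)"
    unfolding F_def by (simp add: sum_product sum.cartesian_product)
  also have "\<dots> \<le> 2 * (\<Sum>m\<in>sqfree_upto y. 1 / real m)"
    by (intro mult_right_mono sum_inverse_squares_le sum_nonneg) auto
  finally show ?thesis .
qed

lemma sum_sqfree_le_prod: "(\<Sum>m\<in>sqfree_upto y. 1 / real m) \<le> (\<Prod>p\<in>primes_upto y. 1 + 1 / real p)"
proof -
  have inj: "inj_on prime_factors (sqfree_upto y)"
    by (rule inj_onI) (metis (no_types, lifting) mem_Collect_eq prod_prime_factors_squarefree sqfree_upto_def)
  have "(\<Sum>m\<in>sqfree_upto y. 1 / real m) = (\<Sum>m\<in>sqfree_upto y. \<Prod>p\<in>prime_factors m. 1 / real p)"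
  proof (rule sum.cong[OF refl])
    fix m assume "m \<in> sqfree_upto y"
    then have eq: "\<Prod>(prime_factors m) = m" using prod_prime_factors_squarefree[of m] by (simp add: sqfree_upto_def)
    have "(\<Prod>p\<in>prime_factors m. real p) = real (\<Prod>(prime_factors m))" by (rule of_nat_prod[symmetric])
    also have "\<dots> = real m" using eq by (simp only:)
    finally have "(\<Prod>p\<in>prime_factors m. real p) = real m" .
    then show "1 / real m = (\<Prod>p\<in>prime_factors m. 1 / real p)" by (simp add: prod_dividef)
  qed
  also have "\<dots> = (\<Sum>A\<in>prime_factors ` sqfree_upto y. \<Prod>p\<in>A. 1 / real p)" by (simp add: sum.reindex[OF inj] o_def)
  also have "\<dots> \<le> (\<Sum>A\<in>Pow (primes_upto y). \<Prod>p\<in>A. 1 / real p)"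
  proof (rule sum_mono2)
    show "prime_factors ` sqfree_upto y \<subseteq> Pow (primes_upto y)"
    proof (rule image_subsetI, rule PowI, rule subsetI)
      fix n p assume n: "n \<in> sqfree_upto y" and p: "p \<in> prime_factors n"
      then have "p \<le> n" by (auto simp: sqfree_upto_def in_prime_factors_iff intro: dvd_imp_le)
      then show "p \<in> primes_upto y" using n p by (auto simp: sqfree_upto_def primes_upto_def in_prime_factors_iff)
    qed
  qed (auto intro: prod_nonneg)
  also have "\<dots> = (\<Prod>p\<in>primes_upto y. 1 + 1 / real p)" by (simp add: prod_one_plus_eq_sum_Pow)
  finally show ?thesis .
qed

text \<open>Euler's product argument in finite form, where \<open>ln 2\<close> is the price for
  passing to squarefree integers and \<open>1 + 1 / p\<close> is majorized by
  \<open>exp (1 / p)\<close>.\<close>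

lemma sum_primes_ge:
  assumes y: "y \<ge> 1" shows "ln (ln (real y + 1)) \<le> ln 2 + (\<Sum>p\<in>primes_upto y. 1 / real p)"
proof -
  have "ln (real y + 1) \<le> harm y" by (rule ln_le_harm)
  also have "\<dots> \<le> 2 * (\<Sum>m\<in>sqfree_upto y. 1 / real m)" by (rule harm_le_sum_sqfree)
  also have "\<dots> \<le> 2 * (\<Prod>p\<in>primes_upto y. 1 + 1 / real p)" by (intro mult_left_mono sum_sqfree_le_prod) simp
  also have "\<dots> \<le> 2 * (\<Prod>p\<in>primes_upto y. exp (1 / real p))"
    by (intro mult_left_mono prod_mono conjI) (auto simp: exp_ge_add_one_self add_nonneg_nonneg)
  also have "\<dots> = exp (ln 2 + (\<Sum>p\<in>primes_upto y. 1 / real p))" by (simp add: exp_add exp_sum)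
  finally have "ln (real y + 1) \<le> exp (ln 2 + (\<Sum>p\<in>primes_upto y. 1 / real p))" .
  moreover have "ln (real y + 1) > 0" using y by simp
  ultimately show ?thesis by (metis exp_gt_zero ln_exp ln_le_cancel_iff)
qed

definition primesQ_upto :: "nat \<Rightarrow> nat set" where "primesQ_upto y = {p \<in> primes_upto y. p mod 8 \<in> {3, 5}}"

lemma finite_primesQ_upto [simp]: "finite (primesQ_upto y)" by (simp add: primesQ_upto_def)

text \<open>What matters is that 2 / 3 is below 1, so these primes cannot exhaust the whole sum of
  \<open>1 / p\<close>. In the product bound with \<open>\<delta>\<close> of order
  \<open>1 / ln y\<close> each of them enters with weight at least \<open>3 / (2 * p)\<close>, while
  the right side is only of order \<open>ln y\<close>. The inequality ln (1 + x) \<ge> x - x^2 then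
  turns the product into a sum.\<close>

lemma sum_primes_split_le:
  assumes y: "y \<ge> 3"
  shows "(\<Sum>p\<in>{p \<in> primes_upto y. p mod 8 \<in> {1, 7}}. 1 / real p) \<le> 2 / 3 * (ln (ln (real y + 1)) + 10)"
proof -
  define P where "P = {p \<in> primes_upto y. p mod 8 \<in> {1, 7}}"
  define L where "L = ln (real y + 1)"
  \<comment> \<open>The factor 4 keeps \<open>p powr (-\<delta>)\<close> above 3 / 4 for all
    \<open>p \<le> y\<close>; twice 3 / 4 is the 3 / 2 whose inverse appears in the bound.\<close>
  define \<delta> where "\<delta> = 1 / (4 * L)"
  have L1: "L \<ge> 1"
  proof -
    have "exp 1 \<le> real y + 1" using exp_le y by linarith
    then show ?thesis unfolding L_def by (subst ln_ge_iff) auto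
  qed
  have \<delta>: "\<delta> > 0" using L1 by (simp add: \<delta>_def)
  have finP: "finite P" by (simp add: P_def)
  define x where "x p = 2 * real p powr (-1 - \<delta>)" for p
  have p: "p \<ge> 2" "p \<le> y" if "p \<in> P" for p
    using that prime_ge_2_nat[of p] by (auto simp: P_def primes_upto_def)
  have xval: "x p = 2 / real p * real p powr (- \<delta>)" if "p \<in> P" for p
  proof -
    have "real p powr (-1 - \<delta>) = real p powr (-1) * real p powr (-\<delta>)" by (subst powr_add[symmetric]) simp
    then show ?thesis using p[OF that] by (simp add: x_def powr_minus_divide)
  qed
  have pd1: "real p powr (- \<delta>) \<le> 1" if "p \<in> P" for p
    using p[OF that] \<delta> powr_mono[of "-\<delta>" 0 "real p"] by simp
  have pd2: "real p powr (- \<delta>) \<ge> 3 / 4" if "p \<in> P" for p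
  proof -
    have "ln (real p) \<le> L" unfolding L_def using p[OF that] by (subst ln_le_cancel_iff) auto
    then have "\<delta> * ln (real p) \<le> \<delta> * L" using \<delta> by (intro mult_left_mono) auto
    also have "\<delta> * L = 1 / 4" using L1 by (simp add: \<delta>_def)
    finally have "3 / 4 \<le> 1 + - \<delta> * ln (real p)" by simp
    also have "\<dots> \<le> exp (- \<delta> * ln (real p))" by (rule exp_ge_add_one_self)
    finally show ?thesis using p[OF that] by (simp add: powr_def)
  qed
  have x01: "0 \<le> x p" "x p \<le> 2 / real p" "x p \<le> 1" "x p \<ge> 3 / 2 * (1 / real p)" if "p \<in> P" for p
  proof -
    have a: "2 / real p \<le> 1" "2 / real p \<ge> 0" using p[OF that] by auto
    show "0 \<le> x p" by (simp add: x_def)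
    show b: "x p \<le> 2 / real p" unfolding xval[OF that] using pd1[OF that] a by (intro mult_left_le) auto
    then show "x p \<le> 1" using a by linarith
    have "2 / real p * (3 / 4) \<le> x p" unfolding xval[OF that] using pd2[OF that] a by (intro mult_left_mono) auto
    then show "x p \<ge> 3 / 2 * (1 / real p)" by simp
  qed
  have "3 / 2 * (\<Sum>p\<in>P. 1 / real p) - 8 \<le> (\<Sum>p\<in>P. x p) - (\<Sum>p\<in>P. x p ^ 2)"
  proof -
    have "(\<Sum>p\<in>P. x p ^ 2) \<le> (\<Sum>p\<in>P. 4 * (1 / real p ^ 2))"
    proof (rule sum_mono)
      fix p assume pP: "p \<in> P"
      have "x p ^ 2 \<le> (2 / real p) ^ 2" using x01[OF pP] by (intro power_mono) auto
      then show "x p ^ 2 \<le> 4 * (1 / real p ^ 2)" by (simp add: power_divide)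
    qed
    also have "\<dots> \<le> (\<Sum>p=1..y. 4 * (1 / real p ^ 2))"
    proof (rule sum_mono2)
      show "P \<subseteq> {1..y}"
      proof
        fix q assume "q \<in> P"
        then show "q \<in> {1..y}" using p[of q] by simp
      qed
    qed auto
    also have "\<dots> \<le> 4 * 2" unfolding sum_distrib_left[symmetric] by (intro mult_left_mono sum_inverse_squares_le) simp
    finally have "(\<Sum>p\<in>P. x p ^ 2) \<le> 8" by simp
    moreover have "(\<Sum>p\<in>P. 3 / 2 * (1 / real p)) \<le> (\<Sum>p\<in>P. x p)" using x01 by (intro sum_mono) auto
    then have "3 / 2 * (\<Sum>p\<in>P. 1 / real p) \<le> (\<Sum>p\<in>P. x p)" unfolding sum_distrib_left[symmetric] .
    ultimately show ?thesis by linarith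
  qed
  also have "\<dots> = (\<Sum>p\<in>P. x p - x p ^ 2)" by (simp add: sum_subtractf)
  also have "\<dots> \<le> (\<Sum>p\<in>P. ln (1 + x p))" using x01 by (intro sum_mono ln_one_plus_pos_lower_bound) auto
  also have "\<dots> = ln (\<Prod>p\<in>P. 1 + x p)"
  proof (rule ln_prod[symmetric])
    fix p assume "p \<in> P"
    then show "1 + x p \<noteq> 0" using x01(1)[of p] by linarith
  qed (rule finP)
  also have "\<dots> \<le> ln (1 + 1 / \<delta>)"
  proof (subst ln_le_cancel_iff)
    show "0 < (\<Prod>p\<in>P. 1 + x p)" using x01(1) by (intro prod_pos) (auto intro: add_pos_nonneg)
    show "0 < 1 + 1 / \<delta>" using \<delta> by (simp add: add_pos_pos)
    show "(\<Prod>p\<in>P. 1 + x p) \<le> 1 + 1 / \<delta>"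
      unfolding x_def by (rule prod_split_primes_le[OF \<delta> finP]) (auto simp: P_def primes_upto_def)
  qed
  also have "\<dots> \<le> ln (5 * L)"
  proof (subst ln_le_cancel_iff)
    show "0 < 1 + 1 / \<delta>" using \<delta> by (simp add: add_pos_pos)
    show "0 < 5 * L" using L1 by simp
    show "1 + 1 / \<delta> \<le> 5 * L" using L1 by (simp add: \<delta>_def)
  qed
  also have "\<dots> = ln 5 + ln L" using L1 by (simp add: ln_mult)
  also have "ln 5 \<le> (2::real)"
  proof -
    have "(5::real) \<le> exp 2" using exp_lower_Taylor_quadratic[of 2] by simp
    then show ?thesis by (metis exp_gt_zero ln_exp ln_le_cancel_iff zero_less_numeral)
  qed
  finally have "3 / 2 * (\<Sum>p\<in>P. 1 / real p) - 8 \<le> 2 + ln L" by simp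
  then show ?thesis by (simp add: P_def L_def)
qed

lemma sum_union_nonneg_le:
  fixes f :: "'a \<Rightarrow> real"
  assumes "finite A" "finite B" "\<And>x. f x \<ge> 0"
  shows "sum f (A \<union> B) \<le> sum f A + sum f B"
  using assms sum.union_inter[of A B f] sum_nonneg[of "A \<inter> B" f] by simp

text \<open>This is what remains of the full sum without 2 and the primes 1, 7 modulo 8. The
  constant 9 absorbs 1 / 2, \<open>ln 2\<close> and 20 / 3.\<close>

lemma sum_primesQ_ge:
  assumes y: "y \<ge> 3"
  shows "(\<Sum>p\<in>primesQ_upto y. 1 / real p) \<ge> 1 / 3 * ln (ln (real y + 1)) - 9"
proof -
  define P where "P = {p \<in> primes_upto y. p mod 8 \<in> {1, 7}}"
  have "primes_upto y \<subseteq> {2} \<union> P \<union> primesQ_upto y"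
  proof
    fix p assume p: "p \<in> primes_upto y"
    show "p \<in> {2} \<union> P \<union> primesQ_upto y"
    proof (cases "p = 2")
      case False
      then have "odd p" using p prime_odd_nat[of p] prime_ge_2_nat[of p] by (auto simp: primes_upto_def)
      then have "p mod 8 \<in> {1, 3, 5, 7}" using mod_8_cases[of p] by (elim disjE) (simp_all, presburger+)
      then show ?thesis using p by (auto simp: P_def primesQ_upto_def)
    qed simp
  qed
  then have "(\<Sum>p\<in>primes_upto y. 1 / real p) \<le> (\<Sum>p\<in>{2} \<union> P \<union> primesQ_upto y. 1 / real p)"
    by (intro sum_mono2) (auto simp: P_def)
  also have "\<dots> \<le> (\<Sum>p\<in>{2} \<union> P. 1 / real p) + (\<Sum>p\<in>primesQ_upto y. 1 / real p)"
    by (intro sum_union_nonneg_le) (auto simp: P_def)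
  also have "(\<Sum>p\<in>{2} \<union> P. 1 / real p) \<le> (\<Sum>p\<in>{2}. 1 / real p) + (\<Sum>p\<in>P. 1 / real p)"
    by (intro sum_union_nonneg_le) (auto simp: P_def)
  finally have "(\<Sum>p\<in>primes_upto y. 1 / real p) \<le> 1 / 2 + (\<Sum>p\<in>P. 1 / real p) + (\<Sum>p\<in>primesQ_upto y. 1 / real p)"
    by simp
  moreover have "ln (ln (real y + 1)) \<le> ln 2 + (\<Sum>p\<in>primes_upto y. 1 / real p)" using sum_primes_ge y by simp
  moreover have "(\<Sum>p\<in>P. 1 / real p) \<le> 2 / 3 * (ln (ln (real y + 1)) + 10)" unfolding P_def by (rule sum_primes_split_le[OF y])
  moreover have "ln 2 \<le> (1::real)" using ln_2_less_1 by simp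
  ultimately show ?thesis by argo
qed

section \<open>Locally soluble forms\<close>

lemma padic_int_of_compatible:
  assumes p: "p > 0" and s: "\<And>k. [s (Suc k) = s k] (mod p ^ k)"
  shows "padic_int p (\<lambda>k. s k mod p ^ k)"
  unfolding padic_int_def
proof (intro allI conjI)
  fix k
  show "0 \<le> s k mod p ^ k" "s k mod p ^ k < p ^ k" using p by simp_all
  have "s (Suc k) mod p ^ Suc k mod p ^ k = s (Suc k) mod p ^ k" by (rule mod_mod_cancel) simp
  also have "\<dots> = s k mod p ^ k" using s[of k] by (simp add: cong_def)
  finally show "s (Suc k) mod p ^ Suc k mod p ^ k = s k mod p ^ k" .
qed

lemma quartic_cong:
  assumes "[x = x'] (mod m)" "[y = y'] (mod m)"
  shows "[quartic a B c x y = quartic a B c x' y'] (mod (m::int))"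
  unfolding quartic_def using assms by (intro cong_add cong_mult cong_pow cong_refl)

text \<open>Admits sequences of integers that are not reduced modulo \<open>p ^ k\<close>, such as
  constants and the output of Hensel lifting. A coordinate whose entry at index 1 is not divisible
  by \<open>p\<close> certifies that the point is not the origin.\<close>

lemma soluble_QpI:
  assumes p: "prime p"
    and X: "\<And>k. [X (Suc k) = X k] (mod p ^ k)" and Y: "\<And>k. [Y (Suc k) = Y k] (mod p ^ k)"
    and Z: "\<And>k. [Z (Suc k) = Z k] (mod p ^ k)"
    and eq: "\<And>k. [Z k ^ 2 = quartic a B c (X k) (Y k)] (mod p ^ k)"
    and nz: "\<not> p dvd X 1 \<or> \<not> p dvd Y 1"
  shows "soluble_Qp p a B c"
  unfolding soluble_Qp_def
proof (intro exI conjI)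
  have p0: "p > 0" using p by (rule prime_gt_0_int)
  show "padic_int p (\<lambda>k. X k mod p ^ k)" "padic_int p (\<lambda>k. Y k mod p ^ k)" "padic_int p (\<lambda>k. Z k mod p ^ k)"
    by (intro padic_int_of_compatible p0 X Y Z)+
  show "\<not> (\<forall>k. X k mod p ^ k = 0 \<and> Y k mod p ^ k = 0)"
  proof
    assume "\<forall>k. X k mod p ^ k = 0 \<and> Y k mod p ^ k = 0"
    then have "X 1 mod p ^ 1 = 0 \<and> Y 1 mod p ^ 1 = 0" by blast
    then show False using nz by (simp add: mod_eq_0_iff_dvd)
  qed
  show "\<forall>k. [(Z k mod p ^ k)\<^sup>2 = quartic a B c (X k mod p ^ k) (Y k mod p ^ k)] (mod p ^ k)"
  proof
    fix k
    have r: "[u mod p ^ k = u] (mod p ^ k)" for u by (simp add: cong_def)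
    have "[(Z k mod p ^ k)\<^sup>2 = Z k ^ 2] (mod p ^ k)" by (intro cong_pow r)
    also note eq[of k]
    also have "[quartic a B c (X k) (Y k) = quartic a B c (X k mod p ^ k) (Y k mod p ^ k)] (mod p ^ k)"
      by (intro quartic_cong cong_sym[OF r])
    finally show "[(Z k mod p ^ k)\<^sup>2 = quartic a B c (X k mod p ^ k) (Y k mod p ^ k)] (mod p ^ k)" .
  qed
qed

definition padic_sqrt :: "int \<Rightarrow> int \<Rightarrow> (nat \<Rightarrow> int) \<Rightarrow> bool" where
  "padic_sqrt p u s \<longleftrightarrow> (\<forall>k. [s k ^ 2 = u] (mod p ^ k)) \<and> (\<forall>k. [s (Suc k) = s k] (mod p ^ k))"

lemma ex_padic_sqrt_odd:
  assumes p: "prime p" "p > 2" and u: "Legendre u p = 1"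
  shows "\<exists>s. padic_sqrt p u s"
proof -
  have pu: "\<not> p dvd u" and "QuadRes p u"
    using u by (auto simp: Legendre_def cong_0_iff split: if_splits)
  then obtain s0 where s0: "[s0 ^ 2 = u] (mod p)" by (auto simp: QuadRes_def)
  \<comment> \<open>The precision stays one exponent ahead, because the recursion starts from a root
    modulo \<open>p\<close>; it is weakened to \<open>p ^ k\<close> at the end.\<close>
  have "\<exists>s. \<forall>k. [s k ^ 2 = u] (mod p ^ Suc k) \<and> [s (Suc k) = s k] (mod p ^ Suc k)"
  proof (rule dependent_nat_choice)
    show "\<exists>s. [s ^ 2 = u] (mod p ^ Suc 0)" using s0 by auto
    fix s k assume s: "[s ^ 2 = u] (mod p ^ Suc k)"
    obtain c where c: "s ^ 2 = u + c * p ^ Suc k"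
      using s by (metis cong_iff_lin cong_sym mult.commute)
    have ps: "\<not> p dvd s"
    proof
      assume "p dvd s"
      then have "p dvd s ^ 2 - c * p ^ Suc k" by (simp add: power2_eq_square)
      then show False using pu c by simp
    qed
    have "\<not> p dvd 2" using p zdvd_imp_le[of p 2] by auto
    then have "\<not> p dvd 2 * s" using ps p by (simp add: prime_dvd_mult_iff)
    then have "coprime (2 * s) p" using p by (meson coprime_commute prime_imp_coprime)
    then obtain v where v: "[2 * s * v = 1] (mod p)" using cong_solve_coprime_int by blast
    \<comment> \<open>Newton's correction: \<open>v\<close> inverts the derivative
      \<open>2 * s\<close> modulo \<open>p\<close>, so that \<open>t\<close> cancels the error
      \<open>c\<close> modulo \<open>p\<close>.\<close>
    define t where "t = - c * v"
    have "[c + 2 * s * t = c + - c * 1] (mod p)"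
      unfolding t_def using cong_mult[OF cong_refl[of "- c"] v] by (intro cong_add cong_refl) (simp add: mult_ac)
    then have "p dvd c + 2 * s * t" by (simp add: cong_0_iff)
    then obtain d where d: "c + 2 * s * t = p * d" by blast
    define s' where "s' = s + t * p ^ Suc k"
    have "s' ^ 2 = u + (c + 2 * s * t) * p ^ Suc k + t ^ 2 * (p ^ Suc k * p ^ Suc k)"
      unfolding s'_def using c by (simp add: power2_eq_square algebra_simps)
    also have "\<dots> = u + p ^ Suc (Suc k) * (d + t ^ 2 * p ^ k)" unfolding d by (simp add: algebra_simps)
    finally have "[s' ^ 2 = u] (mod p ^ Suc (Suc k))" by (simp add: cong_iff_dvd_diff)
    moreover have "[s' = s] (mod p ^ Suc k)" by (simp add: s'_def cong_iff_dvd_diff)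
    ultimately show "\<exists>s'. [s' ^ 2 = u] (mod p ^ Suc (Suc k)) \<and> [s' = s] (mod p ^ Suc k)" by blast
  qed
  then obtain s where s: "\<And>k. [s k ^ 2 = u] (mod p ^ Suc k)" "\<And>k. [s (Suc k) = s k] (mod p ^ Suc k)" by blast
  have d: "p ^ k dvd p ^ Suc k" for k by simp
  have "[s k ^ 2 = u] (mod p ^ k)" "[s (Suc k) = s k] (mod p ^ k)" for k
    using cong_dvd_modulus[OF s(1) d] cong_dvd_modulus[OF s(2) d] by blast+
  then have "padic_sqrt p u s" unfolding padic_sqrt_def by blast
  then show ?thesis by blast
qed

text \<open>At 2 the derivative \<open>2 * s\<close> is not a unit: a correction by
  \<open>2 ^ (k + 2)\<close> first affects the square at \<open>2 ^ (k + 3)\<close>. So the root is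
  stable only modulo \<open>2 ^ (k + 2)\<close> when its square is known modulo
  \<open>2 ^ (k + 3)\<close>, and the start needs a congruence modulo 8.\<close>

lemma ex_padic_sqrt_2:
  assumes u: "[u = 1] (mod 8)" shows "\<exists>s. padic_sqrt 2 u s"
proof -
  have "\<exists>s. \<forall>k. (odd (s k) \<and> [s k ^ 2 = u] (mod 2 ^ (k + 3))) \<and> [s (Suc k) = s k] (mod (2::int) ^ (k + 2))"
  proof (rule dependent_nat_choice)
    show "\<exists>s. odd s \<and> [s ^ 2 = u] (mod 2 ^ (0 + 3))" using u by (intro exI[of _ 1]) (simp add: cong_sym)
    fix s :: int and k assume s: "odd s \<and> [s ^ 2 = u] (mod 2 ^ (k + 3))"
    obtain c where c: "s ^ 2 = u + c * 2 ^ (k + 3)"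
      using s by (metis cong_iff_lin cong_sym mult.commute)
    define s' where "s' = (if even c then s else s + 2 ^ (k + 2))"
    have "odd s'" using s by (simp add: s'_def)
    moreover have "[s' ^ 2 = u] (mod 2 ^ (Suc k + 3))"
    proof (cases "even c")
      case True
      then obtain d where "c = 2 * d" by blast
      then have "s' ^ 2 = u + 2 ^ (Suc k + 3) * d" using c True by (simp add: s'_def power_add)
      then show ?thesis by (simp add: cong_iff_dvd_diff)
    next
      case False
      then obtain d where d: "c + s = 2 * d" using s by (metis evenE odd_even_add)
      have "s' ^ 2 = s ^ 2 + s * 2 ^ (k + 3) + 2 ^ (k + 2) * 2 ^ (k + 2)"
        using False by (simp add: s'_def power2_eq_square algebra_simps power_add)
      also have "\<dots> = u + (c + s) * 2 ^ (k + 3) + 2 ^ (Suc k + 3) * 2 ^ k"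
        unfolding c by (simp add: algebra_simps power_add)
      also have "\<dots> = u + 2 ^ (Suc k + 3) * (d + 2 ^ k)" unfolding d by (simp add: algebra_simps power_add)
      finally show ?thesis by (simp add: cong_iff_dvd_diff)
    qed
    moreover have "[s' = s] (mod 2 ^ (k + 2))" by (simp add: s'_def cong_iff_dvd_diff)
    ultimately show "\<exists>s'. (odd s' \<and> [s' ^ 2 = u] (mod 2 ^ (Suc k + 3))) \<and> [s' = s] (mod 2 ^ (k + 2))" by blast
  qed
  then obtain s where s: "\<And>k. [s k ^ 2 = u] (mod 2 ^ (k + 3))" "\<And>k. [s (Suc k) = s k] (mod (2::int) ^ (k + 2))" by blast
  have d: "(2::int) ^ k dvd 2 ^ (k + 3)" "(2::int) ^ k dvd 2 ^ (k + 2)" for k by (simp_all add: le_imp_power_dvd)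
  have "[s k ^ 2 = u] (mod 2 ^ k)" "[s (Suc k) = s k] (mod 2 ^ k)" for k
    using cong_dvd_modulus[OF s(1) d(1)] cong_dvd_modulus[OF s(2) d(2)] by blast+
  then have "padic_sqrt 2 u s" unfolding padic_sqrt_def by blast
  then show ?thesis by blast
qed

lemma soluble_Qp_of_coeff_square:
  assumes p: "prime p" and s: "padic_sqrt p a s" shows "soluble_Qp p a B c"
  by (rule soluble_QpI[OF p, of "\<lambda>_. 1" "\<lambda>_. 0" s])
     (use s p not_prime_unit[of p] in \<open>auto simp: padic_sqrt_def quartic_def\<close>)

text \<open>If \<open>a\<close> divides \<open>N\<close>, with \<open>N = a * e\<close>, then
  \<open>c = 2 * a * e^2\<close> and the form itself factors. This displays the simple points: the
  value \<open>a\<close> at (1, 0), the value \<open>2 * a\<close> times a square at (0, 1), and a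
  zero if \<open>- e\<close> or \<open>- (2 * e)\<close> is a square.\<close>

lemma quartic_factored: "quartic a (3 * (a * e)) (2 * a * e ^ 2) x y = a * ((x ^ 2 + e * y ^ 2) * (x ^ 2 + 2 * e * y ^ 2))"
  for a e x y :: int
  by (simp add: quartic_def algebra_simps power2_eq_square power4_eq_xxxx)

lemma prime_abs_neq_1: "prime p \<Longrightarrow> \<bar>p\<bar> \<noteq> 1" for p :: int
  by (metis not_prime_unit zdvd1_eq)

lemma soluble_Qp_of_2coeff_square:
  assumes p: "prime p" and s: "padic_sqrt p (2 * a) s"
  shows "soluble_Qp p a (3 * (a * e)) (2 * a * e ^ 2)"
proof (rule soluble_QpI[OF p, of "\<lambda>_. 0" "\<lambda>_. 1" "\<lambda>k. e * s k"])
  fix k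
  show "[e * s (Suc k) = e * s k] (mod p ^ k)" using s by (intro cong_mult cong_refl) (simp add: padic_sqrt_def)
  have "[e ^ 2 * s k ^ 2 = e ^ 2 * (2 * a)] (mod p ^ k)" using s by (intro cong_mult cong_refl) (simp add: padic_sqrt_def)
  then show "[(e * s k) ^ 2 = quartic a (3 * (a * e)) (2 * a * e ^ 2) 0 1] (mod p ^ k)"
    by (simp add: quartic_def power_mult_distrib mult_ac)
qed (use prime_abs_neq_1[OF p] in auto)

lemma soluble_Qp_of_root:
  assumes p: "prime p" and s: "padic_sqrt p (- e) s \<or> padic_sqrt p (- (2 * e)) s"
  shows "soluble_Qp p a (3 * (a * e)) (2 * a * e ^ 2)"
proof (rule soluble_QpI[OF p, of s "\<lambda>_. 1" "\<lambda>k. 0"])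
  fix k
  show "[s (Suc k) = s k] (mod p ^ k)" using s by (auto simp: padic_sqrt_def)
  have "p ^ k dvd s k ^ 2 + e \<or> p ^ k dvd s k ^ 2 + 2 * e"
    using s by (auto simp: padic_sqrt_def cong_iff_dvd_diff)
  then have "p ^ k dvd a * ((s k ^ 2 + e) * (s k ^ 2 + 2 * e))" by (metis dvd_mult dvd_mult2)
  then have "[a * ((s k ^ 2 + e) * (s k ^ 2 + 2 * e)) = 0] (mod p ^ k)" by (simp only: cong_0_iff)
  then have "[0 = a * ((s k ^ 2 + e) * (s k ^ 2 + 2 * e))] (mod p ^ k)" by (rule cong_sym)
  then show "[0 ^ 2 = quartic a (3 * (a * e)) (2 * a * e ^ 2) (s k) 1] (mod p ^ k)"
    unfolding quartic_factored by simp
qed (use prime_abs_neq_1[OF p] in auto)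

lemma soluble_Qp_of_value:
  assumes p: "prime p" and s: "padic_sqrt p (quartic a B c x 1) s"
  shows "soluble_Qp p a B c"
  by (rule soluble_QpI[OF p, of "\<lambda>_. x" "\<lambda>_. 1" s])
     (use s p prime_abs_neq_1[of p] in \<open>auto simp: padic_sqrt_def\<close>)

text \<open>Solubility at primes of good reduction, by an elementary argument. If there were no such
  \<open>x\<close>, then \<open>a\<close> and \<open>- e\<close> would be nonresidues and 2 a
  residue, and \<open>r + e\<close> and \<open>r + 2 * e\<close> would have equal nonzero symbols
  for every nonzero square \<open>r\<close>. Such equalities carry a symbol along an arithmetic
  progression up to a multiple of \<open>p\<close>, where the symbol is 0.\<close>

lemma ex_square_value:
  fixes a e :: int
  assumes p: "prime p" "p > 2" and pa: "\<not> p dvd a" and pe: "\<not> p dvd e"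
    and n1: "Legendre a p \<noteq> 1" and n2: "Legendre (2 * a) p \<noteq> 1"
    and n3: "Legendre (- e) p \<noteq> 1" and n4: "Legendre (- (2 * e)) p \<noteq> 1"
  shows "\<exists>x. Legendre (a * ((x ^ 2 + e) * (x ^ 2 + 2 * e))) p = 1"
proof (rule ccontr)
  assume no: "\<not> ?thesis"
  obtain q where q: "p = int q" "prime q" "2 < q" using int_prime_obtain[OF p] by blast
  define L where "L u = Legendre u p" for u
  have Lm: "L (u * v) = L u * L v" for u v unfolding L_def using Legendre_mult q by blast
  have Lv: "L u \<in> {-1, 0, 1}" for u unfolding L_def by (rule Legendre_values)
  have L0: "L u = 0 \<longleftrightarrow> p dvd u" for u unfolding L_def by (rule Legendre_eq_0_iff)
  have Lc: "L u = L v" if "p dvd u - v" for u v unfolding L_def using that by (intro Legendre_cong) (simp add: cong_iff_dvd_diff)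
  have p2: "\<not> p dvd 2" using p zdvd_imp_le[of p 2] by auto
  have La: "L a = -1" using Lv[of a] L0[of a] pa n1 by (auto simp: L_def)
  have "L (2 * a) = -1" using Lv[of "2 * a"] L0[of "2 * a"] pa p2 p n2 by (auto simp: L_def prime_dvd_mult_iff)
  then have L2: "L 2 = 1" using Lm[of 2 a] La by simp
  have Lne: "L (- e) = -1" using Lv[of "- e"] L0[of "- e"] pe n3 by (auto simp: L_def)
  have Ln2e: "L (- (2 * e)) = -1" using Lm[of 2 "- e"] L2 Lne by simp
  have neg: "L (- u) = L (-1) * L u" for u using Lm[of "-1" u] by simp
  have L11: "L 1 = 1"
  proof -
    have "Legendre (1 ^ 2) p = 1" using p prime_abs_neq_1[of p] by (intro Legendre_square) auto
    then show ?thesis by (simp add: L_def)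
  qed
  have sqL: "L (x ^ 2) = 1" if "\<not> p dvd x" for x unfolding L_def using Legendre_square[OF p(1) that] .
  have sq_no: "\<not> p dvd x ^ 2 + f" if f: "L (- f) = -1" for x f
  proof
    assume d: "p dvd x ^ 2 + f"
    then have "L (x ^ 2) = L (- f)" by (intro Lc) simp
    moreover have "L (x ^ 2) \<noteq> -1" using sqL[of x] L0[of "x ^ 2"] p by (cases "p dvd x") (auto simp: power2_eq_square)
    ultimately show False using f by simp
  qed
  have sq_key: "L (x ^ 2 + e) = L (x ^ 2 + 2 * e) \<and> L (x ^ 2 + e) \<noteq> 0" for x
  proof -
    have nz: "L (x ^ 2 + e) \<noteq> 0" "L (x ^ 2 + 2 * e) \<noteq> 0" using sq_no[OF Lne] sq_no[OF Ln2e] L0 by blast+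
    have "L (a * ((x ^ 2 + e) * (x ^ 2 + 2 * e))) \<noteq> 1" using no unfolding L_def by blast
    then have "L (x ^ 2 + e) * L (x ^ 2 + 2 * e) \<noteq> -1" unfolding Lm La by auto
    then show ?thesis using nz Lv[of "x ^ 2 + e"] Lv[of "x ^ 2 + 2 * e"] by auto
  qed
  have key: "L (r + e) = L (r + 2 * e) \<and> L (r + e) \<noteq> 0" if r: "L r = 1" for r
  proof -
    have "QuadRes p r" using r by (auto simp: L_def Legendre_def split: if_splits)
    then obtain x where "[x ^ 2 = r] (mod p)" by (auto simp: QuadRes_def)
    then have "p dvd x ^ 2 - r" by (simp add: cong_iff_dvd_diff)
    then have "L (x ^ 2 + e) = L (r + e)" "L (x ^ 2 + 2 * e) = L (r + 2 * e)" by (auto intro!: Lc)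
    then show ?thesis using sq_key[of x] by simp
  qed
  have L1v: "L (-1) = 1 \<or> L (-1) = -1" using Lv[of "-1"] L0[of "-1"] p prime_abs_neq_1[of p] by auto
  have Le_neg: "L (-1) * L e = -1" using neg[of e] Lne by simp
  show False
  proof (cases "L (-1) = -1")
    case True
    then have Le: "L e = 1" using Le_neg by simp
    \<comment> \<open>Here \<open>e\<close> and \<open>2 * e\<close> are residues. Taking
      \<open>r = j * e\<close> shows successively that all multiples of \<open>e\<close> are
      residues, finally \<open>p * e\<close>.\<close>
    have "L (int (Suc j) * e) = 1 \<and> L (int (Suc (Suc j)) * e) = 1" for j
    proof (induction j)
      case 0
      then show ?case using Le L2 Lm[of 2 e] by simp
    next
      case (Suc j)
      have "L (int (Suc j) * e + e) = L (int (Suc j) * e + 2 * e)" using key[of "int (Suc j) * e"] Suc by simp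
      then have "L (int (Suc (Suc j)) * e) = L (int (Suc (Suc (Suc j))) * e)" by (simp add: algebra_simps)
      then show ?case using Suc by simp
    qed
    then have "L (int (Suc (q - 1)) * e) = 1" by blast
    moreover have "int (Suc (q - 1)) = p" using q by simp
    ultimately have "L (p * e) = 1" by simp
    then show False using L0[of "p * e"] by simp
  next
    case False
    then have "L (-1) = 1" using L1v by simp
    then have Le: "L e = -1" using Le_neg by simp
    \<comment> \<open>\<open>key\<close> at \<open>r = e * t\<close>, with the nonresidue
      \<open>e\<close> divided out.\<close>
    have step: "L (t + 1) = L (t + 2) \<and> L (t + 1) \<noteq> 0" if t: "L t = -1" for t
    proof -
      have "L (e * t) = 1" using t Le Lm by simp
      then have "L (e * t + e) = L (e * t + 2 * e) \<and> L (e * t + e) \<noteq> 0" by (rule key)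
      moreover have "e * t + e = e * (t + 1)" "e * t + 2 * e = e * (t + 2)" by (simp_all add: algebra_simps)
      ultimately have "L (e * (t + 1)) = L (e * (t + 2)) \<and> L (e * (t + 1)) \<noteq> 0" by simp
      then show ?thesis using Le by (simp add: Lm)
    qed
    \<comment> \<open>Two consecutive nonresidues force all later integers to be nonresidues. If
      \<open>a + 1\<close> is a residue, the inverse \<open>a'\<close> of \<open>a\<close> provides
      them, because \<open>a * (a' + 1)\<close> is congruent to \<open>a + 1\<close>.\<close>
    have "\<exists>t. L t = -1 \<and> L (t + 1) = -1"
    proof (cases "L (a + 1) = -1")
      case True
      then show ?thesis using La by blast
    next
      case False
      then have La1: "L (a + 1) = 1" using step[OF La] Lv[of "a + 1"] by auto
      have "coprime a p" using pa p by (meson coprime_commute prime_imp_coprime)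
      then obtain a' where a': "[a * a' = 1] (mod p)" using cong_solve_coprime_int by blast
      then have d: "p dvd a * a' - 1" by (simp add: cong_iff_dvd_diff)
      have "L (a * a') = 1" using Lc[OF d] L11 by simp
      then have "L a' = -1" using Lm[of a a'] La by simp
      have "L (a * (a' + 1)) = L (a + 1)" using d by (intro Lc) (simp add: algebra_simps)
      then have "L (a' + 1) = -1" using Lm[of a "a' + 1"] La La1 by simp
      then show ?thesis using \<open>L a' = -1\<close> by blast
    qed
    then obtain t where t: "L t = -1" "L (t + 1) = -1" by blast
    have run: "L (t + int j) = -1 \<and> L (t + int j + 1) = -1" for j
    proof (induction j)
      case 0 then show ?case using t by simp
    next
      case (Suc j)
      have "L (t + int j + 1) = L (t + int j + 2)" using step Suc by blast
      then show ?case using Suc by (simp add: algebra_simps)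
    qed
    define j where "j = nat ((- t) mod p)"
    have "int j = (- t) mod p" using p by (simp add: j_def)
    then have "p dvd t + int j" by (metis add.commute diff_minus_eq_add dvd_minus_mod dvd_minus_iff minus_diff_eq mod_eq_dvd_iff mod_mod_trivial uminus_add_conv_diff)
    then show False using run[of j] L0[of "t + int j"] by simp
  qed
qed

text \<open>The point (1, 0) serves the real place and 2, where \<open>a\<close> is a square, being
  positive and 1 modulo 8. Odd primes not dividing \<open>a * e\<close> are covered by the simple
  points or by \<open>ex_square_value\<close>, so conditions arise only at the odd primes dividing
  \<open>a * e\<close>.\<close>

lemma locally_solubleI:
  fixes a e :: int
  assumes a: "a > 0" "[a = 1] (mod 8)"
    and bad: "\<And>p. prime p \<Longrightarrow> p > 2 \<Longrightarrow> p dvd a * e \<Longrightarrow>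
      Legendre a p = 1 \<or> Legendre (2 * a) p = 1 \<or> Legendre (- e) p = 1 \<or> Legendre (- (2 * e)) p = 1"
  shows "locally_soluble a (3 * (a * e)) (2 * a * e ^ 2)"
  unfolding locally_soluble_def
proof (intro conjI allI impI)
  show "soluble_R a (3 * (a * e)) (2 * a * e ^ 2)"
    unfolding soluble_R_def
    by (rule exI[of _ 1], rule exI[of _ 0], rule exI[of _ "sqrt (real_of_int a)"]) (use a in \<open>simp add: quartic_def\<close>)
  fix p :: int assume p: "prime p"
  show "soluble_Qp p a (3 * (a * e)) (2 * a * e ^ 2)"
  proof (cases "p = 2")
    case True
    then show ?thesis using ex_padic_sqrt_2[OF a(2)] soluble_Qp_of_coeff_square p by blast
  next
    case False
    then have p2: "p > 2" using p prime_ge_2_int[of p] by simp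
    note ex = ex_padic_sqrt_odd[OF p p2]
    consider "Legendre a p = 1" | "Legendre (2 * a) p = 1" | "Legendre (- e) p = 1" | "Legendre (- (2 * e)) p = 1"
      | x where "Legendre (a * ((x ^ 2 + e) * (x ^ 2 + 2 * e))) p = 1"
      using bad[OF p p2] ex_square_value[OF p p2, of a e] p by (auto simp: prime_dvd_mult_iff)
    then show ?thesis
    proof cases
      case 1 then show ?thesis using ex soluble_Qp_of_coeff_square p by blast
    next
      case 2 then show ?thesis using ex soluble_Qp_of_2coeff_square p by blast
    next
      case 3 then show ?thesis using ex soluble_Qp_of_root p by blast
    next
      case 4 then show ?thesis using ex soluble_Qp_of_root p by blast
    next
      case 5
      have "quartic a (3 * (a * e)) (2 * a * e ^ 2) x 1 = a * ((x ^ 2 + e) * (x ^ 2 + 2 * e))"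
        unfolding quartic_factored by simp
      then show ?thesis using ex[OF 5] soluble_Qp_of_value[OF p] by metis
    qed
  qed
qed

section \<open>Residues modulo 8 and the quadratic character of 2\<close>

lemma mod_8_mult: "(a * b) mod 8 = ((a mod 8) * (b mod 8)) mod (8::nat)"
  by (simp add: mod_mult_eq)

lemma odd_mod_8: "odd (a::nat) \<Longrightarrow> a mod 8 \<in> {1, 3, 5, 7}"
  by (auto) presburger

lemma odd_square_mod_8: "odd (a::nat) \<Longrightarrow> (a * a) mod 8 = 1"
  using odd_mod_8[of a] by (subst mod_8_mult) auto

lemma odd_of_3_5_mod_8: "k mod 8 \<in> {3, 5::nat} \<Longrightarrow> odd k \<and> 3 \<le> k"
proof -
  assume "k mod 8 \<in> {3, 5}"
  then have "k mod 8 = 3 \<or> k mod 8 = 5" by simp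
  then show ?thesis by presburger
qed

text \<open>The classes 1 and 7 are closed under multiplication, so the prime factors of
  \<open>k\<close> cannot all lie in them.\<close>

lemma ex_prime_3_5_mod_8:
  assumes "k mod 8 \<in> {3, 5::nat}" shows "\<exists>r. prime r \<and> r dvd k \<and> r mod 8 \<in> {3, 5}"
  using assms
proof (induction k rule: less_induct)
  case (less k)
  have odd: "odd k" using odd_of_3_5_mod_8[OF less.prems] by simp
  have "k \<noteq> 1" using less.prems by auto
  then obtain r where r: "prime r" "r dvd k" using prime_factor_nat by blast
  then obtain k' where k': "k = r * k'" by blast
  show ?case
  proof (cases "r mod 8 \<in> {3, 5}")
    case True then show ?thesis using r by blast
  next
    case False
    have "odd r" "odd k'" using odd k' by auto
    then have "r mod 8 \<in> {1, 7}" "k' mod 8 \<in> {1, 3, 5, 7}" using False odd_mod_8[of r] odd_mod_8[of k'] by auto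
    then have "k' mod 8 \<in> {3, 5}" using less.prems mod_8_mult[of r k'] unfolding k' by auto
    moreover have "k' < k" using r \<open>odd k'\<close> prime_gt_1_nat[OF r(1)] odd_pos by (simp add: k')
    ultimately show ?thesis using less.IH[of k'] k' by auto
  qed
qed

text \<open>Infinite descent. If 2 is a square modulo \<open>p\<close>, then
  \<open>x^2 - 2 = p * k\<close> with \<open>x\<close> odd and \<open>x \<le> p\<close>, so
  \<open>0 < k < p\<close>. Since \<open>x^2\<close> is 1 modulo 8, \<open>k\<close> is 3 or 5
  modulo 8, and so is some prime factor of \<open>k\<close>, a smaller prime modulo which 2 is again
  a square.\<close>

lemma not_QuadRes_2:
  assumes "prime p" "p mod 8 \<in> {3, 5::nat}" shows "\<not> QuadRes (int p) 2"
  using assms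
proof (induction p rule: less_induct)
  case (less p)
  have oddp: "odd p" using odd_of_3_5_mod_8[OF less.prems(2)] by simp
  have p3: "p \<ge> 3" using odd_of_3_5_mod_8[OF less.prems(2)] by simp
  show ?case
  proof
    assume "QuadRes (int p) 2"
    then obtain y where y: "[y ^ 2 = 2] (mod int p)" by (auto simp: QuadRes_def)
    define x0 where "x0 = y mod int p"
    have x0: "0 \<le> x0" "x0 < int p" using p3 by (simp_all add: x0_def)
    have x0c: "[x0 ^ 2 = 2] (mod int p)" using y by (simp add: x0_def cong_def power_mod)
    \<comment> \<open>The odd one of \<open>x0\<close> and \<open>p - x0\<close> is taken, which
      fixes the square modulo 8.\<close>
    define xi where "xi = (if odd x0 then x0 else int p - x0)"
    have xi: "0 \<le> xi" "xi \<le> int p" "odd xi" using x0 oddp by (auto simp: xi_def)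
    have xic: "[xi ^ 2 = 2] (mod int p)"
    proof (cases "odd x0")
      case False
      have "(int p - x0) ^ 2 = x0 ^ 2 + int p * (int p - 2 * x0)" by (simp add: power2_eq_square algebra_simps)
      then have "[xi ^ 2 = x0 ^ 2] (mod int p)" using False by (simp add: xi_def cong_iff_dvd_diff)
      then show ?thesis using x0c cong_trans by blast
    qed (use x0c in \<open>simp add: xi_def\<close>)
    define x where "x = nat xi"
    have x: "int x = xi" "odd x" "x \<le> p" using xi by (auto simp: x_def even_nat_iff)
    have "int p dvd xi ^ 2 - 2" using xic by (simp add: cong_iff_dvd_diff)
    then obtain k where k: "xi ^ 2 - 2 = int p * k" by blast
    have "xi \<noteq> 1"
    proof
      assume "xi = 1"
      then have "int p * k = -1" using k by simp
      then have "int p dvd 1" by (metis dvd_minus_iff dvd_triv_left)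
      then show False using p3 by simp
    qed
    then have xi3: "xi \<ge> 3" using xi by (auto elim!: oddE)
    then have "xi * xi \<ge> 3 * 3" by (intro mult_mono) auto
    then have "int p * k > 0" using k by (simp add: power2_eq_square)
    then have k0: "k > 0" using p3 by (simp add: zero_less_mult_iff)
    have "int p * k < int p * int p"
    proof -
      have "xi * xi \<le> int p * int p" using xi by (intro mult_mono) auto
      then show ?thesis using k by (simp add: power2_eq_square)
    qed
    then have kp: "k < int p" using p3 by simp
    define k' where "k' = nat k"
    have k': "int k' = k" "k' < p" using k0 kp by (auto simp: k'_def)
    have "int (x * x) = int (p * k' + 2)" using k by (simp add: x(1) k'(1) power2_eq_square)
    then have eq: "x * x = p * k' + 2" by (simp only: of_nat_eq_iff)
    have "(p * k' + 2) mod 8 = 1" using odd_square_mod_8[OF x(2)] eq by simp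
    then have "(p * k') mod 8 = 7" by presburger
    then have m7: "(p mod 8 * (k' mod 8)) mod 8 = 7" and "odd (p * k')"
      by (simp only: mod_8_mult[of p k', symmetric], presburger)
    then have "k' mod 8 \<in> {1, 3, 5, 7}" by (intro odd_mod_8) simp
    with m7 have "k' mod 8 \<in> {3, 5}" using less.prems(2) by auto
    then obtain r where r: "prime r" "r dvd k'" "r mod 8 \<in> {3, 5}" using ex_prime_3_5_mod_8 by blast
    have "r \<le> k'" using r k0 k' by (intro dvd_imp_le) auto
    then have "r < p" using k' by simp
    moreover have "QuadRes (int r) 2"
    proof -
      have "int r dvd xi ^ 2 - 2" unfolding k k'(1)[symmetric] using r by simp
      then show ?thesis unfolding QuadRes_def by (intro exI[of _ xi]) (simp add: cong_iff_dvd_diff)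
    qed
    ultimately show False using less.IH r by blast
  qed
qed

lemma Legendre_2_eq_minus1:
  assumes "prime p" "p mod 8 \<in> {3, 5::nat}" shows "Legendre 2 (int p) = -1"
proof -
  have "2 < p" using odd_of_3_5_mod_8[OF assms(2)] by simp
  then have "\<not> int p dvd 2" using zdvd_imp_le[of "int p" 2] by auto
  then show ?thesis using not_QuadRes_2[OF assms] by (simp add: Legendre_def cong_0_iff)
qed

section \<open>Counting locally soluble forms\<close>

definition omegaQ :: "nat \<Rightarrow> nat" where
  "omegaQ n = card {p \<in> prime_factors n. p mod 8 \<in> {3, 5}}"

lemma prod_sym_diff:
  fixes f :: "'a \<Rightarrow> 'b::comm_monoid_mult"
  assumes "finite A" "finite B"
  shows "prod f A * prod f B = prod f (sym_diff A B) * (prod f (A \<inter> B) * prod f (A \<inter> B))"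
proof -
  have "prod f A = prod f (A - B) * prod f (A \<inter> B)" "prod f B = prod f (B - A) * prod f (A \<inter> B)"
    using prod.Int_Diff[OF assms(1), of f B] prod.Int_Diff[OF assms(2), of f A] by (simp_all add: Int_commute mult.commute)
  moreover have "prod f (sym_diff A B) = prod f (A - B) * prod f (B - A)"
    using assms by (intro prod.union_disjoint) auto
  ultimately show ?thesis by (simp add: mult_ac)
qed

lemma squarefree_of_nat_aux:
  assumes "squarefree (n::nat)" shows "squarefree (int n)" "squarefree (- int n)"
proof -
  show "squarefree (int n)"
  proof (rule squarefreeI)
    fix x :: int assume "x ^ 2 dvd int n"
    then have "int (nat \<bar>x\<bar>) ^ 2 dvd int n" by simp
    then have "int (nat \<bar>x\<bar> ^ 2) dvd int n" by (simp only: of_nat_power)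
    then have "nat \<bar>x\<bar> ^ 2 dvd n" by (simp only: int_dvd_int_iff)
    then have "nat \<bar>x\<bar> dvd 1" using squarefreeD[OF assms] by blast
    then show "x dvd 1" by (simp add: nat_eq_iff)
  qed
  then show "squarefree (- int n)" by (simp only: squarefree_minus)
qed

lemma finite_formsF: "M \<noteq> 0 \<Longrightarrow> finite (formsF B M)"
proof -
  assume M: "M \<noteq> 0"
  have "formsF B M \<subseteq> (\<lambda>a. (a, M div a)) ` {a. a dvd M}"
    by (auto simp: formsF_def image_iff)
  then show ?thesis using M finite_divisors_int[of M] by (meson finite_imageI finite_subset)
qed

text \<open>The sets of odd primes dividing \<open>n\<close> are a group under symmetric difference, and the products of those
  in one fibre of a homomorphism to a group of order \<open>4 * 2 ^ card P1\<close> are leading coefficients of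
  locally soluble forms.\<close>

lemma card_formsF_ls_ge:
  assumes n: "squarefree n" and \<epsilon>: "\<epsilon> \<in> {1, -1}" and N: "N = \<epsilon> * int n"
  shows "2 ^ omegaQ n \<le> 4 * card (formsF_ls (3 * N) (2 * N ^ 2))"
proof -
  define P where "P = {p \<in> prime_factors n. odd p}"
  define P1 where "P1 = {p \<in> P. p mod 8 \<notin> {3, 5}}"
  define Q where "Q = {p \<in> prime_factors n. p mod 8 \<in> {3, 5}}"
  \<comment> \<open>The entry at \<open>q = p\<close> makes \<open>\<sigma> A p\<close> the symbol
    required at \<open>p\<close> in both cases. With \<open>a\<close> the product of
    \<open>A\<close> and \<open>N = a * e\<close>, it is the symbol of \<open>a\<close> if
    \<open>p\<close> is not in \<open>A\<close>. If \<open>a = p * b\<close>, then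
    \<open>N div p = b * e\<close>, and it is the symbol of \<open>- e * b^2\<close>, that is of
    \<open>- e\<close>. As a product over \<open>A\<close> it is multiplicative under symmetric
    difference.\<close>
  define h where "h p q = (if q = p then Legendre (- (N div int p)) (int p) else Legendre (int q) (int p))" for p q
  define \<sigma> where "\<sigma> A p = (\<Prod>q\<in>A. h p q)" for A p
  define Good where "Good = {A \<in> Pow P. \<Prod>A mod 8 = 1 \<and> (\<forall>p\<in>P1. \<sigma> A p = 1)}"
  \<comment> \<open>Four odd classes modulo 8 and one sign for each prime in \<open>P1\<close>; the
    primes 3, 5 modulo 8 need no sign. Dividing \<open>2 ^ card P\<close> by the size of
    \<open>R\<close> leaves a quarter of \<open>2 ^ omegaQ n\<close>.\<close>
  define R where "R = ({1, 3, 5, 7::nat} \<times> (P1 \<rightarrow>\<^sub>E {1, -1::int}))"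
  define \<Psi> where "\<Psi> A = (\<Prod>A mod 8, restrict (\<sigma> A) P1)" for A
  have n0: "n > 0" using n not_squarefree_0 by (metis gr0I)
  have N0: "N \<noteq> 0" using \<epsilon> n0 by (auto simp: N)
  have finP: "finite P" by (simp add: P_def)
  have finP1: "finite P1" using finP by (simp add: P1_def)
  have Pp: "prime p" "p dvd n" "2 < p" "odd p" if "p \<in> P" for p
  proof -
    show "prime p" "p dvd n" "odd p" using that by (auto simp: P_def in_prime_factors_iff)
    then show "2 < p" using prime_ge_2_nat[of p] by (cases "p = 2") auto
  qed
  have finA: "finite A" if "A \<subseteq> P" for A using that finP finite_subset by blast
  have P_split: "P = P1 \<union> Q" "P1 \<inter> Q = {}"
  proof -
    have "odd p" if "p mod 8 \<in> {3, 5}" for p :: nat using odd_of_3_5_mod_8[OF that] by simp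
    then show "P = P1 \<union> Q" "P1 \<inter> Q = {}" by (auto simp: P1_def Q_def P_def)
  qed
  have N_quot: "int p dvd N" "N = int p * (N div int p)" "\<not> int p dvd N div int p" if "p \<in> P" for p
  proof -
    have sqN: "squarefree N" using n \<epsilon> squarefree_of_nat_aux by (auto simp: N)
    show d: "int p dvd N" using Pp(2)[OF that] by (simp add: N)
    then show eq: "N = int p * (N div int p)" by simp
    show "\<not> int p dvd N div int p"
      using squarefree_prime_quotient[OF _ sqN eq] Pp(1)[OF that] by simp
  qed
  have h_val: "h p q \<in> {1, -1}" if "p \<in> P" "q \<in> P" for p q
  proof -
    have "Legendre (- (N div int p)) (int p) \<noteq> 0" using N_quot(3)[OF that(1)] by (simp add: Legendre_eq_0_iff)
    moreover have "q \<noteq> p \<Longrightarrow> Legendre (int q) (int p) \<noteq> 0"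
      using Pp(1)[OF that(1)] Pp(1)[OF that(2)] primes_dvd_imp_eq[of p q] by (auto simp: Legendre_eq_0_iff)
    ultimately show ?thesis using Legendre_values[of "- (N div int p)" "int p"] Legendre_values[of "int q" "int p"]
      by (auto simp: h_def)
  qed
  have prod_val: "(\<Prod>q\<in>A. f q) \<in> {1, -1}" if "finite A" "\<forall>q\<in>A. f q \<in> {1, -1}" for A and f :: "nat \<Rightarrow> int"
    using that by (induction A rule: finite_induct) auto
  have \<sigma>_val: "\<sigma> A p \<in> {1, -1}" if "A \<subseteq> P" "p \<in> P" for A p
    unfolding \<sigma>_def using that h_val finA by (intro prod_val) auto
  have \<sigma>_sym: "\<sigma> (sym_diff A B) p = \<sigma> A p * \<sigma> B p" if "A \<subseteq> P" "B \<subseteq> P" "p \<in> P" for A B p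
  proof -
    have "\<sigma> (A \<inter> B) p \<in> {1, -1}" using that by (intro \<sigma>_val) auto
    then have "\<sigma> (A \<inter> B) p * \<sigma> (A \<inter> B) p = 1" by auto
    then show ?thesis using prod_sym_diff[of A B "h p"] that finA by (simp add: \<sigma>_def)
  qed
  have odd_prod: "odd (\<Prod>A)" if "A \<subseteq> P" for A
    using that finA[OF that] Pp(4) by (auto simp: even_prod_iff)
  have \<Psi>R: "\<Psi> A \<in> R" if "A \<subseteq> P" for A
    using that odd_mod_8[OF odd_prod[OF that]] \<sigma>_val[OF that] by (auto simp: \<Psi>_def R_def P1_def)
  \<comment> \<open>Symmetric difference with one element \<open>A0\<close> of a fibre maps this
    fibre injectively into the fibre over the identity, which is \<open>Good\<close>.\<close>
  have fiber: "card {A \<in> Pow P. \<Psi> A = r} \<le> card Good" for r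
  proof (cases "{A \<in> Pow P. \<Psi> A = r} = {}")
    case True
    show ?thesis unfolding True by simp
  next
    case False
    then obtain A0 where A0: "A0 \<subseteq> P" "\<Psi> A0 = r" by blast
    show ?thesis
    proof (rule card_inj_on_le)
      show "inj_on (\<lambda>A. sym_diff A A0) {A \<in> Pow P. \<Psi> A = r}" by (rule inj_onI) blast
      show "finite Good" unfolding Good_def using finP by simp
      show "(\<lambda>A. sym_diff A A0) ` {A \<in> Pow P. \<Psi> A = r} \<subseteq> Good"
      proof clarify
        fix A assume A: "A \<subseteq> P" "r = \<Psi> A"
        have eq: "\<Prod>A mod 8 = \<Prod>A0 mod 8" and \<sigma>eq: "p \<in> P1 \<Longrightarrow> \<sigma> A p = \<sigma> A0 p" for p
          using A A0 by (auto simp: \<Psi>_def dest!: fun_cong[of _ _ p] split: if_splits)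
        have "\<Prod>A * \<Prod>A0 = \<Prod>(sym_diff A A0) * (\<Prod>(A \<inter> A0) * \<Prod>(A \<inter> A0))"
          using prod_sym_diff[of A A0 "\<lambda>x. x"] A A0 finA by simp
        then have "(\<Prod>A * \<Prod>A0) mod 8 = (\<Prod>(sym_diff A A0) mod 8 * ((\<Prod>(A \<inter> A0) * \<Prod>(A \<inter> A0)) mod 8)) mod 8"
          using mod_8_mult[of "\<Prod>(sym_diff A A0)" "\<Prod>(A \<inter> A0) * \<Prod>(A \<inter> A0)"] by (simp only:)
        also have "(\<Prod>(A \<inter> A0) * \<Prod>(A \<inter> A0)) mod 8 = 1" using A by (intro odd_square_mod_8 odd_prod) auto
        finally have "\<Prod>(sym_diff A A0) mod 8 = (\<Prod>A * \<Prod>A0) mod 8" by simp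
        also have "\<dots> = (\<Prod>A0 * \<Prod>A0) mod 8" using eq by (rule mod_mult_cong) simp
        also have "\<dots> = 1" using A0 by (intro odd_square_mod_8 odd_prod) auto
        finally have 1: "\<Prod>(sym_diff A A0) mod 8 = 1" .
        have 2: "\<sigma> (sym_diff A A0) p = 1" if p: "p \<in> P1" for p
        proof -
          have pP: "p \<in> P" using p by (simp add: P1_def)
          have "\<sigma> A0 p \<in> {1, -1}" using A0 pP by (intro \<sigma>_val)
          then show ?thesis using \<sigma>_sym[OF A(1) A0(1) pP] \<sigma>eq[OF p] by auto
        qed
        show "sym_diff A A0 \<in> Good" using 1 2 A A0 by (auto simp: Good_def)
      qed
    qed
  qed
  have "2 ^ card P = card (Pow P)" using finP by (simp add: card_Pow)
  also have "\<dots> = (\<Sum>A\<in>Pow P. 1)" by simp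
  also have "\<dots> = (\<Sum>r\<in>R. \<Sum>A\<in>{A \<in> Pow P. \<Psi> A = r}. 1)"
  proof (rule sum.group[symmetric])
    show "finite (Pow P)" using finP by simp
    show "finite R" unfolding R_def using finP1 by (intro finite_cartesian_product finite_PiE) auto
    show "\<Psi> ` Pow P \<subseteq> R" using \<Psi>R by blast
  qed
  also have "\<dots> = (\<Sum>r\<in>R. card {A \<in> Pow P. \<Psi> A = r})" by simp
  also have "\<dots> \<le> (\<Sum>r\<in>R. card Good)" by (intro sum_mono fiber)
  also have "\<dots> = card R * card Good" by simp
  also have "card R = 4 * 2 ^ card P1" unfolding R_def using finP1 by (simp add: card_cartesian_product card_PiE numeral_2_eq_2)
  finally have "2 ^ card P1 * 2 ^ card Q \<le> 2 ^ card P1 * (4 * card Good)"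
    unfolding P_split(1) using P_split(2) finP1 by (simp add: card_Un_disjoint Q_def power_add mult_ac)
  then have main: "2 ^ card Q \<le> 4 * card Good" by simp
  define F where "F A = (int (\<Prod>A), 2 * int (\<Prod>A) * (N div int (\<Prod>A)) ^ 2)" for A :: "nat set"
  have "card Good \<le> card (formsF_ls (3 * N) (2 * N ^ 2))"
  proof (rule card_inj_on_le)
    show "finite (formsF_ls (3 * N) (2 * N ^ 2))"
      using finite_formsF[of "2 * N ^ 2" "3 * N"] N0 by (auto simp: formsF_ls_def intro: finite_subset[rotated])
    have mem: "p \<in> A \<longleftrightarrow> p dvd \<Prod>A" if AP: "A \<subseteq> P" and pP: "p \<in> P" for A p
    proof
      assume "p \<in> A" then show "p dvd \<Prod>A" using dvd_prodI[OF finA[OF AP], of p "\<lambda>x. x"] by simp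
    next
      assume "p dvd \<Prod>A"
      then obtain q where "q \<in> A" "p dvd q" using Pp(1)[OF pP] finA[OF AP] by (auto simp: prime_dvd_prod_iff)
      then show "p \<in> A" using Pp(1) pP AP primes_dvd_imp_eq by blast
    qed
    show "inj_on F Good"
    proof (rule inj_onI)
      fix A B assume AB: "A \<in> Good" "B \<in> Good" "F A = F B"
      then have s: "A \<subseteq> P" "B \<subseteq> P" and "int (\<Prod>A) = int (\<Prod>B)" by (auto simp: Good_def F_def)
      then have "\<Prod>A = \<Prod>B" by (simp only: of_nat_eq_iff)
      then show "A = B" using mem[OF s(1)] mem[OF s(2)] s by (auto; blast)
    qed
    show "F ` Good \<subseteq> formsF_ls (3 * N) (2 * N ^ 2)"
    proof (rule image_subsetI)
      fix A assume AG: "A \<in> Good"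
      then have A: "A \<subseteq> P" "\<Prod>A mod 8 = 1" "\<And>p. p \<in> P1 \<Longrightarrow> \<sigma> A p = 1" by (auto simp: Good_def)
      define a where "a = int (\<Prod>A)"
      define e where "e = N div a"
      have aN: "a dvd N"
      proof -
        have "(\<Prod>q\<in>A. int q) dvd N" using A(1) Pp N_quot(1) finA[OF A(1)] by (intro prod_primes_dvd) auto
        then show ?thesis by (simp add: a_def)
      qed
      have N_ae: "N = a * e" using aN by (simp add: e_def)
      have "a \<noteq> 0" using N0 N_ae by auto
      moreover have "a \<ge> 0" unfolding a_def by (rule of_nat_0_le_iff)
      ultimately have a_pos: "a > 0" by simp
      have sqN: "squarefree N" using n \<epsilon> squarefree_of_nat_aux by (auto simp: N)
      have sqa: "squarefree a" using squarefree_mono[OF aN sqN] .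
      have a8: "[a = 1] (mod 8)"
      proof -
        have "[\<Prod>A = 1] (mod 8)" using A(2) by (simp add: cong_def)
        then have "[int (\<Prod>A) = int 1] (mod int 8)" by (simp only: cong_int_iff)
        then show ?thesis by (simp add: a_def)
      qed
      have "locally_soluble a (3 * (a * e)) (2 * a * e ^ 2)"
      proof (rule locally_solubleI[OF a_pos a8])
        fix p' :: int assume p': "prime p'" "p' > 2" "p' dvd a * e"
        obtain p where p: "p' = int p" "prime p" "2 < p" using int_prime_obtain[OF p'(1,2)] by blast
        have "int p dvd \<epsilon> * int n" using p' p N_ae N by simp
        then have "int p dvd int n" using \<epsilon> by auto
        then have "p dvd n" by simp
        have oddp: "odd p" using p prime_odd_nat by blast
        have pP: "p \<in> P" using p \<open>p dvd n\<close> n0 oddp by (simp add: P_def in_prime_factors_iff)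
        have Lm: "Legendre (u * v) p' = Legendre u p' * Legendre v p'" for u v using Legendre_mult[OF p(2,3)] p(1) by simp
        have Lnz: "Legendre u p' = 1 \<or> Legendre u p' = -1" if "\<not> p' dvd u" for u
          using Legendre_values[of u p'] Legendre_eq_0_iff[of u p'] that by auto
        have not_both: "\<not> p' dvd e" if pa: "p' dvd a"
        proof
          assume "p' dvd e"
          obtain a' where "a = p' * a'" using pa by (elim dvdE)
          then have "N = p' * (a' * e)" by (simp add: N_ae)
          then have "\<not> p' dvd a' * e" by (rule squarefree_prime_quotient[OF p'(1) sqN])
          then show False using \<open>p' dvd e\<close> by simp
        qed
        have dvdA: "p' dvd a \<longleftrightarrow> p \<in> A" using mem[OF A(1) pP] unfolding p(1) a_def int_dvd_int_iff by simp
        show "Legendre a p' = 1 \<or> Legendre (2 * a) p' = 1 \<or> Legendre (- e) p' = 1 \<or> Legendre (- (2 * e)) p' = 1"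
        proof (cases "p mod 8 \<in> {3, 5}")
          case True
          then have L2: "Legendre 2 p' = -1" using Legendre_2_eq_minus1[OF p(2)] p(1) by simp
          have "Legendre (- (2 * e)) p' = Legendre 2 p' * Legendre (- e) p'" using Lm[of 2 "- e"] by simp
          then show ?thesis using L2 Lm[of 2 a] Lnz[of a] Lnz[of "- e"] not_both by (cases "p' dvd a") auto
        next
          case False
          then have "p \<in> P1" using pP by (simp add: P1_def)
          then have \<sigma>1: "\<sigma> A p = 1" by (rule A(3))
          have Lprod: "(\<Prod>q\<in>B. Legendre (int q) p') = Legendre (int (\<Prod>B)) p'" if "finite B" for B :: "nat set"
            using that p'(1)
          proof (induction B rule: finite_induct)
            case empty
            have "Legendre (1 ^ 2) p' = 1" using p'(1) prime_abs_neq_1[of p'] by (intro Legendre_square) auto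
            then show ?case by simp
          next
            case (insert q B) then show ?case by (simp add: Lm)
          qed
          show ?thesis
          proof (cases "p \<in> A")
            case False
            have "\<sigma> A p = (\<Prod>q\<in>A. Legendre (int q) p')" unfolding \<sigma>_def h_def p(1) using False by (intro prod.cong) auto
            then have "Legendre a p' = 1" using \<sigma>1 Lprod[OF finA[OF A(1)]] by (simp add: a_def)
            then show ?thesis by simp
          next
            case True
            define b where "b = int (\<Prod>(A - {p}))"
            have ab: "a = p' * b" unfolding a_def b_def p(1) using finA[OF A(1)] True by (simp add: prod.remove)
            have pb: "\<not> p' dvd b" using squarefree_prime_quotient[OF p'(1) sqa ab] .
            have Nd: "N div p' = b * e" using p'(2) by (simp add: N_ae ab)
            have "\<sigma> A p = h p p * (\<Prod>q\<in>A - {p}. h p q)" unfolding \<sigma>_def using finA[OF A(1)] True by (rule prod.remove)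
            also have "(\<Prod>q\<in>A - {p}. h p q) = (\<Prod>q\<in>A - {p}. Legendre (int q) p')"
              unfolding h_def p(1) by (intro prod.cong) auto
            also have "\<dots> = Legendre b p'" using Lprod[of "A - {p}"] finA[OF A(1)] by (simp add: b_def)
            also have "h p p = Legendre (- (b * e)) p'" unfolding h_def using Nd p(1) by simp
            finally have "Legendre (- (b * e)) p' * Legendre b p' = 1" using \<sigma>1 by simp
            then have "Legendre (- e * b ^ 2) p' = 1" unfolding Lm[symmetric] by (simp add: power2_eq_square mult_ac)
            moreover have "Legendre (b ^ 2) p' = 1" using Legendre_square[OF p'(1) pb] .
            ultimately show ?thesis using Lm[of "- e" "b ^ 2"] by simp
          qed
        qed
      qed
      moreover have "(a, 2 * a * e ^ 2) \<in> formsF (3 * N) (2 * N ^ 2)"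
        using a_pos sqa squarefree_factorial_semiring''[of a] by (auto simp: formsF_def N_ae power_mult_distrib power2_eq_square)
      moreover have "3 * N = 3 * (a * e)" by (simp add: N_ae)
      ultimately have "(a, 2 * a * e ^ 2) \<in> formsF_ls (3 * N) (2 * N ^ 2)" by (simp add: formsF_ls_def)
      moreover have "F A = (a, 2 * a * e ^ 2)" by (simp add: F_def a_def e_def)
      ultimately show "F A \<in> formsF_ls (3 * N) (2 * N ^ 2)" by simp
    qed
  qed
  then show ?thesis using main by (simp add: omegaQ_def Q_def)
qed

section \<open>Squarefree numbers with many prime factors congruent to 3 or 5 modulo 8\<close>

text \<open>Adjoining one more element to the sets of size \<open>j\<close> produces each set of
  size \<open>j + 1\<close> exactly \<open>j + 1\<close> times. Leaving out the elements already in
  the set costs at most \<open>K * \<epsilon>\<close> of the full sum.\<close>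

lemma elementary_symmetric_lower:
  fixes f :: "'a \<Rightarrow> real"
  assumes Q: "finite Q" and f: "\<And>p. p \<in> Q \<Longrightarrow> 0 \<le> f p \<and> f p \<le> \<epsilon>" and s: "sum f Q \<ge> real K * \<epsilon>" and j: "j \<le> K"
    and \<epsilon>: "\<epsilon> \<ge> 0"
  shows "(\<Sum>A | A \<subseteq> Q \<and> card A = j. prod f A) \<ge> (sum f Q - real K * \<epsilon>) ^ j / fact j"
  using j
proof (induction j)
  case 0
  have "{A. A \<subseteq> Q \<and> card A = 0} = {{}}" using Q finite_subset by (auto simp: card_eq_0_iff)
  then show ?case by simp
next
  case (Suc j)
  define E where "E i = {A. A \<subseteq> Q \<and> card A = i}" for i
  define S where "S = sum f Q - real K * \<epsilon>"
  have finE: "finite (E i)" for i unfolding E_def by (rule finite_subset[of _ "Pow Q"]) (use Q in auto)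
  have finA: "finite A" if "A \<in> E i" for A i using that Q finite_subset by (auto simp: E_def)
  have nn: "prod f A \<ge> 0" if "A \<in> E i" for A i using that f by (intro prod_nonneg) (auto simp: E_def)
  have "S * (S ^ j / fact j) \<le> S * (\<Sum>A\<in>E j. prod f A)"
    using Suc s by (intro mult_left_mono) (auto simp: E_def S_def)
  also have "\<dots> = (\<Sum>A\<in>E j. prod f A * S)" by (simp add: sum_distrib_left mult.commute)
  also have "\<dots> \<le> (\<Sum>A\<in>E j. prod f A * sum f (Q - A))"
  proof (intro sum_mono mult_left_mono nn)
    fix A assume A: "A \<in> E j"
    have "sum f A \<le> (\<Sum>p\<in>A. \<epsilon>)" using A f by (intro sum_mono) (auto simp: E_def)
    also have "\<dots> = real j * \<epsilon>" using A by (simp add: E_def)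
    also have "\<dots> \<le> real K * \<epsilon>" using Suc.prems \<epsilon> by (intro mult_right_mono) auto
    finally have "sum f A \<le> real K * \<epsilon>" .
    moreover have "sum f (Q - A) = sum f Q - sum f A" using A Q by (intro sum_diff) (auto simp: E_def)
    ultimately show "S \<le> sum f (Q - A)" by (simp add: S_def)
  qed
  also have "\<dots> = (\<Sum>A\<in>E j. \<Sum>p\<in>Q - A. prod f (insert p A))"
  proof (rule sum.cong[OF refl])
    fix A assume A: "A \<in> E j"
    show "prod f A * sum f (Q - A) = (\<Sum>p\<in>Q - A. prod f (insert p A))"
      unfolding sum_distrib_left using finA[OF A] by (intro sum.cong refl) (simp add: mult.commute)
  qed
  also have "\<dots> = (\<Sum>(A, p)\<in>(SIGMA A:E j. Q - A). prod f (insert p A))" using finE Q by (intro sum.Sigma) auto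
  also have "\<dots> = (\<Sum>(B, p)\<in>(SIGMA B:E (Suc j). B). prod f B)"
  proof (rule sum.reindex_bij_witness[of _ "\<lambda>(B, p). (B - {p}, p)" "\<lambda>(A, p). (insert p A, p)"])
    fix a assume a: "a \<in> (SIGMA A:E j. Q - A)"
    obtain A p where ap: "a = (A, p)" "A \<in> E j" "p \<in> Q" "p \<notin> A" using a by auto
    show "(case case a of (A, p) \<Rightarrow> (insert p A, p) of (B, p) \<Rightarrow> (B - {p}, p)) = a" using ap by simp
    show "(case a of (A, p) \<Rightarrow> (insert p A, p)) \<in> (SIGMA B:E (Suc j). B)" using ap finA[OF ap(2)] by (auto simp: E_def)
    show "(case case a of (A, p) \<Rightarrow> (insert p A, p) of (B, p) \<Rightarrow> prod f B) = (case a of (A, p) \<Rightarrow> prod f (insert p A))"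
      using ap by simp
  next
    fix b assume b: "b \<in> (SIGMA B:E (Suc j). B)"
    obtain B p where bp: "b = (B, p)" "B \<in> E (Suc j)" "p \<in> B" using b by auto
    show "(case case b of (B, p) \<Rightarrow> (B - {p}, p) of (A, p) \<Rightarrow> (insert p A, p)) = b" using bp by auto
    show "(case b of (B, p) \<Rightarrow> (B - {p}, p)) \<in> (SIGMA A:E j. Q - A)" using bp finA[OF bp(2)] by (auto simp: E_def)
  qed
  also have "\<dots> = (\<Sum>B\<in>E (Suc j). \<Sum>p\<in>B. prod f B)" using finE finA by (intro sum.Sigma[symmetric]) auto
  also have "\<dots> = (\<Sum>B\<in>E (Suc j). real (Suc j) * prod f B)" by (intro sum.cong refl) (simp add: E_def)
  also have "\<dots> = real (Suc j) * (\<Sum>B\<in>E (Suc j). prod f B)" by (simp add: sum_distrib_left)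
  finally have "S ^ Suc j / fact j \<le> real (Suc j) * (\<Sum>B\<in>E (Suc j). prod f B)" by simp
  then have "S ^ Suc j / fact j \<le> (\<Sum>B\<in>E (Suc j). prod f B) * real (Suc j)" by (simp only: mult.commute)
  then have "(S ^ Suc j / fact j) / real (Suc j) \<le> (\<Sum>B\<in>E (Suc j). prod f B)" by (rule mult_imp_div_pos_le[rotated]) simp
  moreover have "(S ^ Suc j / fact j) / real (Suc j) = S ^ Suc j / fact (Suc j)" by (simp add: mult.commute)
  ultimately show ?case unfolding E_def S_def by (simp only:)
qed

lemma card_multiples_le: "d > 0 \<Longrightarrow> real (card {m \<in> {1..Y}. d dvd m}) \<le> real Y / real d"
proof -
  assume d: "d > 0"
  have "{m \<in> {1..Y}. d dvd m} \<subseteq> (\<lambda>k. d * k) ` {1..Y div d}"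
    using d by (auto elim!: dvdE simp: less_eq_div_iff_mult_less_eq mult.commute intro!: imageI Suc_leI Nat.gr0I)
  then have "card {m \<in> {1..Y}. d dvd m} \<le> card ((\<lambda>k. d * k) ` {1..Y div d})" by (intro card_mono) auto
  also have "\<dots> \<le> Y div d" using card_image_le[of "{1..Y div d}" "\<lambda>k. d * k"] by simp
  finally have "real (card {m \<in> {1..Y}. d dvd m}) \<le> real (Y div d)" by simp
  also have "\<dots> \<le> real Y / real d" by (rule of_nat_div_le_of_nat)
  finally show ?thesis .
qed

lemma sum_inverse_squares_from_2_le: "(\<Sum>k=2..y. 1 / real k ^ 2) \<le> 3 / 4"
proof -
  define T where "T y = (\<Sum>k=2..y + 2. 1 / real k ^ 2)" for y :: nat
  have rec: "T (Suc y) = 1 / real (y + 3) ^ 2 + T y" for y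
  proof -
    have "{2..Suc y + 2} = insert (y + 3) {2..y + 2}" by auto
    then show ?thesis unfolding T_def by (simp only:) (subst sum.insert, auto)
  qed
  have T: "T y \<le> 3 / 4 - 1 / real (y + 2)" for y
  proof (induction y)
    case 0 show ?case by (simp add: T_def)
  next
    case (Suc y)
    have "1 / real (y + 3) ^ 2 \<le> 1 / real (y + 2) - 1 / real (Suc y + 2)"
      by (simp add: divide_simps power2_eq_square, simp add: algebra_simps)
    then show ?case using Suc rec[of y] by linarith
  qed
  show ?thesis
  proof (cases "y \<ge> 2")
    case True
    then have "y - 2 + 2 = y" by simp
    then have "(\<Sum>k=2..y. 1 / real k ^ 2) = T (y - 2)" unfolding T_def by (simp only:)
    also have "\<dots> \<le> 3 / 4 - 1 / real (y - 2 + 2)" by (rule T)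
    also have "\<dots> \<le> 3 / 4" by simp
    finally show ?thesis .
  qed simp
qed

text \<open>A union bound: multiples of some \<open>j^2\<close> with \<open>j \<ge> 2\<close> take
  at most 3 / 4 of the range and multiples of elements of \<open>A\<close> at most 1 / 8, which
  leaves 1 / 8.\<close>

lemma card_squarefree_coprime_ge:
  assumes A: "finite A" "\<And>p. p \<in> A \<Longrightarrow> p > 0" and s: "(\<Sum>p\<in>A. 1 / real p) \<le> 1 / 8"
  shows "real (card {m \<in> {1..Y}. squarefree m \<and> (\<forall>p\<in>A. \<not> p dvd m)}) \<ge> real Y / 8"
proof -
  define G where "G = {m \<in> {1..Y}. squarefree m \<and> (\<forall>p\<in>A. \<not> p dvd m)}"
  define M where "M d = {m \<in> {1..Y}. d dvd m}" for d
  have "{1..Y} \<subseteq> G \<union> ((\<Union>j\<in>{2..Y}. M (j ^ 2)) \<union> (\<Union>p\<in>A. M p))"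
  proof
    fix m assume m: "m \<in> {1..Y}"
    show "m \<in> G \<union> ((\<Union>j\<in>{2..Y}. M (j ^ 2)) \<union> (\<Union>p\<in>A. M p))"
    proof (cases "squarefree m")
      case True
      then show ?thesis using m by (auto simp: G_def M_def)
    next
      case False
      then obtain q where q: "prime q" "q ^ 2 dvd m" using squarefree_factorial_semiring[of m] m by auto
      have "q ^ 2 \<le> m" using q m by (intro dvd_imp_le) auto
      moreover have "q \<le> q ^ 2" by (simp add: power2_eq_square)
      ultimately have "q \<in> {2..Y}" using m prime_ge_2_nat[OF q(1)] by simp
      then show ?thesis using q m by (auto simp: M_def)
    qed
  qed
  then have "card {1..Y} \<le> card (G \<union> ((\<Union>j\<in>{2..Y}. M (j ^ 2)) \<union> (\<Union>p\<in>A. M p)))"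
    using A by (intro card_mono) (auto simp: G_def M_def)
  also have "\<dots> \<le> card G + (card (\<Union>j\<in>{2..Y}. M (j ^ 2)) + card (\<Union>p\<in>A. M p))"
    by (intro order_trans[OF card_Un_le] add_left_mono card_Un_le)
  also have "\<dots> \<le> card G + ((\<Sum>j=2..Y. card (M (j ^ 2))) + (\<Sum>p\<in>A. card (M p)))"
    using A by (intro add_left_mono add_mono card_UN_le) auto
  finally have "real Y \<le> real (card G) + ((\<Sum>j=2..Y. real (card (M (j ^ 2)))) + (\<Sum>p\<in>A. real (card (M p))))"
    by (simp flip: of_nat_sum of_nat_add)
  also have "\<dots> \<le> real (card G) + ((\<Sum>j=2..Y. real Y * (1 / real j ^ 2)) + (\<Sum>p\<in>A. real Y * (1 / real p)))"
  proof (intro add_left_mono add_mono sum_mono)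
    fix j assume "j \<in> {2..Y}"
    then show "real (card (M (j ^ 2))) \<le> real Y * (1 / real j ^ 2)"
      unfolding M_def using card_multiples_le[of "j ^ 2" Y] by simp
  next
    fix p assume "p \<in> A"
    then show "real (card (M p)) \<le> real Y * (1 / real p)" unfolding M_def using card_multiples_le[of p Y] A by simp
  qed
  also have "\<dots> = real (card G) + real Y * ((\<Sum>j=2..Y. 1 / real j ^ 2) + (\<Sum>p\<in>A. 1 / real p))"
    by (simp add: sum_distrib_left distrib_left)
  also have "\<dots> \<le> real (card G) + real Y * (3 / 4 + 1 / 8)"
    using s by (intro add_left_mono mult_left_mono add_mono sum_inverse_squares_from_2_le) auto
  finally show ?thesis by (simp add: G_def)
qed

text \<open>\<open>2 ^ omegaQ n\<close> counts sets of primes 3, 5 modulo 8 dividing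
  \<open>n\<close>, and only those of size \<open>K\<close> inside \<open>Q\<close> are kept. For
  such a set with product \<open>d\<close>, the multiples \<open>d * m\<close> with \<open>m\<close>
  squarefree and prime to \<open>d\<close> are counted. The bound on \<open>y\<close> gives
  \<open>d * d \<le> x\<close>, so rounding \<open>x div d\<close> loses at most a factor 2. The
  primes are at least \<open>8 * K\<close> to bring the sum of \<open>1 / p\<close> over the set
  down to 1 / 8. Together this gives 1 / 16.\<close>

lemma sum_two_power_omegaQ_ge_elementary:
  assumes K: "K \<ge> 1" and y: "y ^ (2 * K) \<le> x"
    and Q: "Q = {p \<in> primesQ_upto y. 8 * K \<le> p}"
  shows "(\<Sum>n\<in>sqfree_upto x. 2 ^ omegaQ n :: real) \<ge> real x / 16 * (\<Sum>A | A \<subseteq> Q \<and> card A = K. \<Prod>p\<in>A. 1 / real p)"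
proof -
  have finQ: "finite Q" by (simp add: Q)
  define E where "E = {A. A \<subseteq> Q \<and> card A = K}"
  have finE: "finite E" unfolding E_def using finQ by simp
  have Qp: "prime p" "p \<le> y" "p mod 8 \<in> {3, 5}" "8 * K \<le> p" if "p \<in> Q" for p
    using that by (auto simp: Q primesQ_upto_def primes_upto_def)
  have low: "real x / 16 * (\<Prod>p\<in>A. 1 / real p) \<le> real (card {n \<in> sqfree_upto x. A \<subseteq> prime_factors n})" if A: "A \<in> E" for A
  proof -
    have AQ: "A \<subseteq> Q" and cA: "card A = K" using A by (auto simp: E_def)
    have finA: "finite A" using AQ finQ finite_subset by blast
    define d where "d = \<Prod>A"
    have d0: "d > 0" unfolding d_def using AQ Qp(1) prime_gt_0_nat by (intro prod_pos) auto
    have "d \<le> (\<Prod>p\<in>A. y)" unfolding d_def using AQ Qp(2) by (intro prod_mono) auto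
    also have "\<dots> = y ^ K" using cA by simp
    finally have "d * d \<le> y ^ K * y ^ K" by (intro mult_mono) auto
    also have "\<dots> \<le> x" using y by (simp add: power_add[symmetric] mult_2)
    finally have dx: "d * d \<le> x" .
    define Y where "Y = x div d"
    have "d \<le> Y" unfolding Y_def using dx d0 by (simp add: less_eq_div_iff_mult_less_eq)
    then have Y1: "Y \<ge> 1" using d0 by simp
    have "x < d * (Y + 1)" unfolding Y_def using d0 by (metis Suc_eq_plus1 dividend_less_times_div mult.commute mult_Suc_right)
    then have "x \<le> d * (2 * Y)" using Y1 by (metis add_leE le_trans less_imp_le mult_2 mult_le_mono2 nat_add_left_cancel_le)
    then have xY: "real x \<le> real d * (2 * real Y)" by (metis of_nat_le_iff of_nat_mult of_nat_numeral)
    define G where "G = {m \<in> {1..Y}. squarefree m \<and> (\<forall>p\<in>A. \<not> p dvd m)}"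
    have "(\<Sum>p\<in>A. 1 / real p) \<le> (\<Sum>p\<in>A. 1 / (8 * real K))"
    proof (rule sum_mono)
      fix p assume "p \<in> A"
      then have "8 * K \<le> p" using AQ Qp(4) by blast
      then have "8 * real K \<le> real p" by (metis of_nat_le_iff of_nat_mult of_nat_numeral)
      then show "1 / real p \<le> 1 / (8 * real K)" using K by (intro divide_left_mono) auto
    qed
    also have "\<dots> = 1 / 8" using cA K by simp
    finally have "(\<Sum>p\<in>A. 1 / real p) \<le> 1 / 8" .
    then have G: "real Y / 8 \<le> real (card G)"
      unfolding G_def using finA AQ Qp(1) prime_gt_0_nat by (intro card_squarefree_coprime_ge) auto
    have "card G \<le> card {n \<in> sqfree_upto x. A \<subseteq> prime_factors n}"
    proof (rule card_inj_on_le)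
      show "inj_on (\<lambda>m. d * m) G" using d0 by (intro inj_onI) simp
      show "(\<lambda>m. d * m) ` G \<subseteq> {n \<in> sqfree_upto x. A \<subseteq> prime_factors n}"
      proof (rule image_subsetI)
        fix m assume m: "m \<in> G"
        have "d * m \<le> d * Y" using m by (simp add: G_def)
        also have "\<dots> \<le> x" by (simp add: Y_def)
        finally have le: "d * m \<le> x" .
        have pos: "d * m > 0" using d0 m by (simp add: G_def)
        have "squarefree d" unfolding d_def
        proof (rule squarefree_prod_coprime)
          fix p q assume pq: "p \<in> A" "q \<in> A" "p \<noteq> q"
          then have "prime p" "prime q" using AQ Qp(1) by auto
          then show "coprime p q" using pq(3) by (rule primes_coprime)
        next
          fix p assume "p \<in> A"
          then have "prime p" using AQ Qp(1) by auto
          then show "squarefree p" by (rule squarefree_prime)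
        qed
        moreover have "coprime d m"
          unfolding d_def
        proof (rule prod_coprime_left)
          fix p assume "p \<in> A"
          then have "prime p" "\<not> p dvd m" using AQ Qp(1) m by (auto simp: G_def)
          then show "coprime p m" by (rule prime_imp_coprime)
        qed
        ultimately have sq: "squarefree (d * m)" using m by (intro squarefree_mult_coprime) (auto simp: G_def)
        have "A \<subseteq> prime_factors (d * m)"
        proof
          fix p assume p: "p \<in> A"
          then have "p dvd d" unfolding d_def using dvd_prodI[OF finA, of p "\<lambda>x. x"] by simp
          then show "p \<in> prime_factors (d * m)" using p AQ Qp(1) pos by (auto simp: in_prime_factors_iff)
        qed
        then show "d * m \<in> {n \<in> sqfree_upto x. A \<subseteq> prime_factors n}" using le pos sq by (simp add: sqfree_upto_def)
      qed
    qed simp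
    then have "real Y / 8 \<le> real (card {n \<in> sqfree_upto x. A \<subseteq> prime_factors n})" using G by linarith
    moreover have "real x / 16 * (\<Prod>p\<in>A. 1 / real p) = real x / (16 * real d)" by (simp add: d_def prod_dividef)
    moreover have "real x / (16 * real d) \<le> real Y / 8" using xY d0 by (simp add: field_simps)
    ultimately show ?thesis by linarith
  qed
  have up: "(\<Sum>A\<in>E. if A \<subseteq> prime_factors n then 1 else 0) \<le> (2 ^ omegaQ n :: real)" for n
  proof -
    define B where "B = {p \<in> prime_factors n. p mod 8 \<in> {3, 5}}"
    have "(\<Sum>A\<in>E. if A \<subseteq> prime_factors n then 1 else 0 :: real) = real (card {A \<in> E. A \<subseteq> prime_factors n})"
      using finE by (simp add: sum.If_cases Int_def)
    also have "card {A \<in> E. A \<subseteq> prime_factors n} \<le> card (Pow B)"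
      using Qp(3) by (intro card_mono) (auto simp: B_def E_def)
    also have "\<dots> = 2 ^ omegaQ n" by (simp add: card_Pow omegaQ_def B_def)
    finally show ?thesis by simp
  qed
  have "real x / 16 * (\<Sum>A\<in>E. \<Prod>p\<in>A. 1 / real p) = (\<Sum>A\<in>E. real x / 16 * (\<Prod>p\<in>A. 1 / real p))"
    by (rule sum_distrib_left)
  also have "\<dots> \<le> (\<Sum>A\<in>E. real (card {n \<in> sqfree_upto x. A \<subseteq> prime_factors n}))" by (intro sum_mono low)
  also have "\<dots> = (\<Sum>A\<in>E. \<Sum>n\<in>sqfree_upto x. if A \<subseteq> prime_factors n then 1 else 0)"
    by (intro sum.cong refl) (simp add: sum.If_cases Int_def)
  also have "\<dots> = (\<Sum>n\<in>sqfree_upto x. \<Sum>A\<in>E. if A \<subseteq> prime_factors n then 1 else 0)" by (rule sum.swap)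
  also have "\<dots> \<le> (\<Sum>n\<in>sqfree_upto x. 2 ^ omegaQ n)" by (intro sum_mono up)
  finally show ?thesis by (simp add: E_def)
qed

text \<open>With \<open>y\<close> about \<open>x^(1 / (2 * K))\<close>, the double logarithms of
  \<open>x\<close> and \<open>y\<close> differ by a bounded amount. The sum of \<open>1 / p\<close>
  over \<open>Q\<close> is then at least a sixth of \<open>ln (ln x)\<close> for large
  \<open>x\<close>, and its elementary symmetric function of degree \<open>K\<close> supplies the
  \<open>K\<close>-th power.\<close>

lemma sum_two_power_omegaQ_ge:
  assumes K: "K \<ge> 1"
  shows "\<exists>c>0. eventually (\<lambda>x. (\<Sum>n\<in>sqfree_upto x. 2 ^ omegaQ n :: real) \<ge> c * real x * ln (ln (real x)) ^ K) sequentially"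
proof -
  \<comment> \<open>It dominates the constants lost on the way from \<open>1 / 3 * ln l\<close> to
    \<open>S\<close>; once \<open>ln l \<ge> 6 * C0\<close>, half of the main term survives.\<close>
  define C0 where "C0 = 2 * real K + 9 + 8 * real K + 1"
  define c where "c = 1 / 16 * (1 / 6) ^ K / (fact K :: real)"
  have c: "c > 0" by (simp add: c_def)
  have lim: "filterlim (\<lambda>x::nat. ln (ln (real x))) at_top sequentially" by real_asymp
  have ev: "eventually (\<lambda>x::nat. ln (ln (real x)) \<ge> 6 * C0) sequentially"
    using lim unfolding filterlim_at_top by blast
  have "eventually (\<lambda>x. (\<Sum>n\<in>sqfree_upto x. 2 ^ omegaQ n :: real) \<ge> c * real x * ln (ln (real x)) ^ K) sequentially"
    using ev eventually_gt_at_top[of 2]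
  proof eventually_elim
    case (elim x)
    have x: "real x > 0" "x > 2" using elim by auto
    define l where "l = ln (real x)"
    have l0: "l > 0" unfolding l_def using x by (intro ln_gt_zero) simp
    have "ln l > 0" using elim(1) of_nat_0_le_iff[where ?'a=real, of K] unfolding l_def C0_def by argo
    then have l1: "l > 1" using l0 by (rule ln_gt_zero_imp_gt_one)
    have lnl: "ln l \<le> l - 1" using l1 by (intro ln_le_minus_one) simp
    have l_big: "l \<ge> 6 * C0" using elim(1) lnl unfolding l_def[symmetric] by linarith
    define z where "z = exp (l / (2 * real K))"
    define y where "y = nat \<lfloor>z\<rfloor>"
    have z0: "z > 0" by (simp add: z_def)
    have yz: "real y \<le> z" "z < real y + 1" using z0 unfolding y_def by (auto simp: of_nat_nat)
    have "real y ^ (2 * K) \<le> z ^ (2 * K)" using yz by (intro power_mono) auto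
    also have "z ^ (2 * K) = exp (real (2 * K) * (l / (2 * real K)))" unfolding z_def by (rule exp_of_nat_mult[symmetric])
    also have "real (2 * K) * (l / (2 * real K)) = l" using K by simp
    also have "exp l = real x" using x by (simp add: l_def)
    finally have "real (y ^ (2 * K)) \<le> real x" by simp
    then have yK: "y ^ (2 * K) \<le> x" unfolding of_nat_le_iff .
    have lK: "l / (2 * real K) \<ge> 3"
    proof -
      have "6 * real K \<le> 6 * C0" by (simp add: C0_def)
      then have "6 * real K \<le> l" using l_big by linarith
      then show ?thesis using K by (simp add: field_simps)
    qed
    have lny: "ln (real y + 1) \<ge> l / (2 * real K)"
    proof -
      have "ln z \<le> ln (real y + 1)" using yz z0 by (subst ln_le_cancel_iff) auto
      then show ?thesis by (simp add: z_def)
    qed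
    have y3: "y \<ge> 3"
    proof -
      have "1 + l / (2 * real K) \<le> z" unfolding z_def by (rule exp_ge_add_one_self)
      then have "real y + 1 > 4" using lK yz by linarith
      then show ?thesis by simp
    qed
    have "ln (l / (2 * real K)) \<le> ln (ln (real y + 1))" using lny lK y3 by (subst ln_le_cancel_iff) auto
    moreover have "ln (l / (2 * real K)) = ln l - ln (2 * real K)" using K l1 by (subst ln_div) auto
    moreover have "ln (2 * real K) \<le> 2 * real K" using K ln_le_minus_one[of "2 * real K"] by simp
    ultimately have lly: "ln (ln (real y + 1)) \<ge> ln l - 2 * real K" by linarith
    define Q where "Q = {p \<in> primesQ_upto y. 8 * K \<le> p}"
    have finQ: "finite Q" by (simp add: Q_def)
    have "(\<Sum>p\<in>primesQ_upto y. 1 / real p) \<le> (\<Sum>p\<in>Q. 1 / real p) + 8 * real K"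
    proof -
      define S where "S = {p \<in> primesQ_upto y. \<not> 8 * K \<le> p}"
      have "(\<Sum>p\<in>primesQ_upto y. 1 / real p) = (\<Sum>p\<in>Q \<union> S. 1 / real p)" by (intro sum.cong) (auto simp: Q_def S_def)
      also have "\<dots> \<le> (\<Sum>p\<in>Q. 1 / real p) + (\<Sum>p\<in>S. 1 / real p)" by (intro sum_union_nonneg_le) (auto simp: finQ S_def)
      also have "(\<Sum>p\<in>S. 1 / real p) \<le> (\<Sum>p\<in>{..<8 * K}. 1)"
      proof (rule order_trans[OF sum_mono sum_mono2])
        show "1 / real p \<le> 1" if "p \<in> S" for p by (cases p) auto
        show "S \<subseteq> {..<8 * K}" by (auto simp: S_def)
      qed auto
      finally show ?thesis by simp
    qed
    then have SQ: "(\<Sum>p\<in>Q. 1 / real p) \<ge> 1 / 3 * (ln l - 2 * real K) - 9 - 8 * real K"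
    proof -
      have "1 / 3 * (a - 2 * k) - 9 - 8 * k \<le> q" if "s \<le> q + 8 * k" "1 / 3 * b - 9 \<le> s" "a - 2 * k \<le> b" for a b k q s :: real
        using that by argo
      from this[OF _ sum_primesQ_ge[OF y3] lly] show ?thesis using \<open>(\<Sum>p\<in>primesQ_upto y. 1 / real p) \<le> _\<close> by blast
    qed
    define S where "S = (\<Sum>p\<in>Q. 1 / real p) - real K * (1 / (8 * real K))"
    have S: "S \<ge> 1 / 6 * ln l"
    proof -
      have "real K * (1 / (8 * real K)) = 1 / 8" using K by simp
      then have s1: "S \<ge> 1 / 3 * (ln l - 2 * real K) - 9 - 8 * real K - 1 / 8" using SQ by (simp add: S_def)
      have s2: "ln l \<ge> 6 * C0" using elim(1) by (simp add: l_def)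
      have s3: "1 / 6 * a \<le> s" if "1 / 3 * (a - 2 * k) - 9 - 8 * k - 1 / 8 \<le> s" "6 * (2 * k + 9 + 8 * k + 1) \<le> a" "k \<ge> 0" for a k s :: real
        using that by argo
      show ?thesis by (rule s3[OF s1 s2[unfolded C0_def]]) simp
    qed
    have lnl0: "ln l \<ge> 0" using l1 by simp
    have "(1 / 6 * ln l) ^ K / fact K \<le> S ^ K / fact K"
      using S lnl0 by (intro divide_right_mono power_mono) auto
    also have "\<dots> \<le> (\<Sum>A | A \<subseteq> Q \<and> card A = K. \<Prod>p\<in>A. 1 / real p)"
      unfolding S_def
    proof (rule elementary_symmetric_lower[OF finQ])
      fix p assume p: "p \<in> Q"
      then have "8 * K \<le> p" by (simp add: Q_def)
      then have "8 * real K \<le> real p" by (metis of_nat_le_iff of_nat_mult of_nat_numeral)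
      then show "0 \<le> 1 / real p \<and> 1 / real p \<le> 1 / (8 * real K)" using K by (auto intro!: divide_left_mono)
    next
      show "real K * (1 / (8 * real K)) \<le> (\<Sum>p\<in>Q. 1 / real p)" using S lnl0 unfolding S_def by linarith
    qed simp_all
    finally have "real x / 16 * ((1 / 6 * ln l) ^ K / fact K) \<le> real x / 16 * (\<Sum>A | A \<subseteq> Q \<and> card A = K. \<Prod>p\<in>A. 1 / real p)"
      using x by (intro mult_left_mono) auto
    also have "\<dots> \<le> (\<Sum>n\<in>sqfree_upto x. 2 ^ omegaQ n)"
      by (rule sum_two_power_omegaQ_ge_elementary[OF K yK Q_def])
    finally show ?case by (simp add: c_def l_def power_mult_distrib power_divide mult_ac)
  qed
  then show ?thesis using c by blast
qed

section \<open>Expansion into Jacobi symbols\<close>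

definition block :: "nat \<Rightarrow> (nat \<Rightarrow> 'u) \<Rightarrow> 'u \<Rightarrow> nat" where
  "block m f u = \<Prod>{p \<in> prime_factors m. f p = u}"

lemma prod_block:
  assumes m: "squarefree m" and I: "finite I" and f: "f \<in> prime_factors m \<rightarrow>\<^sub>E I"
  shows "(\<Prod>u\<in>I. block m f u) = m"
proof -
  have "(\<Prod>u\<in>I. block m f u) = (\<Prod>u\<in>I. \<Prod>p\<in>{p \<in> prime_factors m. f p = u}. p)" by (simp add: block_def)
  also have "\<dots> = \<Prod>(prime_factors m)"
    using f I by (intro prod.group) auto
  also have "\<dots> = m" using m by (rule prod_prime_factors_squarefree)
  finally show ?thesis .
qed

lemma prime_factors_block:
  assumes m: "squarefree m"
  shows "prime_factors (block m f u) = {p \<in> prime_factors m. f p = u}"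
proof -
  define A where "A = {p \<in> prime_factors m. f p = u}"
  have finA: "finite A" by (simp add: A_def)
  have pA: "prime p" if "p \<in> A" for p using that by (simp add: A_def in_prime_factors_iff)
  have "0 \<notin> A" using pA[of 0] by auto
  then have nz: "\<Prod>A \<noteq> 0" using finA by simp
  have "prime_factors (\<Prod>A) = A"
  proof (intro equalityI subsetI)
    fix p assume "p \<in> prime_factors (\<Prod>A)"
    then have p: "prime p" "p dvd \<Prod>A" by (auto simp: in_prime_factors_iff)
    then obtain q where "q \<in> A" "p dvd q" using finA by (auto simp: prime_dvd_prod_iff)
    then show "p \<in> A" using p pA primes_dvd_imp_eq by blast
  next
    fix p assume p: "p \<in> A"
    then have "p dvd \<Prod>A" using dvd_prodI[OF finA, of p "\<lambda>x. x"] by simp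
    then show "p \<in> prime_factors (\<Prod>A)" using pA[OF p] nz by (simp add: in_prime_factors_iff)
  qed
  then show ?thesis by (simp add: block_def A_def)
qed

text \<open>Each prime of a squarefree \<open>m\<close> divides exactly one factor, so an ordered
  factorization amounts to choosing an index for every prime; the factors are the products of the
  fibres.\<close>

lemma bij_block:
  fixes I :: "'u set"
  assumes m: "squarefree m" and I: "finite I"
  shows "bij_betw (\<lambda>f. \<lambda>u\<in>I. block m f u) (prime_factors m \<rightarrow>\<^sub>E I) {D \<in> I \<rightarrow>\<^sub>E UNIV. (\<Prod>u\<in>I. D u) = m}"
proof -
  have m0: "m \<noteq> 0" using m not_squarefree_0 by metis
  have inj: "inj_on (\<lambda>f. \<lambda>u\<in>I. block m f u) (prime_factors m \<rightarrow>\<^sub>E I)"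
  proof (rule inj_onI)
    fix f g assume f: "f \<in> prime_factors m \<rightarrow>\<^sub>E I" and g: "g \<in> prime_factors m \<rightarrow>\<^sub>E I"
      and eq: "(\<lambda>u\<in>I. block m f u) = (\<lambda>u\<in>I. block m g u)"
    show "f = g"
    proof (rule PiE_ext[OF f g])
      fix p assume p: "p \<in> prime_factors m"
      then have u: "f p \<in> I" using f by auto
      then have "block m f (f p) = block m g (f p)" using fun_cong[OF eq, of "f p"] by simp
      then have sets: "{q \<in> prime_factors m. f q = f p} = {q \<in> prime_factors m. g q = f p}"
        using prime_factors_block[OF m, of f "f p"] prime_factors_block[OF m, of g "f p"] by simp
      have "p \<in> {q \<in> prime_factors m. f q = f p}" using p by simp
      then have "p \<in> {q \<in> prime_factors m. g q = f p}" unfolding sets .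
      then show "f p = g p" by simp
    qed
  qed
  moreover have "(\<lambda>f. \<lambda>u\<in>I. block m f u) ` (prime_factors m \<rightarrow>\<^sub>E I) = {D \<in> I \<rightarrow>\<^sub>E UNIV. (\<Prod>u\<in>I. D u) = m}"
  proof (intro equalityI subsetI)
    fix D assume "D \<in> (\<lambda>f. \<lambda>u\<in>I. block m f u) ` (prime_factors m \<rightarrow>\<^sub>E I)"
    then obtain f where f: "f \<in> prime_factors m \<rightarrow>\<^sub>E I" "D = (\<lambda>u\<in>I. block m f u)" by blast
    then show "D \<in> {D \<in> I \<rightarrow>\<^sub>E UNIV. (\<Prod>u\<in>I. D u) = m}" using prod_block[OF m I f(1)] by simp
  next
    fix D assume "D \<in> {D \<in> I \<rightarrow>\<^sub>E UNIV. (\<Prod>u\<in>I. D u) = m}"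
    then have D: "D \<in> I \<rightarrow>\<^sub>E UNIV" "(\<Prod>u\<in>I. D u) = m" by auto
    have ex: "\<exists>u\<in>I. p dvd D u" if "p \<in> prime_factors m" for p
      using that D(2) I by (auto simp: in_prime_factors_iff prime_dvd_prod_iff)
    have uniq: "u = v" if p: "prime p" and uv: "u \<in> I" "v \<in> I" "p dvd D u" "p dvd D v" for p u v
    proof (rule ccontr)
      assume "u \<noteq> v"
      have "m = D u * (D v * (\<Prod>w\<in>I - {u} - {v}. D w))"
        using uv I \<open>u \<noteq> v\<close> unfolding D(2)[symmetric] by (simp add: prod.remove[of I u] prod.remove[of "I - {u}" v])
      then have "m = (D u * D v) * (\<Prod>w\<in>I - {u} - {v}. D w)" by (simp only: mult.assoc)
      moreover have "p * p dvd D u * D v" using uv by (intro mult_dvd_mono)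
      ultimately have "p ^ 2 dvd m" by (metis dvd_mult2 power2_eq_square)
      then have "p dvd 1" using squarefreeD[OF m] by blast
      then show False using p not_prime_unit by blast
    qed
    define f where "f = (\<lambda>p\<in>prime_factors m. SOME u. u \<in> I \<and> p dvd D u)"
    have fp: "f p \<in> I" "p dvd D (f p)" if "p \<in> prime_factors m" for p
      using someI_ex[of "\<lambda>u. u \<in> I \<and> p dvd D u"] ex[OF that] that by (auto simp: f_def)
    have fI: "f \<in> prime_factors m \<rightarrow>\<^sub>E I" using fp(1) by (auto simp: f_def)
    have "block m f u = D u" if u: "u \<in> I" for u
    proof -
      have dvd: "D u dvd m" using u I unfolding D(2)[symmetric] by (intro dvd_prodI)
      then have sq: "squarefree (D u)" using m squarefree_mono by blast
      have "{p \<in> prime_factors m. f p = u} = prime_factors (D u)"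
      proof (intro equalityI subsetI)
        fix p assume "p \<in> {p \<in> prime_factors m. f p = u}"
        then show "p \<in> prime_factors (D u)" using fp(2)[of p] dvd m0 by (auto simp: in_prime_factors_iff)
      next
        fix p assume p: "p \<in> prime_factors (D u)"
        then have pm: "p \<in> prime_factors m" using dvd m0 by (auto simp: in_prime_factors_iff intro: dvd_trans)
        then have "f p = u" using uniq[of p "f p" u] fp[OF pm] p u by (auto simp: in_prime_factors_iff)
        then show "p \<in> {p \<in> prime_factors m. f p = u}" using pm by simp
      qed
      then show ?thesis using prod_prime_factors_squarefree[OF sq] by (simp add: block_def)
    qed
    then have "(\<lambda>u\<in>I. block m f u) = D" using D(1) by (auto simp: fun_eq_iff restrict_def PiE_def extensional_def)
    then show "D \<in> (\<lambda>f. \<lambda>u\<in>I. block m f u) ` (prime_factors m \<rightarrow>\<^sub>E I)" using fI by blast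
  qed
  ultimately show ?thesis by (simp add: bij_betw_def)
qed

lemma card_factorizations:
  fixes m :: nat
  assumes m: "squarefree m" and I: "finite I"
  shows "card {D \<in> I \<rightarrow>\<^sub>E UNIV. (\<Prod>u\<in>I. D u) = m} = card I ^ card (prime_factors m)"
  using bij_betw_same_card[OF bij_block[OF m I]] by (simp add: card_PiE)

type_synonym idx = "(bool \<times> bool) \<times> (bool \<times> bool)"

text \<open>The first component of an index is the type of a prime (does it divide the two descent
  parameters?), the second selects a monomial in the expansion of
  \<open>(1 + sym1) * (1 + sym2)\<close>.\<close>

definition expo :: "idx \<Rightarrow> idx \<Rightarrow> nat" where
  "expo u v = (if fst (snd u) \<and> fst (fst u) \<noteq> fst (fst v) then 1 else 0)
    + (if snd (snd u) \<and> snd (fst u) \<noteq> snd (fst v) then 1 else 0)"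

text \<open>The share of a single block: the normalization 1 / 4 for each prime and the symbols of
  the constants, kept or omitted according to the monomial chosen in the second component of
  \<open>u\<close>. Interactions between blocks are left to \<open>expo\<close>.\<close>

definition local_weight :: "int \<Rightarrow> int \<Rightarrow> int \<Rightarrow> idx \<Rightarrow> nat \<Rightarrow> real" where
  "local_weight \<nu> \<alpha> \<beta> u x = (1 / 4) ^ card (prime_factors x)
    * real_of_int (if fst (snd u) then jac (scoef1 \<nu> \<alpha> (fst u)) x else 1)
    * real_of_int (if snd (snd u) then jac (scoef2 \<nu> \<beta> (fst u)) x else 1)"

definition weight :: "int \<Rightarrow> int \<Rightarrow> int \<Rightarrow> (idx \<Rightarrow> nat) \<Rightarrow> real" where
  "weight \<nu> \<alpha> \<beta> D = (\<Prod>u\<in>UNIV. local_weight \<nu> \<alpha> \<beta> u (D u)) * (\<Prod>u\<in>UNIV. \<Prod>v\<in>UNIV. J (D v) (D u) ^ expo u v)"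

lemma jac_blocks:
  fixes D :: "idx \<Rightarrow> nat"
  assumes "odd n" shows "jac (c * (\<Prod>v\<in>V. int (D v))) n = jac c n * (\<Prod>v\<in>V. jac (int (D v)) n)"
  using assms by (simp add: jac_mult_left jac_prod_left)

text \<open>Primes are grouped by their index. At a prime of block \<open>u\<close>, the symbol
  \<open>sym1\<close> contains, besides its constant, exactly the blocks whose first bit differs
  from that of \<open>u\<close>; multiplying over the block turns Legendre symbols into Jacobi
  symbols with lower argument \<open>D u\<close>. The same holds for \<open>sym2\<close> and the
  second bit.\<close>

lemma symbols_weight:
  fixes f :: "nat \<Rightarrow> idx"
  assumes m: "odd m" "squarefree m" and f: "f \<in> prime_factors m \<rightarrow>\<^sub>E UNIV"
  defines "P \<equiv> prime_factors m"
  shows "(\<Prod>p\<in>P. 1 / 4 * (real_of_int (if fst (snd (f p)) then sym1 P \<nu> \<alpha> (\<lambda>q\<in>P. fst (f q)) p else 1)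
      * real_of_int (if snd (snd (f p)) then sym2 P \<nu> \<beta> (\<lambda>q\<in>P. fst (f q)) p else 1))) = weight \<nu> \<alpha> \<beta> (block m f)"
proof -
  define t where "t = (\<lambda>q\<in>P. fst (f q))"
  define D where "D = block m f"
  define A where "A u = {p \<in> P. f p = u}" for u
  have finP: "finite P" by (simp add: P_def)
  have Dpf: "prime_factors (D u) = A u" for u unfolding D_def A_def P_def by (rule prime_factors_block[OF m(2)])
  have m0: "m \<noteq> 0" using m(2) not_squarefree_0 by metis
  have Ddvd: "D u dvd m" for u
  proof -
    have "D u dvd (\<Prod>u\<in>UNIV. D u)" by (intro dvd_prodI) auto
    then show ?thesis unfolding D_def using prod_block[OF m(2) _ f] by simp
  qed
  have Dodd: "odd (D u)" for u using Ddvd[of u] m(1) dvd_trans by blast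
  have Dprod: "(\<Prod>q\<in>{q \<in> P. R (f q)}. int q) = (\<Prod>v\<in>{v. R v}. int (D v))" for R
  proof -
    have "(\<Prod>q\<in>{q \<in> P. R (f q)}. int q) = (\<Prod>v\<in>{v. R v}. \<Prod>q\<in>{q \<in> {q \<in> P. R (f q)}. f q = v}. int q)"
      using finP by (intro prod.group[symmetric]) auto
    also have "\<dots> = (\<Prod>v\<in>{v. R v}. int (D v))"
    proof (rule prod.cong[OF refl])
      fix v assume v: "v \<in> {v. R v}"
      have "{q \<in> {q \<in> P. R (f q)}. f q = v} = A v" using v by (auto simp: A_def)
      then show "(\<Prod>q\<in>{q \<in> {q \<in> P. R (f q)}. f q = v}. int q) = int (D v)" by (simp add: D_def block_def A_def P_def)
    qed
    finally show ?thesis .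
  qed
  have s1: "(\<Prod>p\<in>A u. sym1 P \<nu> \<alpha> t p) = jac (scoef1 \<nu> \<alpha> (fst u)) (D u) * (\<Prod>v\<in>{v. fst (fst v) \<noteq> fst (fst u)}. jac (int (D v)) (D u))" for u
  proof -
    have "(\<Prod>p\<in>A u. sym1 P \<nu> \<alpha> t p) = (\<Prod>p\<in>A u. Legendre (scoef1 \<nu> \<alpha> (fst u) * (\<Prod>v\<in>{v. fst (fst v) \<noteq> fst (fst u)}. int (D v))) (int p))"
    proof (rule prod.cong[OF refl])
      fix p assume p: "p \<in> A u"
      then have tp: "t p = fst u" by (auto simp: A_def t_def)
      have "{q \<in> P. fst (t q) \<noteq> fst (t p)} = {q \<in> P. fst (fst (f q)) \<noteq> fst (fst u)}" unfolding tp by (auto simp: t_def)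
      then show "sym1 P \<nu> \<alpha> t p = Legendre (scoef1 \<nu> \<alpha> (fst u) * (\<Prod>v\<in>{v. fst (fst v) \<noteq> fst (fst u)}. int (D v))) (int p)"
        using Dprod[of "\<lambda>v. fst (fst v) \<noteq> fst (fst u)"] by (simp only: sym1_def tp)
    qed
    also have "\<dots> = jac (scoef1 \<nu> \<alpha> (fst u) * (\<Prod>v\<in>{v. fst (fst v) \<noteq> fst (fst u)}. int (D v))) (D u)"
      by (simp only: jac_def Dpf)
    finally show ?thesis by (simp only: jac_blocks[OF Dodd])
  qed
  have s2: "(\<Prod>p\<in>A u. sym2 P \<nu> \<beta> t p) = jac (scoef2 \<nu> \<beta> (fst u)) (D u) * (\<Prod>v\<in>{v. snd (fst v) \<noteq> snd (fst u)}. jac (int (D v)) (D u))" for u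
  proof -
    have "(\<Prod>p\<in>A u. sym2 P \<nu> \<beta> t p) = (\<Prod>p\<in>A u. Legendre (scoef2 \<nu> \<beta> (fst u) * (\<Prod>v\<in>{v. snd (fst v) \<noteq> snd (fst u)}. int (D v))) (int p))"
    proof (rule prod.cong[OF refl])
      fix p assume p: "p \<in> A u"
      then have tp: "t p = fst u" by (auto simp: A_def t_def)
      have "{q \<in> P. snd (t q) \<noteq> snd (t p)} = {q \<in> P. snd (fst (f q)) \<noteq> snd (fst u)}" unfolding tp by (auto simp: t_def)
      then show "sym2 P \<nu> \<beta> t p = Legendre (scoef2 \<nu> \<beta> (fst u) * (\<Prod>v\<in>{v. snd (fst v) \<noteq> snd (fst u)}. int (D v))) (int p)"
        using Dprod[of "\<lambda>v. snd (fst v) \<noteq> snd (fst u)"] by (simp only: sym2_def tp)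
    qed
    also have "\<dots> = jac (scoef2 \<nu> \<beta> (fst u) * (\<Prod>v\<in>{v. snd (fst v) \<noteq> snd (fst u)}. int (D v))) (D u)"
      by (simp only: jac_def Dpf)
    finally show ?thesis by (simp only: jac_blocks[OF Dodd])
  qed
  have pw: "(\<Prod>v\<in>UNIV. J (D v) (D u) ^ expo u v) =
      real_of_int (if fst (snd u) then \<Prod>v\<in>{v. fst (fst v) \<noteq> fst (fst u)}. jac (int (D v)) (D u) else 1)
      * real_of_int (if snd (snd u) then \<Prod>v\<in>{v. snd (fst v) \<noteq> snd (fst u)}. jac (int (D v)) (D u) else 1)" for u
  proof -
    have e: "(\<Prod>v\<in>UNIV. J (D v) (D u) ^ (if b \<and> R v then 1 else 0)) = real_of_int (if b then \<Prod>v\<in>{v. R v}. jac (int (D v)) (D u) else 1)"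
      for b and R :: "idx \<Rightarrow> bool"
    proof (cases b)
      case True
      have "(\<Prod>v\<in>UNIV. J (D v) (D u) ^ (if b \<and> R v then 1 else 0)) = (\<Prod>v\<in>UNIV. if v \<in> {v. R v} then J (D v) (D u) else 1)"
        using True by (intro prod.cong) auto
      also have "\<dots> = (\<Prod>v\<in>{v. R v}. J (D v) (D u))" by (subst prod.inter_restrict[symmetric]) auto
      finally show ?thesis using True by simp
    qed simp
    show ?thesis
      using e[of "fst (snd u)" "\<lambda>v. fst (fst v) \<noteq> fst (fst u)"] e[of "snd (snd u)" "\<lambda>v. snd (fst v) \<noteq> snd (fst u)"]
      by (simp add: expo_def power_add prod.distrib eq_commute[of "fst (fst u)"] eq_commute[of "snd (fst u)"])
  qed
  have "(\<Prod>p\<in>P. 1 / 4 * (real_of_int (if fst (snd (f p)) then sym1 P \<nu> \<alpha> t p else 1)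
      * real_of_int (if snd (snd (f p)) then sym2 P \<nu> \<beta> t p else 1)))
    = (\<Prod>u\<in>UNIV. \<Prod>p\<in>A u. 1 / 4 * (real_of_int (if fst (snd (f p)) then sym1 P \<nu> \<alpha> t p else 1)
      * real_of_int (if snd (snd (f p)) then sym2 P \<nu> \<beta> t p else 1)))"
    unfolding A_def using finP by (intro prod.group[symmetric]) auto
  also have "\<dots> = (\<Prod>u\<in>UNIV. local_weight \<nu> \<alpha> \<beta> u (D u) * (\<Prod>v\<in>UNIV. J (D v) (D u) ^ expo u v))"
  proof (rule prod.cong[OF refl])
    fix u :: idx
    have "(\<Prod>p\<in>A u. 1 / 4 * (real_of_int (if fst (snd (f p)) then sym1 P \<nu> \<alpha> t p else 1)
      * real_of_int (if snd (snd (f p)) then sym2 P \<nu> \<beta> t p else 1)))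
     = (\<Prod>p\<in>A u. 1 / 4 * (real_of_int (if fst (snd u) then sym1 P \<nu> \<alpha> t p else 1)
      * real_of_int (if snd (snd u) then sym2 P \<nu> \<beta> t p else 1)))"
      by (intro prod.cong) (auto simp: A_def)
    also have "\<dots> = (1 / 4) ^ card (A u) * (real_of_int (if fst (snd u) then \<Prod>p\<in>A u. sym1 P \<nu> \<alpha> t p else 1)
      * real_of_int (if snd (snd u) then \<Prod>p\<in>A u. sym2 P \<nu> \<beta> t p else 1))"
      unfolding prod.distrib prod_constant by (simp add: power_divide)
    also have "\<dots> = local_weight \<nu> \<alpha> \<beta> u (D u) * (\<Prod>v\<in>UNIV. J (D v) (D u) ^ expo u v)"
      unfolding pw s1 s2 local_weight_def Dpf by (simp add: mult_ac)
    finally show "(\<Prod>p\<in>A u. 1 / 4 * (real_of_int (if fst (snd (f p)) then sym1 P \<nu> \<alpha> t p else 1)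
      * real_of_int (if snd (snd (f p)) then sym2 P \<nu> \<beta> t p else 1))) = local_weight \<nu> \<alpha> \<beta> u (D u) * (\<Prod>v\<in>UNIV. J (D v) (D u) ^ expo u v)" .
  qed
  finally show ?thesis by (simp only: weight_def prod.distrib t_def D_def)
qed

text \<open>The product of \<open>(1 + sym1) * (1 + sym2) / 4\<close> over the primes is 1 on
  \<open>Sel\<close> and never negative, so it majorizes the indicator of \<open>Sel\<close>.
  Expanding it picks one of four monomials at each prime; with the four types this is a map from the
  primes to 16 indices.\<close>

lemma card_Sel_le:
  assumes m: "odd m" "squarefree m"
  shows "real (card (Sel \<nu> m \<alpha> \<beta>)) \<le> (\<Sum>D | (\<Prod>u\<in>UNIV. D u) = m. weight \<nu> \<alpha> \<beta> D)"
proof -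
  define P where "P = prime_factors m"
  have finP: "finite P" by (simp add: P_def)
  define s1 where "s1 t p = real_of_int (sym1 P \<nu> \<alpha> t p)" for t p
  define s2 where "s2 t p = real_of_int (sym2 P \<nu> \<beta> t p)" for t p
  define g where "g t p j = 1 / 4 * ((if fst j then s1 t p else 1) * (if snd j then s2 t p else 1))" for t p and j :: "bool \<times> bool"
  have s_vals: "s1 t p \<in> {-1, 0, 1}" "s2 t p \<in> {-1, 0, 1}" for t p
  proof -
    have "sym1 P \<nu> \<alpha> t p \<in> {-1, 0, 1}" unfolding sym1_def by (rule Legendre_values)
    then show "s1 t p \<in> {-1, 0, 1}" by (auto simp: s1_def)
    have "sym2 P \<nu> \<beta> t p \<in> {-1, 0, 1}" unfolding sym2_def by (rule Legendre_values)
    then show "s2 t p \<in> {-1, 0, 1}" by (auto simp: s2_def)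
  qed
  have g_sum: "(\<Sum>j\<in>UNIV. g t p j) = 1 / 4 * ((1 + s1 t p) * (1 + s2 t p))" for t p
    by (simp add: g_def UNIV_Times_UNIV[symmetric] sum.cartesian_product[symmetric] UNIV_bool del: UNIV_Times_UNIV) (simp add: algebra_simps)
  have g_nonneg: "(\<Sum>j\<in>UNIV. g t p j) \<ge> 0" for t p
    unfolding g_sum using s_vals[of t p] by auto
  have fin: "finite (P \<rightarrow>\<^sub>E (UNIV :: (bool \<times> bool) set))" using finP by (intro finite_PiE) auto
  have "real (card (Sel \<nu> m \<alpha> \<beta>)) = (\<Sum>t\<in>Sel \<nu> m \<alpha> \<beta>. 1)" by simp
  also have "\<dots> = (\<Sum>t\<in>Sel \<nu> m \<alpha> \<beta>. \<Prod>p\<in>P. \<Sum>j\<in>UNIV. g t p j)"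
  proof (rule sum.cong[OF refl])
    fix t assume "t \<in> Sel \<nu> m \<alpha> \<beta>"
    then have "s1 t p = 1" "s2 t p = 1" if "p \<in> P" for p using that by (auto simp: Sel_def s1_def s2_def P_def)
    then show "1 = (\<Prod>p\<in>P. \<Sum>j\<in>UNIV. g t p j)" by (simp add: g_sum)
  qed
  also have "\<dots> \<le> (\<Sum>t\<in>P \<rightarrow>\<^sub>E UNIV. \<Prod>p\<in>P. \<Sum>j\<in>UNIV. g t p j)"
    by (rule sum_mono2[OF fin]) (auto simp: Sel_def P_def intro!: prod_nonneg g_nonneg[unfolded P_def])
  also have "\<dots> = (\<Sum>t\<in>P \<rightarrow>\<^sub>E UNIV. \<Sum>l\<in>P \<rightarrow>\<^sub>E UNIV. \<Prod>p\<in>P. g t p (l p))"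
    using finP by (intro sum.cong refl prod_sum_PiE) auto
  also have "\<dots> = (\<Sum>(t, l)\<in>(P \<rightarrow>\<^sub>E UNIV) \<times> (P \<rightarrow>\<^sub>E UNIV). \<Prod>p\<in>P. g t p (l p))" by (rule sum.cartesian_product)
  also have "\<dots> = (\<Sum>f\<in>P \<rightarrow>\<^sub>E UNIV. \<Prod>p\<in>P. g (\<lambda>q\<in>P. fst (f q)) p (snd (f p)))"
  proof (rule sum.reindex_bij_witness[of _ "\<lambda>f. (\<lambda>q\<in>P. fst (f q), \<lambda>q\<in>P. snd (f q))" "\<lambda>(t, l). \<lambda>q\<in>P. (t q, l q)"])
    fix a :: "(nat \<Rightarrow> bool \<times> bool) \<times> (nat \<Rightarrow> bool \<times> bool)" assume "a \<in> (P \<rightarrow>\<^sub>E UNIV) \<times> (P \<rightarrow>\<^sub>E UNIV)"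
    then obtain t l where a: "a = (t, l)" and t: "t \<in> P \<rightarrow>\<^sub>E UNIV" and l: "l \<in> P \<rightarrow>\<^sub>E UNIV" by auto
    have r: "(\<lambda>q\<in>P. fst ((\<lambda>q\<in>P. (t q, l q)) q)) = t" "(\<lambda>q\<in>P. snd ((\<lambda>q\<in>P. (t q, l q)) q)) = l"
      by (auto simp: restrict_def fun_eq_iff PiE_arb[OF t] PiE_arb[OF l])
    show "(\<lambda>q\<in>P. fst ((case a of (t, l) \<Rightarrow> \<lambda>q\<in>P. (t q, l q)) q), \<lambda>q\<in>P. snd ((case a of (t, l) \<Rightarrow> \<lambda>q\<in>P. (t q, l q)) q)) = a"
      unfolding a by (simp only: prod.case r)
    show "(case a of (t, l) \<Rightarrow> \<lambda>q\<in>P. (t q, l q)) \<in> P \<rightarrow>\<^sub>E UNIV" unfolding a by simp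
    show "(\<Prod>p\<in>P. g (\<lambda>q\<in>P. fst ((case a of (t, l) \<Rightarrow> \<lambda>q\<in>P. (t q, l q)) q)) p (snd ((case a of (t, l) \<Rightarrow> \<lambda>q\<in>P. (t q, l q)) p)))
       = (case a of (t, l) \<Rightarrow> \<Prod>p\<in>P. g t p (l p))"
      unfolding a prod.case r by (intro prod.cong) auto
  next
    fix f :: "nat \<Rightarrow> idx" assume f: "f \<in> P \<rightarrow>\<^sub>E UNIV"
    show "(case (\<lambda>q\<in>P. fst (f q), \<lambda>q\<in>P. snd (f q)) of (t, l) \<Rightarrow> \<lambda>q\<in>P. (t q, l q)) = f"
      using f by (auto simp: fun_eq_iff restrict_def PiE_def extensional_def)
    show "(\<lambda>q\<in>P. fst (f q), \<lambda>q\<in>P. snd (f q)) \<in> (P \<rightarrow>\<^sub>E UNIV) \<times> (P \<rightarrow>\<^sub>E UNIV)" by simp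
  qed
  also have "\<dots> = (\<Sum>f\<in>P \<rightarrow>\<^sub>E UNIV. weight \<nu> \<alpha> \<beta> (block m f))"
  proof (rule sum.cong[OF refl])
    fix f :: "nat \<Rightarrow> idx" assume f: "f \<in> P \<rightarrow>\<^sub>E UNIV"
    have "(\<Prod>p\<in>P. g (\<lambda>q\<in>P. fst (f q)) p (snd (f p))) = (\<Prod>p\<in>P. 1 / 4 * (real_of_int (if fst (snd (f p)) then sym1 P \<nu> \<alpha> (\<lambda>q\<in>P. fst (f q)) p else 1)
      * real_of_int (if snd (snd (f p)) then sym2 P \<nu> \<beta> (\<lambda>q\<in>P. fst (f q)) p else 1)))"
      by (intro prod.cong refl) (simp add: g_def s1_def s2_def)
    also have "\<dots> = weight \<nu> \<alpha> \<beta> (block m f)" using symbols_weight[OF m f[unfolded P_def]] by (simp only: P_def)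
    finally show "(\<Prod>p\<in>P. g (\<lambda>q\<in>P. fst (f q)) p (snd (f p))) = weight \<nu> \<alpha> \<beta> (block m f)" .
  qed
  also have "\<dots> = (\<Sum>D | (\<Prod>u\<in>UNIV. D u) = m. weight \<nu> \<alpha> \<beta> D)"
  proof -
    have "bij_betw (\<lambda>f. \<lambda>u\<in>UNIV. block m f u) (P \<rightarrow>\<^sub>E (UNIV :: idx set)) {D \<in> UNIV \<rightarrow>\<^sub>E UNIV. (\<Prod>u\<in>UNIV. D u) = m}"
      unfolding P_def by (rule bij_block[OF m(2)]) simp
    then have "bij_betw (block m) (P \<rightarrow>\<^sub>E (UNIV :: idx set)) {D. (\<Prod>u\<in>UNIV. D u) = m}"
      by (simp add: restrict_UNIV)
    then show ?thesis by (rule sum.reindex_bij_betw)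
  qed
  finally show ?thesis .
qed

text \<open>The relation is directed: the symbol \<open>J (D v) (D u)\<close> survives modulo
  squares and its reverse does not. Pairs for which both survive are left out, since by reciprocity
  their product is a sign depending on residues modulo 4 and yields no cancellation.\<close>

definition linked :: "idx \<Rightarrow> idx \<Rightarrow> bool" where
  "linked u v \<longleftrightarrow> odd (expo u v) \<and> even (expo v u)"

text \<open>The relation says that the difference of the two indices is a zero of the quadratic form
  \<open>x1 x3 + x2 x4\<close> over the field with two elements, whose totally singular subspaces have at most
  four elements.\<close>

lemma not_linked_iff:
  "\<not> linked ((i1, i2), (j1, j2)) ((k1, k2), (l1, l2)) \<and> \<not> linked ((k1, k2), (l1, l2)) ((i1, i2), (j1, j2))
    \<longleftrightarrow> ((j1 \<noteq> l1 \<and> i1 \<noteq> k1) \<longleftrightarrow> (j2 \<noteq> l2 \<and> i2 \<noteq> k2))"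
  by (cases i1; cases i2; cases k1; cases k2; cases j1; cases j2; cases l1; cases l2) (simp_all add: linked_def expo_def)

text \<open>Four singular vectors with singular differences are pairwise orthogonal, so they span a
  totally singular subspace, and such a subspace has at most three nonzero vectors. In coordinates
  this is a propositional statement.\<close>

lemma no_four_singular_bool:
  fixes b1 b2 b3 b4 c1 c2 c3 c4 d1 d2 d3 d4 e1 e2 e3 e4 :: bool
  assumes "(b3 \<and> b1) = (b4 \<and> b2)" "(c3 \<and> c1) = (c4 \<and> c2)"
    "(d3 \<and> d1) = (d4 \<and> d2)" "(e3 \<and> e1) = (e4 \<and> e2)"
    "((b3 \<noteq> c3) \<and> (b1 \<noteq> c1)) = ((b4 \<noteq> c4) \<and> (b2 \<noteq> c2))" "((b3 \<noteq> d3) \<and> (b1 \<noteq> d1)) = ((b4 \<noteq> d4) \<and> (b2 \<noteq> d2))"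
    "((b3 \<noteq> e3) \<and> (b1 \<noteq> e1)) = ((b4 \<noteq> e4) \<and> (b2 \<noteq> e2))" "((c3 \<noteq> d3) \<and> (c1 \<noteq> d1)) = ((c4 \<noteq> d4) \<and> (c2 \<noteq> d2))"
    "((c3 \<noteq> e3) \<and> (c1 \<noteq> e1)) = ((c4 \<noteq> e4) \<and> (c2 \<noteq> e2))" "((d3 \<noteq> e3) \<and> (d1 \<noteq> e1)) = ((d4 \<noteq> e4) \<and> (d2 \<noteq> e2))"
    "b1 \<or> b2 \<or> b3 \<or> b4" "c1 \<or> c2 \<or> c3 \<or> c4"
    "d1 \<or> d2 \<or> d3 \<or> d4" "e1 \<or> e2 \<or> e3 \<or> e4"
    "b1 \<noteq> c1 \<or> b2 \<noteq> c2 \<or> b3 \<noteq> c3 \<or> b4 \<noteq> c4" "b1 \<noteq> d1 \<or> b2 \<noteq> d2 \<or> b3 \<noteq> d3 \<or> b4 \<noteq> d4"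
    "b1 \<noteq> e1 \<or> b2 \<noteq> e2 \<or> b3 \<noteq> e3 \<or> b4 \<noteq> e4" "c1 \<noteq> d1 \<or> c2 \<noteq> d2 \<or> c3 \<noteq> d3 \<or> c4 \<noteq> d4"
    "c1 \<noteq> e1 \<or> c2 \<noteq> e2 \<or> c3 \<noteq> e3 \<or> c4 \<noteq> e4" "d1 \<noteq> e1 \<or> d2 \<noteq> e2 \<or> d3 \<noteq> e3 \<or> d4 \<noteq> e4"
  shows False
  using assms by argo

text \<open>Translation moves the first vector to the origin and preserves differences, which
  reduces the propositional check from 20 to 16 variables.\<close>

lemma no_five_unlinked_bool:
  fixes a1 a2 a3 a4 b1 b2 b3 b4 c1 c2 c3 c4 d1 d2 d3 d4 e1 e2 e3 e4 :: bool
  assumes "((a3 \<noteq> b3) \<and> (a1 \<noteq> b1)) = ((a4 \<noteq> b4) \<and> (a2 \<noteq> b2))" "((a3 \<noteq> c3) \<and> (a1 \<noteq> c1)) = ((a4 \<noteq> c4) \<and> (a2 \<noteq> c2))"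
    "((a3 \<noteq> d3) \<and> (a1 \<noteq> d1)) = ((a4 \<noteq> d4) \<and> (a2 \<noteq> d2))" "((a3 \<noteq> e3) \<and> (a1 \<noteq> e1)) = ((a4 \<noteq> e4) \<and> (a2 \<noteq> e2))"
    "((b3 \<noteq> c3) \<and> (b1 \<noteq> c1)) = ((b4 \<noteq> c4) \<and> (b2 \<noteq> c2))" "((b3 \<noteq> d3) \<and> (b1 \<noteq> d1)) = ((b4 \<noteq> d4) \<and> (b2 \<noteq> d2))"
    "((b3 \<noteq> e3) \<and> (b1 \<noteq> e1)) = ((b4 \<noteq> e4) \<and> (b2 \<noteq> e2))" "((c3 \<noteq> d3) \<and> (c1 \<noteq> d1)) = ((c4 \<noteq> d4) \<and> (c2 \<noteq> d2))"
    "((c3 \<noteq> e3) \<and> (c1 \<noteq> e1)) = ((c4 \<noteq> e4) \<and> (c2 \<noteq> e2))" "((d3 \<noteq> e3) \<and> (d1 \<noteq> e1)) = ((d4 \<noteq> e4) \<and> (d2 \<noteq> e2))"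
    "a1 \<noteq> b1 \<or> a2 \<noteq> b2 \<or> a3 \<noteq> b3 \<or> a4 \<noteq> b4" "a1 \<noteq> c1 \<or> a2 \<noteq> c2 \<or> a3 \<noteq> c3 \<or> a4 \<noteq> c4"
    "a1 \<noteq> d1 \<or> a2 \<noteq> d2 \<or> a3 \<noteq> d3 \<or> a4 \<noteq> d4" "a1 \<noteq> e1 \<or> a2 \<noteq> e2 \<or> a3 \<noteq> e3 \<or> a4 \<noteq> e4"
    "b1 \<noteq> c1 \<or> b2 \<noteq> c2 \<or> b3 \<noteq> c3 \<or> b4 \<noteq> c4" "b1 \<noteq> d1 \<or> b2 \<noteq> d2 \<or> b3 \<noteq> d3 \<or> b4 \<noteq> d4"
    "b1 \<noteq> e1 \<or> b2 \<noteq> e2 \<or> b3 \<noteq> e3 \<or> b4 \<noteq> e4" "c1 \<noteq> d1 \<or> c2 \<noteq> d2 \<or> c3 \<noteq> d3 \<or> c4 \<noteq> d4"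
    "c1 \<noteq> e1 \<or> c2 \<noteq> e2 \<or> c3 \<noteq> e3 \<or> c4 \<noteq> e4" "d1 \<noteq> e1 \<or> d2 \<noteq> e2 \<or> d3 \<noteq> e3 \<or> d4 \<noteq> e4"
  shows False
proof -
  have xor: "((p \<noteq> q) \<noteq> (p \<noteq> r)) = (q \<noteq> r)" for p q r :: bool by (cases p) auto
  show False
    by (rule no_four_singular_bool[of "a3 \<noteq> b3" "a1 \<noteq> b1" "a4 \<noteq> b4" "a2 \<noteq> b2" "a3 \<noteq> c3" "a1 \<noteq> c1" "a4 \<noteq> c4" "a2 \<noteq> c2" "a3 \<noteq> d3" "a1 \<noteq> d1" "a4 \<noteq> d4" "a2 \<noteq> d2" "a3 \<noteq> e3" "a1 \<noteq> e1" "a4 \<noteq> e4" "a2 \<noteq> e2", unfolded xor, OF assms])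
qed

lemma card_unlinked_le:
  assumes L: "\<And>u v. u \<in> L \<Longrightarrow> v \<in> L \<Longrightarrow> \<not> linked u v"
  shows "card (L :: idx set) \<le> 4"
proof (rule ccontr)
  assume "\<not> card L \<le> 4"
  obtain xs where xs: "set xs = L" "distinct xs" using finite_distinct_list[of L] by auto
  have len: "length xs \<ge> 5" using \<open>\<not> card L \<le> 4\<close> xs distinct_card[of xs] by simp
  have mem: "xs ! i \<in> L" if "i < 5" for i using that len xs(1) nth_mem[of i xs] by simp
  have neq: "xs ! i \<noteq> xs ! j" if "i < 5" "j < 5" "i \<noteq> j" for i j
    using that len nth_eq_iff_index_eq[OF xs(2), of i j] by simp
  have key: "((fst (snd (xs ! i)) \<noteq> fst (snd (xs ! j))) \<and> (fst (fst (xs ! i)) \<noteq> fst (fst (xs ! j))))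
      = ((snd (snd (xs ! i)) \<noteq> snd (snd (xs ! j))) \<and> (snd (fst (xs ! i)) \<noteq> snd (fst (xs ! j))))" if "i < 5" "j < 5" for i j
    using not_linked_iff[of "fst (fst (xs ! i))" "snd (fst (xs ! i))" "fst (snd (xs ! i))" "snd (snd (xs ! i))"
        "fst (fst (xs ! j))" "snd (fst (xs ! j))" "fst (snd (xs ! j))" "snd (snd (xs ! j))"]
      L[OF mem[OF that(1)] mem[OF that(2)]] L[OF mem[OF that(2)] mem[OF that(1)]] by simp
  have dis: "fst (fst (xs ! i)) \<noteq> fst (fst (xs ! j)) \<or> snd (fst (xs ! i)) \<noteq> snd (fst (xs ! j))
      \<or> fst (snd (xs ! i)) \<noteq> fst (snd (xs ! j)) \<or> snd (snd (xs ! i)) \<noteq> snd (snd (xs ! j))" if "i < 5" "j < 5" "i \<noteq> j" for i j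
    using neq[OF that] by (auto simp: prod_eq_iff)
  show False
    by (rule no_five_unlinked_bool[OF key[of 0 1] key[of 0 2] key[of 0 3] key[of 0 4] key[of 1 2] key[of 1 3] key[of 1 4]
          key[of 2 3] key[of 2 4] key[of 3 4] dis[of 0 1] dis[of 0 2] dis[of 0 3] dis[of 0 4] dis[of 1 2] dis[of 1 3] dis[of 1 4]
          dis[of 2 3] dis[of 2 4] dis[of 3 4]]) simp_all
qed

section \<open>Tuples sorted by their set of large factors\<close>

definition tuples :: "nat \<Rightarrow> real \<Rightarrow> idx set \<Rightarrow> (idx \<Rightarrow> nat) set" where
  "tuples x T L = {D. (\<Prod>u\<in>UNIV. D u) \<in> oddsqf x \<and> {u. T < real (D u)} = L}"

lemma tuples_D:
  assumes "D \<in> tuples x T L"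
  shows "1 \<le> D u" "D u \<le> x" "odd (D u)" "squarefree (D u)" "D u dvd (\<Prod>u\<in>UNIV. D u)" "(\<Prod>u\<in>UNIV. D u) \<le> x"
proof -
  have o: "(\<Prod>u\<in>UNIV. D u) \<in> oddsqf x" using assms by (simp add: tuples_def)
  show d: "D u dvd (\<Prod>u\<in>UNIV. D u)" by (intro dvd_prodI) auto
  have pos: "(\<Prod>u\<in>UNIV. D u) > 0" and le: "(\<Prod>u\<in>UNIV. D u) \<le> x" and od: "odd (\<Prod>u\<in>UNIV. D u)" and sq: "squarefree (\<Prod>u\<in>UNIV. D u)"
    using o unfolding oddsqf_def by (simp_all del: prod_pos_nat_iff)
  show "D u \<le> x" using dvd_imp_le[OF d pos] le by linarith
  show "odd (D u)" using d od dvd_trans by blast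
  then show "1 \<le> D u" by (cases "D u") auto
  show "squarefree (D u)" using d sq squarefree_mono by blast
  show "(\<Prod>u\<in>UNIV. D u) \<le> x" by (rule le)
qed

lemma finite_tuples [simp]: "finite (tuples x T L)"
proof (rule finite_subset)
  show "tuples x T L \<subseteq> (UNIV \<rightarrow>\<^sub>E {1..x})" by (intro subsetI PiE_I) (use tuples_D(1,2) in auto)
qed (intro finite_PiE, auto)

lemma abs_local_weight_le: "\<bar>local_weight \<nu> \<alpha> \<beta> u x\<bar> \<le> (1 / 4) ^ card (prime_factors x)"
proof -
  have j: "\<bar>real_of_int (if b then jac c x else 1)\<bar> \<le> 1" for b c using abs_jac_le_1[of c x] by (simp flip: of_int_abs)
  have "\<bar>(1 / 4) ^ card (prime_factors x) * y * z\<bar> \<le> (1 / 4) ^ card (prime_factors x)" if "\<bar>y\<bar> \<le> 1" "\<bar>z\<bar> \<le> 1" for y z :: real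
    using abs_mult_le_1[OF that] mult_left_le[of "\<bar>y * z\<bar>" "(1 / 4) ^ card (prime_factors x)"] by (simp add: abs_mult mult.assoc)
  then show ?thesis unfolding local_weight_def using j by blast
qed

lemma abs_local_weight_le_1: "\<bar>local_weight \<nu> \<alpha> \<beta> u x\<bar> \<le> 1"
  using abs_local_weight_le[of \<nu> \<alpha> \<beta> u x] power_le_one[of "1/4::real" "card (prime_factors x)"] by linarith

lemma abs_prod_le_1:
  fixes f :: "'a \<Rightarrow> real"
  assumes "\<And>i. i \<in> A \<Longrightarrow> \<bar>f i\<bar> \<le> 1" shows "\<bar>\<Prod>i\<in>A. f i\<bar> \<le> 1"
  unfolding abs_prod using assms by (intro prod_le_1) auto

lemma abs_J_power_le_1: "\<bar>J d e ^ n\<bar> \<le> 1"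
  unfolding power_abs using abs_J_le_1[of d e] by (intro power_le_one) auto

lemma abs_weight_le: "\<bar>weight \<nu> \<alpha> \<beta> D\<bar> \<le> (\<Prod>u\<in>L. (1 / 4) ^ card (prime_factors (D u)))"
proof -
  have a: "\<bar>\<Prod>u\<in>UNIV. local_weight \<nu> \<alpha> \<beta> u (D u)\<bar> \<le> (\<Prod>u\<in>L. (1 / 4) ^ card (prime_factors (D u)))"
  proof -
    have "\<bar>\<Prod>u\<in>UNIV. local_weight \<nu> \<alpha> \<beta> u (D u)\<bar> \<le> (\<Prod>u\<in>UNIV. (1 / 4) ^ card (prime_factors (D u)))"
      unfolding abs_prod by (intro prod_mono conjI abs_local_weight_le) auto
    also have "\<dots> = (\<Prod>u\<in>UNIV - L. (1 / 4) ^ card (prime_factors (D u))) * (\<Prod>u\<in>L. (1 / 4) ^ card (prime_factors (D u)))"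
      by (rule prod.subset_diff) auto
    also have "\<dots> \<le> 1 * (\<Prod>u\<in>L. (1 / 4) ^ card (prime_factors (D u)))"
      by (intro mult_right_mono prod_le_1 prod_nonneg) (auto simp: power_le_one)
    finally show ?thesis by simp
  qed
  have b: "\<bar>\<Prod>u\<in>UNIV. \<Prod>v\<in>UNIV. J (D v) (D u) ^ expo u v\<bar> \<le> 1"
    by (intro abs_prod_le_1 abs_J_power_le_1)
  have "\<bar>weight \<nu> \<alpha> \<beta> D\<bar> \<le> (\<Prod>u\<in>L. (1 / 4) ^ card (prime_factors (D u))) * 1"
    unfolding weight_def abs_mult by (intro mult_mono a b) (auto intro: prod_nonneg)
  then show ?thesis by simp
qed

text \<open>The place where four enters. Each \<open>l \<le> Y\<close> has
  \<open>card L ^ omega\<close> ordered factorizations over \<open>L\<close>, each of weight at most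
  \<open>(1 / 4) ^ omega\<close>, so for \<open>card L \<le> 4\<close> every \<open>l\<close>
  contributes at most 1.\<close>

lemma sum_factorizations_le:
  assumes L: "card (L :: idx set) \<le> 4"
  shows "finite {g \<in> L \<rightarrow>\<^sub>E UNIV. (\<Prod>u\<in>L. g u) \<in> oddsqf Y}"
    "(\<Sum>g | g \<in> L \<rightarrow>\<^sub>E UNIV \<and> (\<Prod>u\<in>L. g u) \<in> oddsqf Y. \<Prod>u\<in>L. (1 / 4) ^ card (prime_factors (g u)) :: real) \<le> real Y"
proof -
  define G where "G = {g \<in> L \<rightarrow>\<^sub>E UNIV. (\<Prod>u\<in>L. g u :: nat) \<in> oddsqf Y}"
  have fin: "finite {g \<in> L \<rightarrow>\<^sub>E UNIV. (\<Prod>u\<in>L. g u) = l}" "card {g \<in> L \<rightarrow>\<^sub>E UNIV. (\<Prod>u\<in>L. g u) = l} = card L ^ card (prime_factors l)"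
    if "l \<in> oddsqf Y" for l
  proof -
    have sq: "squarefree l" using that by (simp add: oddsqf_def)
    have "finite (prime_factors l \<rightarrow>\<^sub>E L)" by (intro finite_PiE) auto
    then show "finite {g \<in> L \<rightarrow>\<^sub>E UNIV. (\<Prod>u\<in>L. g u) = l}" using bij_betw_finite[OF bij_block[OF sq, of L]] by simp
    show "card {g \<in> L \<rightarrow>\<^sub>E UNIV. (\<Prod>u\<in>L. g u) = l} = card L ^ card (prime_factors l)" by (rule card_factorizations[OF sq]) simp
  qed
  have "G = (\<Union>l\<in>oddsqf Y. {g \<in> L \<rightarrow>\<^sub>E UNIV. (\<Prod>u\<in>L. g u) = l})" by (auto simp: G_def)
  then show finG: "finite {g \<in> L \<rightarrow>\<^sub>E UNIV. (\<Prod>u\<in>L. g u) \<in> oddsqf Y}" unfolding G_def[symmetric] using fin(1) by simp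
  have le: "(\<Prod>u\<in>L. (1 / 4) ^ card (prime_factors (g u)) :: real) \<le> (1 / 4) ^ card (prime_factors (\<Prod>u\<in>L. g u))" for g :: "idx \<Rightarrow> nat"
  proof -
    have "prime_factors (\<Prod>u\<in>L. g u) \<subseteq> (\<Union>u\<in>L. prime_factors (g u)) \<or> (\<Prod>u\<in>L. g u) = 0"
      by (auto simp: in_prime_factors_iff prime_dvd_prod_iff)
    moreover have "card (prime_factors (\<Prod>u\<in>L. g u)) = 0" if "(\<Prod>u\<in>L. g u) = 0" unfolding that by simp
    ultimately have "card (prime_factors (\<Prod>u\<in>L. g u)) \<le> card (\<Union>u\<in>L. prime_factors (g u))"
      by (metis card_mono finite_UN finite_class.finite finite_set_mset le0)
    also have "\<dots> \<le> (\<Sum>u\<in>L. card (prime_factors (g u)))" by (rule card_UN_le) simp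
    finally have "(1 / 4 :: real) ^ (\<Sum>u\<in>L. card (prime_factors (g u))) \<le> (1 / 4) ^ card (prime_factors (\<Prod>u\<in>L. g u))"
      by (intro power_decreasing) auto
    then show ?thesis by (simp only: power_sum)
  qed
  have "(\<Sum>g\<in>G. \<Prod>u\<in>L. (1 / 4) ^ card (prime_factors (g u)) :: real) \<le> (\<Sum>g\<in>G. (1 / 4) ^ card (prime_factors (\<Prod>u\<in>L. g u)))"
    by (intro sum_mono le)
  also have "\<dots> = (\<Sum>l\<in>oddsqf Y. \<Sum>g\<in>{g \<in> G. (\<Prod>u\<in>L. g u) = l}. (1 / 4) ^ card (prime_factors (\<Prod>u\<in>L. g u)))"
    using finG by (intro sum.group[symmetric]) (auto simp: G_def)
  also have "\<dots> = (\<Sum>l\<in>oddsqf Y. real (card L ^ card (prime_factors l)) * (1 / 4) ^ card (prime_factors l))"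
  proof (rule sum.cong[OF refl])
    fix l assume l: "l \<in> oddsqf Y"
    have "{g \<in> G. (\<Prod>u\<in>L. g u) = l} = {g \<in> L \<rightarrow>\<^sub>E UNIV. (\<Prod>u\<in>L. g u) = l}" using l by (auto simp: G_def)
    then have "(\<Sum>g\<in>{g \<in> G. (\<Prod>u\<in>L. g u) = l}. (1 / 4) ^ card (prime_factors (\<Prod>u\<in>L. g u)) :: real)
      = (\<Sum>g\<in>{g \<in> L \<rightarrow>\<^sub>E UNIV. (\<Prod>u\<in>L. g u) = l}. (1 / 4) ^ card (prime_factors l))" by (intro sum.cong) auto
    also have "\<dots> = real (card L ^ card (prime_factors l)) * (1 / 4) ^ card (prime_factors l)" using fin(2)[OF l] by simp
    finally show "(\<Sum>g\<in>{g \<in> G. (\<Prod>u\<in>L. g u) = l}. (1 / 4) ^ card (prime_factors (\<Prod>u\<in>L. g u)) :: real)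
      = real (card L ^ card (prime_factors l)) * (1 / 4) ^ card (prime_factors l)" .
  qed
  also have "\<dots> \<le> (\<Sum>l\<in>oddsqf Y. 1)"
  proof (rule sum_mono)
    fix l
    have "real (card L ^ card (prime_factors l)) * (1 / 4) ^ card (prime_factors l) = (real (card L) * (1 / 4)) ^ card (prime_factors l)"
      by (simp only: of_nat_power power_mult_distrib)
    also have "\<dots> \<le> 1" using L by (intro power_le_one) auto
    finally show "real (card L ^ card (prime_factors l)) * (1 / 4) ^ card (prime_factors l) \<le> 1" .
  qed
  also have "\<dots> \<le> real Y" using card_oddsqf[of Y] by simp
  finally show "(\<Sum>g | g \<in> L \<rightarrow>\<^sub>E UNIV \<and> (\<Prod>u\<in>L. g u) \<in> oddsqf Y. \<Prod>u\<in>L. (1 / 4) ^ card (prime_factors (g u)) :: real) \<le> real Y"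
    by (simp only: G_def)
qed

text \<open>With the small coordinates fixed, the large ones contribute at most \<open>x\<close>
  divided by the product of the small ones. Each small coordinate is then summed with weight
  \<open>1 / k\<close> up to \<open>T\<close>. The exponent 16 is the total number of indices, a
  safe bound for the number of small ones.\<close>

lemma unlinked_sum_le:
  assumes L: "\<And>u v. u \<in> L \<Longrightarrow> v \<in> L \<Longrightarrow> \<not> linked u v" and T: "T \<ge> 1"
  shows "(\<Sum>D\<in>tuples x T L. \<bar>weight \<nu> \<alpha> \<beta> D\<bar>) \<le> real x * (1 + ln T) ^ 16"
proof -
  define S where "S = - L"
  define N where "N = nat \<lfloor>T\<rfloor>"
  have N: "N \<ge> 1" "real N \<le> T" using T by (auto simp: N_def le_nat_iff of_nat_nat)
  define q where "q g = (\<Prod>u\<in>L. (1 / 4) ^ card (prime_factors (g u)) :: real)" for g :: "idx \<Rightarrow> nat"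
  define R where "R = (S \<rightarrow>\<^sub>E {1..N})"
  define G where "G r = {g \<in> L \<rightarrow>\<^sub>E UNIV. (\<Prod>u\<in>L. g u) \<in> oddsqf (x div (\<Prod>u\<in>S. r u))}" for r :: "idx \<Rightarrow> nat"
  define \<phi> where "\<phi> D = (restrict D S, restrict D L)" for D :: "idx \<Rightarrow> nat"
  have cL: "card L \<le> 4" using L by (rule card_unlinked_le)
  have finR: "finite R" unfolding R_def by (intro finite_PiE) auto
  have finG: "finite (G r)" for r unfolding G_def by (rule sum_factorizations_le(1)[OF cL])
  have inj: "inj_on \<phi> (tuples x T L)"
  proof (rule inj_onI)
    fix D E assume eq: "\<phi> D = \<phi> E"
    show "D = E"
    proof
      fix u
      have "restrict D S u = restrict E S u" "restrict D L u = restrict E L u" using eq by (simp_all add: \<phi>_def)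
      then show "D u = E u" by (cases "u \<in> L") (auto simp: S_def)
    qed
  qed
  have sub: "\<phi> ` tuples x T L \<subseteq> (SIGMA r:R. G r)"
  proof (rule image_subsetI)
    fix D assume D: "D \<in> tuples x T L"
    have r: "restrict D S \<in> R" unfolding R_def
    proof (rule PiE_I)
      fix u assume u: "u \<in> S"
      then have "\<not> T < real (D u)" using D by (auto simp: tuples_def S_def)
      then have "D u \<le> N" unfolding N_def by (simp add: le_nat_floor)
      then show "restrict D S u \<in> {1..N}" using u tuples_D(1)[OF D, of u] by simp
    qed simp
    have split: "(\<Prod>u\<in>UNIV. D u) = (\<Prod>u\<in>S. D u) * (\<Prod>u\<in>L. D u)"
      unfolding S_def Compl_eq_Diff_UNIV by (rule prod.subset_diff) auto
    have o: "(\<Prod>u\<in>UNIV. D u) \<in> oddsqf x" using D by (simp add: tuples_def)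
    have rS: "(\<Prod>u\<in>S. restrict D S u) = (\<Prod>u\<in>S. D u)" "(\<Prod>u\<in>L. restrict D L u) = (\<Prod>u\<in>L. D u)" by simp_all
    have posS: "(\<Prod>u\<in>S. D u) > 0" and posL: "(\<Prod>u\<in>L. D u) > 0" using tuples_D(1)[OF D] by (auto intro!: prod_pos simp: Suc_le_eq)
    have "(\<Prod>u\<in>L. D u) \<le> x div (\<Prod>u\<in>S. D u)"
      using o posS by (simp add: less_eq_div_iff_mult_less_eq oddsqf_def split mult.commute)
    moreover have "odd (\<Prod>u\<in>L. D u)" using o by (simp add: oddsqf_def split)
    moreover have "squarefree (\<Prod>u\<in>L. D u)"
    proof (rule squarefree_mono)
      show "squarefree (\<Prod>u\<in>UNIV. D u)" using o by (simp add: oddsqf_def)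
      show "(\<Prod>u\<in>L. D u) dvd (\<Prod>u\<in>UNIV. D u)" unfolding split by simp
    qed
    ultimately have "(\<Prod>u\<in>L. D u) \<in> oddsqf (x div (\<Prod>u\<in>S. D u))" using posL by (simp add: oddsqf_def del: prod_pos_nat_iff)
    then have "restrict D L \<in> G (restrict D S)" by (simp add: G_def)
    then show "\<phi> D \<in> (SIGMA r:R. G r)" using r by (simp add: \<phi>_def)
  qed
  have "(\<Sum>D\<in>tuples x T L. \<bar>weight \<nu> \<alpha> \<beta> D\<bar>) \<le> (\<Sum>D\<in>tuples x T L. (\<lambda>(r, g). q g) (\<phi> D))"
  proof (rule sum_mono)
    fix D
    have "q (restrict D L) = q D" by (simp add: q_def)
    then show "\<bar>weight \<nu> \<alpha> \<beta> D\<bar> \<le> (\<lambda>(r, g). q g) (\<phi> D)" using abs_weight_le[of \<nu> \<alpha> \<beta> D L] by (simp add: \<phi>_def q_def)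
  qed
  also have "\<dots> = (\<Sum>z\<in>\<phi> ` tuples x T L. (\<lambda>(r, g). q g) z)" by (rule sum.reindex[OF inj, unfolded o_def, symmetric])
  also have "\<dots> \<le> (\<Sum>z\<in>(SIGMA r:R. G r). (\<lambda>(r, g). q g) z)"
    by (rule sum_mono2[OF _ sub]) (use finR finG in \<open>auto simp: q_def intro!: prod_nonneg\<close>)
  also have "\<dots> = (\<Sum>r\<in>R. \<Sum>g\<in>G r. q g)" using finR finG by (intro sum.Sigma[symmetric]) auto
  also have "\<dots> \<le> (\<Sum>r\<in>R. real x * (\<Prod>u\<in>S. 1 / real (r u)))"
  proof (rule sum_mono)
    fix r
    have "(\<Sum>g\<in>G r. q g) \<le> real (x div (\<Prod>u\<in>S. r u))" unfolding G_def q_def using sum_factorizations_le(2)[OF cL] by simp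
    also have "\<dots> \<le> real x / real (\<Prod>u\<in>S. r u)" by (rule of_nat_div_le_of_nat)
    also have "\<dots> = real x * (\<Prod>u\<in>S. 1 / real (r u))" by (simp add: prod_dividef)
    finally show "(\<Sum>g\<in>G r. q g) \<le> real x * (\<Prod>u\<in>S. 1 / real (r u))" .
  qed
  also have "\<dots> = real x * (\<Sum>r\<in>R. \<Prod>u\<in>S. 1 / real (r u))" by (simp only: sum_distrib_left)
  also have "(\<Sum>r\<in>R. \<Prod>u\<in>S. 1 / real (r u)) = (\<Prod>u\<in>S. \<Sum>k=1..N. 1 / real k)"
    unfolding R_def by (rule prod_sum_PiE[symmetric]) auto
  also have "\<dots> = harm N ^ card S" by (simp add: harm_def divide_inverse)
  also have "\<dots> \<le> (1 + ln T) ^ 16"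
  proof -
    have h: "harm N \<le> 1 + ln T"
    proof -
      have "harm N \<le> 1 + ln (real N)" using N by (intro harm_le_ln) auto
      also have "ln (real N) \<le> ln T" using N by (subst ln_le_cancel_iff) auto
      finally show ?thesis by simp
    qed
    have "card S \<le> card (UNIV :: idx set)" by (intro card_mono) auto
    then have S16: "card S \<le> 16" by (simp add: card_UNIV_bool)
    have "harm N ^ card S \<le> (1 + ln T) ^ card S" using h by (intro power_mono harm_nonneg)
    also have "\<dots> \<le> (1 + ln T) ^ 16" using S16 T by (intro power_increasing) auto
    finally show ?thesis .
  qed
  finally show ?thesis by (simp add: mult_left_mono)
qed

section \<open>Separating two linked variables\<close>

lemma prod_UNIV_two:
  fixes f :: "'a::finite \<Rightarrow> 'b::comm_monoid_mult"
  assumes "u \<noteq> v"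
  shows "(\<Prod>a\<in>UNIV. f a) = f u * (f v * (\<Prod>a\<in>UNIV - {u, v}. f a))"
proof -
  have "(\<Prod>a\<in>UNIV. f a) = f u * (\<Prod>a\<in>UNIV - {u}. f a)" by (rule prod.remove) auto
  also have "(\<Prod>a\<in>UNIV - {u}. f a) = f v * (\<Prod>a\<in>UNIV - {u} - {v}. f a)" using assms by (intro prod.remove) auto
  also have "UNIV - {u} - {v} = UNIV - {u, v}" by auto
  finally show ?thesis .
qed

lemma squarefree_mult_imp_coprime:
  fixes a b :: "'a::factorial_semiring"
  assumes "squarefree (a * b)" shows "coprime a b"
proof (rule coprimeI)
  fix c assume "c dvd a" "c dvd b"
  then have "c ^ 2 dvd a * b" unfolding power2_eq_square by (rule mult_dvd_mono)
  with assms show "is_unit c" by (rule squarefreeD)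
qed

definition side :: "int \<Rightarrow> int \<Rightarrow> int \<Rightarrow> idx set \<Rightarrow> (idx \<Rightarrow> nat) \<Rightarrow> idx \<Rightarrow> nat \<Rightarrow> real" where
  "side \<nu> \<alpha> \<beta> U r w d = local_weight \<nu> \<alpha> \<beta> w d * ((\<Prod>a\<in>U. J (r a) d ^ expo w a) * (\<Prod>a\<in>U. J d (r a) ^ expo a w))"

definition rest_weight :: "int \<Rightarrow> int \<Rightarrow> int \<Rightarrow> idx set \<Rightarrow> (idx \<Rightarrow> nat) \<Rightarrow> real" where
  "rest_weight \<nu> \<alpha> \<beta> U r = (\<Prod>a\<in>U. local_weight \<nu> \<alpha> \<beta> a (r a)) * (\<Prod>a\<in>U. \<Prod>b\<in>U. J (r b) (r a) ^ expo a b)"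

lemma abs_side_le_1: "\<bar>side \<nu> \<alpha> \<beta> U r w d\<bar> \<le> 1"
  unfolding side_def by (intro abs_mult_le_1 abs_local_weight_le_1 abs_prod_le_1 abs_J_power_le_1)

lemma abs_rest_weight_le_1: "\<bar>rest_weight \<nu> \<alpha> \<beta> U r\<bar> \<le> 1"
  unfolding rest_weight_def by (intro abs_mult_le_1 abs_local_weight_le_1 abs_prod_le_1 abs_J_power_le_1)

lemma expo_refl [simp]: "expo u u = 0"
  by (simp add: expo_def)

lemma expo_less_3: "expo u v < 3"
  by (simp add: expo_def)

text \<open>With the other coordinates frozen, the weight is a function of \<open>d\<close>, a
  function of \<open>e\<close> and a single Jacobi symbol. The reversed symbol occurs to an even
  power, which is 1 because coprimality keeps the symbol from vanishing.\<close>

lemma weight_linked: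
  assumes uv: "linked u v" and de: "coprime d e" "d > 0" "e > 0"
  shows "weight \<nu> \<alpha> \<beta> (r(u := d, v := e)) = side \<nu> \<alpha> \<beta> (UNIV - {u, v}) r v e
    * (rest_weight \<nu> \<alpha> \<beta> (UNIV - {u, v}) r * side \<nu> \<alpha> \<beta> (UNIV - {u, v}) r u d) * J e d"
proof -
  define E where "E = r(u := d, v := e)"
  define U where "U = UNIV - {u, v}"
  have neq: "u \<noteq> v" using uv unfolding linked_def by auto
  have E: "E u = d" "E v = e" "\<And>a. a \<in> U \<Longrightarrow> E a = r a" using neq by (auto simp: E_def U_def)
  have e1: "expo u v = 1"
  proof -
    have "odd (expo u v)" using uv by (simp add: linked_def)
    then show ?thesis using expo_less_3[of u v] by presburger
  qed
  have Jev: "J d e ^ expo v u = 1"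
  proof -
    have "jac (int d) e \<in> {-1, 1}" using de by (intro jac_values) auto
    moreover have "even (expo v u)" using uv by (simp add: linked_def)
    ultimately show ?thesis by auto
  qed
  have row: "(\<Prod>b\<in>UNIV. J (E b) n ^ expo w b) = J d n ^ expo w u * (J e n ^ expo w v * (\<Prod>b\<in>U. J (r b) n ^ expo w b))" for n w
  proof -
    have "(\<Prod>b\<in>U. J (E b) n ^ expo w b) = (\<Prod>b\<in>U. J (r b) n ^ expo w b)" using E(3) by (intro prod.cong) auto
    then show ?thesis unfolding prod_UNIV_two[OF neq] U_def[symmetric] E(1,2) by simp
  qed
  have lw: "(\<Prod>a\<in>UNIV. local_weight \<nu> \<alpha> \<beta> a (E a)) = local_weight \<nu> \<alpha> \<beta> u d * (local_weight \<nu> \<alpha> \<beta> v e * (\<Prod>a\<in>U. local_weight \<nu> \<alpha> \<beta> a (r a)))"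
  proof -
    have "(\<Prod>a\<in>U. local_weight \<nu> \<alpha> \<beta> a (E a)) = (\<Prod>a\<in>U. local_weight \<nu> \<alpha> \<beta> a (r a))" using E(3) by (intro prod.cong) auto
    then show ?thesis unfolding prod_UNIV_two[OF neq] U_def[symmetric] E(1,2) by simp
  qed
  have "(\<Prod>a\<in>UNIV. \<Prod>b\<in>UNIV. J (E b) (E a) ^ expo a b)
    = (\<Prod>b\<in>UNIV. J (E b) d ^ expo u b) * ((\<Prod>b\<in>UNIV. J (E b) e ^ expo v b) * (\<Prod>a\<in>U. \<Prod>b\<in>UNIV. J (E b) (r a) ^ expo a b))"
  proof -
    have "(\<Prod>a\<in>U. \<Prod>b\<in>UNIV. J (E b) (E a) ^ expo a b) = (\<Prod>a\<in>U. \<Prod>b\<in>UNIV. J (E b) (r a) ^ expo a b)" using E(3) by (intro prod.cong) auto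
    moreover have "(\<Prod>a\<in>UNIV. \<Prod>b\<in>UNIV. J (E b) (E a) ^ expo a b) = (\<Prod>b\<in>UNIV. J (E b) (E u) ^ expo u b) * ((\<Prod>b\<in>UNIV. J (E b) (E v) ^ expo v b)
        * (\<Prod>a\<in>U. \<Prod>b\<in>UNIV. J (E b) (E a) ^ expo a b))"
      unfolding U_def by (rule prod_UNIV_two[OF neq])
    ultimately show ?thesis by (simp only: E(1,2))
  qed
  also have "\<dots> = (J e d * (\<Prod>b\<in>U. J (r b) d ^ expo u b)) * ((\<Prod>b\<in>U. J (r b) e ^ expo v b)
      * ((\<Prod>a\<in>U. J d (r a) ^ expo a u) * ((\<Prod>a\<in>U. J e (r a) ^ expo a v) * (\<Prod>a\<in>U. \<Prod>b\<in>U. J (r b) (r a) ^ expo a b))))"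
    unfolding row prod.distrib by (simp add: e1 Jev)
  finally have jw: "(\<Prod>a\<in>UNIV. \<Prod>b\<in>UNIV. J (E b) (E a) ^ expo a b) = \<dots>" .
  show ?thesis
    unfolding weight_def E_def[symmetric] U_def[symmetric] lw jw side_def rest_weight_def by (simp only: mult_ac)
qed

text \<open>Only the entries at \<open>u\<close> and \<open>v\<close> vary; the others have the
  fixed product \<open>s\<close>. The pairs of entries fill the region of the bilinear bound for
  \<open>Y = x div s\<close>, up to coprimality conditions.\<close>

lemma linked_inner_sum_le:
  assumes uv: "linked u v" "u \<in> L" "v \<in> L" and T: "T \<ge> 1" and D0: "D0 \<in> tuples x T L"
  defines "r \<equiv> D0(u := 1, v := 1)"
  defines "s \<equiv> (\<Prod>w\<in>UNIV. r w)"
  shows "\<bar>\<Sum>D | D \<in> tuples x T L \<and> D(u := 1, v := 1) = r. weight \<nu> \<alpha> \<beta> D\<bar>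
    \<le> 30 * (1 + 4 * ln (real x)) ^ 9 * (real x / real s) * T powr (- 1 / 16)"
proof -
  define U where "U = UNIV - {u, v}"
  define Y where "Y = x div s"
  define P where "P = {(e, d). e \<in> oddsqf Y \<and> d \<in> oddsqf Y \<and> T < real e \<and> T < real d \<and> e * d \<le> Y}"
  define S where "S = {(e, d). r(u := d, v := e) \<in> tuples x T L}"
  \<comment> \<open>Coprimality to \<open>s\<close> restricts each variable separately and is put
    into the coefficients. Coprimality of \<open>d\<close> and \<open>e\<close> is enforced by
    \<open>J e d\<close>, which vanishes otherwise. So the sum over \<open>S\<close> becomes a sum
    over the whole region \<open>P\<close>.\<close>
  define a where "a e = (if coprime e s then side \<nu> \<alpha> \<beta> U r v e else 0)" for e
  define b where "b d = (if coprime d s then rest_weight \<nu> \<alpha> \<beta> U r * side \<nu> \<alpha> \<beta> U r u d else 0)" for d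
  have neq: "u \<noteq> v" using uv unfolding linked_def by auto
  have prod_upd: "(\<Prod>w\<in>UNIV. (r(u := d, v := e)) w) = d * (e * (\<Prod>w\<in>U. r w))" for d e
  proof -
    have "(\<Prod>w\<in>U. (r(u := d, v := e)) w) = (\<Prod>w\<in>U. r w)" by (intro prod.cong) (auto simp: U_def)
    then show ?thesis unfolding prod_UNIV_two[OF neq] U_def[symmetric] using neq by simp
  qed
  have s_eq: "s = (\<Prod>w\<in>U. r w)"
  proof -
    have "r(u := 1, v := 1) = r" by (auto simp: r_def)
    then show ?thesis using prod_upd[of 1 1] by (simp add: s_def)
  qed
  have D0_eq: "r(u := D0 u, v := D0 v) = D0" by (auto simp: r_def)
  have D0_prod: "(\<Prod>w\<in>UNIV. D0 w) = D0 u * (D0 v * s)" using prod_upd[of "D0 u" "D0 v"] unfolding D0_eq s_eq .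
  have D0_odd: "(\<Prod>w\<in>UNIV. D0 w) \<in> oddsqf x" using D0 by (simp add: tuples_def)
  have s_dvd: "s dvd (\<Prod>w\<in>UNIV. D0 w)" unfolding D0_prod by simp
  have D0_pos: "(\<Prod>w\<in>UNIV. D0 w) > 0" using D0_odd unfolding oddsqf_def by (simp del: prod_pos_nat_iff)
  have sle: "s \<le> x" using dvd_imp_le[OF s_dvd D0_pos] tuples_D(6)[OF D0] by linarith
  have sodd: "odd s" using D0_odd s_dvd unfolding oddsqf_def using dvd_trans by auto
  have ssq: "squarefree s" using squarefree_mono[OF s_dvd] D0_odd unfolding oddsqf_def by (simp del: prod_pos_nat_iff)
  have s0: "s > 0" using sodd by (cases s) auto
  have Y1: "Y \<ge> 1" using sle s0 unfolding Y_def by (simp add: less_eq_div_iff_mult_less_eq)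
  have Lset: "{w. T < real ((r(u := d, v := e)) w)} = L \<longleftrightarrow> T < real d \<and> T < real e" for d e
  proof -
    have "T < real (r w) \<longleftrightarrow> w \<in> L" if "w \<in> U" for w
      using D0 that by (auto simp: tuples_def r_def U_def)
    then have "{w. T < real ((r(u := d, v := e)) w)} = (L - {u, v}) \<union> (if T < real d then {u} else {}) \<union> (if T < real e then {v} else {})"
      using neq by (auto simp: U_def)
    then show ?thesis using uv(2,3) neq by auto
  qed
  have S_eq: "S = {(e, d) \<in> P. coprime d s \<and> coprime e s \<and> coprime d e}"
  proof (rule Set.set_eqI)
    fix z :: "nat \<times> nat"
    obtain e d where z: "z = (e, d)" by (cases z)
    have "d * (e * s) \<in> oddsqf x \<longleftrightarrow> e \<in> oddsqf Y \<and> d \<in> oddsqf Y \<and> e * d \<le> Y \<and> coprime d s \<and> coprime e s \<and> coprime d e"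
    proof
      assume o: "d * (e * s) \<in> oddsqf x"
      then have sq: "squarefree (d * (e * s))" and od: "odd d" "odd e" and le: "d * (e * s) \<le> x" and pos: "d > 0" "e > 0"
        by (auto simp: oddsqf_def)
      have sq1: "squarefree d" "squarefree (e * s)" using squarefree_multD[OF sq] by auto
      have sq2: "squarefree e" using squarefree_multD[OF sq1(2)] by auto
      have cop: "coprime d (e * s)" "coprime e s" by (rule squarefree_mult_imp_coprime[OF sq], rule squarefree_mult_imp_coprime[OF sq1(2)])
      have ed: "e * d \<le> Y" unfolding Y_def using le s0 by (simp add: less_eq_div_iff_mult_less_eq mult_ac)
      have "e * 1 \<le> e * d" "1 * d \<le> e * d" using pos by (auto intro!: mult_le_mono)
      then have "e \<le> Y" "d \<le> Y" using ed by linarith+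
      then show "e \<in> oddsqf Y \<and> d \<in> oddsqf Y \<and> e * d \<le> Y \<and> coprime d s \<and> coprime e s \<and> coprime d e"
        using cop sq1 sq2 od pos ed by (auto simp: oddsqf_def Suc_le_eq)
    next
      assume o: "e \<in> oddsqf Y \<and> d \<in> oddsqf Y \<and> e * d \<le> Y \<and> coprime d s \<and> coprime e s \<and> coprime d e"
      then have "squarefree (e * s)" using ssq by (intro squarefree_mult_coprime) (auto simp: oddsqf_def)
      with o have "coprime d (e * s) \<and> squarefree d \<and> squarefree (e * s)" by (simp add: oddsqf_def)
      then have "squarefree (d * (e * s))" by (blast intro: squarefree_mult_coprime)
      moreover have "d * (e * s) \<le> x" using o s0 unfolding Y_def by (simp add: less_eq_div_iff_mult_less_eq mult_ac)
      ultimately show "d * (e * s) \<in> oddsqf x" using o sodd s0 by (auto simp: oddsqf_def Suc_le_eq)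
    qed
    then show "z \<in> S \<longleftrightarrow> z \<in> {(e, d) \<in> P. coprime d s \<and> coprime e s \<and> coprime d e}"
      unfolding S_def P_def z tuples_def by (simp only: mem_Collect_eq prod.case Lset prod_upd s_eq[symmetric]) blast
  qed
  have finP: "finite P"
  proof (rule finite_subset)
    show "P \<subseteq> oddsqf Y \<times> oddsqf Y" by (auto simp: P_def)
  qed (auto simp: oddsqf_def)
  have bij: "bij_betw (\<lambda>(e, d). r(u := d, v := e)) S {D. D \<in> tuples x T L \<and> D(u := 1, v := 1) = r}"
  proof (rule bij_betw_byWitness[where f' = "\<lambda>D. (D v, D u)"])
    show "\<forall>z\<in>S. (\<lambda>D. (D v, D u)) ((\<lambda>(e, d). r(u := d, v := e)) z) = z" using neq by auto
    show "\<forall>D\<in>{D. D \<in> tuples x T L \<and> D(u := 1, v := 1) = r}. (\<lambda>(e, d). r(u := d, v := e)) (D v, D u) = D" by auto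
    show "(\<lambda>(e, d). r(u := d, v := e)) ` S \<subseteq> {D. D \<in> tuples x T L \<and> D(u := 1, v := 1) = r}" by (auto simp: S_def r_def)
    show "(\<lambda>D. (D v, D u)) ` {D. D \<in> tuples x T L \<and> D(u := 1, v := 1) = r} \<subseteq> S" by (auto simp: S_def)
  qed
  have "(\<Sum>D | D \<in> tuples x T L \<and> D(u := 1, v := 1) = r. weight \<nu> \<alpha> \<beta> D) = (\<Sum>z\<in>S. weight \<nu> \<alpha> \<beta> ((\<lambda>(e, d). r(u := d, v := e)) z))"
    by (rule sum.reindex_bij_betw[OF bij, symmetric])
  also have "\<dots> = (\<Sum>(e, d)\<in>P. a e * b d * J e d)"
  proof (rule sum.mono_neutral_cong_left[OF finP])
    show "S \<subseteq> P" unfolding S_eq by auto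
    show "\<forall>z\<in>P - S. (case z of (e, d) \<Rightarrow> a e * b d * J e d) = 0"
    proof
      fix z assume z: "z \<in> P - S"
      obtain e d where ed: "z = (e, d)" by (cases z)
      have d0: "d > 0" using z by (auto simp: ed P_def oddsqf_def)
      have "\<not> (coprime d s \<and> coprime e s \<and> coprime d e)" using z unfolding S_eq ed by blast
      moreover have "J e d = 0" if "\<not> coprime d e"
      proof -
        have "\<not> coprime (int e) (int d)" using that by (simp add: coprime_commute)
        then show ?thesis using d0 by (simp add: jac_eq_0)
      qed
      ultimately show "(case z of (e, d) \<Rightarrow> a e * b d * J e d) = 0" by (auto simp: ed a_def b_def)
    qed
    fix z assume z: "z \<in> S"
    obtain e d where ed: "z = (e, d)" by (cases z)
    have c: "coprime d s" "coprime e s" "coprime d e" "d > 0" "e > 0" using z unfolding S_eq by (auto simp: ed P_def oddsqf_def)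
    show "weight \<nu> \<alpha> \<beta> ((\<lambda>(e, d). r(u := d, v := e)) z) = (case z of (e, d) \<Rightarrow> a e * b d * J e d)"
      using weight_linked[OF uv(1) c(3-5), of \<nu> \<alpha> \<beta> r] c(1,2) by (simp add: ed a_def b_def U_def)
  qed
  finally have eq: "(\<Sum>D | D \<in> tuples x T L \<and> D(u := 1, v := 1) = r. weight \<nu> \<alpha> \<beta> D) = (\<Sum>(e, d)\<in>P. a e * b d * J e d)" .
  have "\<bar>\<Sum>(e, d)\<in>P. a e * b d * J e d\<bar> \<le> 30 * (1 + 4 * ln (real Y)) ^ 9 * real Y * T powr (- 1 / 16)"
    unfolding P_def
  proof (rule bilinear_bound[OF _ _ Y1 T])
    show "\<bar>a e\<bar> \<le> 1" for e unfolding a_def by (simp add: abs_side_le_1)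
    show "\<bar>b d\<bar> \<le> 1" for d unfolding b_def using abs_mult_le_1[OF abs_rest_weight_le_1 abs_side_le_1] by simp
  qed
  also have "\<dots> \<le> 30 * (1 + 4 * ln (real x)) ^ 9 * (real x / real s) * T powr (- 1 / 16)"
  proof -
    have Yx: "real Y \<le> real x / real s" unfolding Y_def by (rule of_nat_div_le_of_nat)
    have "Y \<le> x" unfolding Y_def by simp
    then have "ln (real Y) \<le> ln (real x)" using Y1 by (subst ln_le_cancel_iff) auto
    moreover have "ln (real Y) \<ge> 0" using Y1 by simp
    ultimately have "(1 + 4 * ln (real Y)) ^ 9 \<le> (1 + 4 * ln (real x)) ^ 9" by (intro power_mono) auto
    moreover have "0 \<le> (1 + 4 * ln (real x)) ^ 9" using \<open>ln (real Y) \<ge> 0\<close> \<open>ln (real Y) \<le> ln (real x)\<close> by (intro zero_le_power) auto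
    ultimately show ?thesis using Yx \<open>ln (real Y) \<ge> 0\<close> by (intro mult_right_mono mult_mono) auto
  qed
  finally show ?thesis unfolding eq .
qed

lemma linked_sum_le:
  assumes uv: "linked u v" "u \<in> L" "v \<in> L" and T: "T \<ge> 1" and x: "x \<ge> 1"
  shows "\<bar>\<Sum>D\<in>tuples x T L. weight \<nu> \<alpha> \<beta> D\<bar> \<le> 30 * (1 + 4 * ln (real x)) ^ 9 * real x * T powr (- 1 / 16) * (1 + ln (real x)) ^ 16"
proof -
  define \<phi> where "\<phi> D = D(u := 1, v := 1)" for D :: "idx \<Rightarrow> nat"
  define R where "R = \<phi> ` tuples x T L"
  define B where "B = 30 * (1 + 4 * ln (real x)) ^ 9 * real x * T powr (- 1 / 16)"
  have B: "B \<ge> 0" unfolding B_def using x by (intro mult_nonneg_nonneg zero_le_power) auto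
  have RX: "R \<subseteq> (UNIV \<rightarrow>\<^sub>E {1..x})" unfolding R_def
  proof (rule image_subsetI)
    fix D assume D: "D \<in> tuples x T L"
    show "\<phi> D \<in> (UNIV \<rightarrow>\<^sub>E {1..x})" by (rule PiE_I) (use tuples_D(1,2)[OF D] x in \<open>auto simp: \<phi>_def\<close>)
  qed
  have fin: "finite (UNIV \<rightarrow>\<^sub>E {1..x} :: (idx \<Rightarrow> nat) set)" by (intro finite_PiE) auto
  have "(\<Sum>D\<in>tuples x T L. weight \<nu> \<alpha> \<beta> D) = (\<Sum>r\<in>R. \<Sum>D | D \<in> tuples x T L \<and> \<phi> D = r. weight \<nu> \<alpha> \<beta> D)"
    unfolding R_def by (rule sum.image_gen) simp
  also have "\<bar>\<dots>\<bar> \<le> (\<Sum>r\<in>R. \<bar>\<Sum>D | D \<in> tuples x T L \<and> \<phi> D = r. weight \<nu> \<alpha> \<beta> D\<bar>)" by (rule sum_abs)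
  also have "\<dots> \<le> (\<Sum>r\<in>R. B * (\<Prod>w\<in>UNIV. 1 / real (r w)))"
  proof (rule sum_mono)
    fix r assume "r \<in> R"
    then obtain D0 where D0: "D0 \<in> tuples x T L" "r = D0(u := 1, v := 1)" by (auto simp: R_def \<phi>_def)
    show "\<bar>\<Sum>D | D \<in> tuples x T L \<and> \<phi> D = r. weight \<nu> \<alpha> \<beta> D\<bar> \<le> B * (\<Prod>w\<in>UNIV. 1 / real (r w))"
      using linked_inner_sum_le[OF uv T D0(1), of \<nu> \<alpha> \<beta>] unfolding D0(2)[symmetric] \<phi>_def B_def
      by (simp add: prod_dividef mult_ac)
  qed
  also have "\<dots> \<le> (\<Sum>r\<in>(UNIV \<rightarrow>\<^sub>E {1..x}). B * (\<Prod>w\<in>(UNIV :: idx set). 1 / real (r w)))"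
    using B by (intro sum_mono2[OF fin RX] mult_nonneg_nonneg prod_nonneg) auto
  also have "\<dots> = B * (\<Sum>r\<in>(UNIV \<rightarrow>\<^sub>E {1..x}). \<Prod>w\<in>(UNIV :: idx set). 1 / real (r w))" by (simp only: sum_distrib_left)
  also have "(\<Sum>r\<in>(UNIV \<rightarrow>\<^sub>E {1..x}). \<Prod>w\<in>(UNIV :: idx set). 1 / real (r w)) = (\<Prod>w\<in>(UNIV :: idx set). \<Sum>k=1..x. 1 / real k)"
    by (rule prod_sum_PiE[symmetric]) auto
  also have "\<dots> = harm x ^ 16" by (simp add: harm_def divide_inverse)
  also have "B * harm x ^ 16 \<le> B * (1 + ln (real x)) ^ 16"
    using B x by (intro mult_left_mono power_mono harm_le_ln harm_nonneg) auto
  finally show ?thesis unfolding B_def .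
qed

section \<open>Averages over squarefree integers\<close>

lemma sum_Sel_le_tuples:
  "real (\<Sum>m\<in>oddsqf x. card (Sel \<nu> m \<alpha> \<beta>)) \<le> (\<Sum>L\<in>UNIV. \<bar>\<Sum>D\<in>tuples x T L. weight \<nu> \<alpha> \<beta> D\<bar>)"
proof -
  define DD where "DD = {D :: idx \<Rightarrow> nat. (\<Prod>u\<in>UNIV. D u) \<in> oddsqf x}"
  have "DD = (\<Union>L. tuples x T L)" by (auto simp: DD_def tuples_def)
  then have fin: "finite DD" by simp
  have "real (\<Sum>m\<in>oddsqf x. card (Sel \<nu> m \<alpha> \<beta>)) \<le> (\<Sum>m\<in>oddsqf x. \<Sum>D | (\<Prod>u\<in>UNIV. D u) = m. weight \<nu> \<alpha> \<beta> D)"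
    unfolding of_nat_sum by (intro sum_mono card_Sel_le) (auto simp: oddsqf_def)
  also have "\<dots> = (\<Sum>m\<in>oddsqf x. \<Sum>D\<in>{D \<in> DD. (\<Prod>u\<in>UNIV. D u) = m}. weight \<nu> \<alpha> \<beta> D)"
    by (intro sum.cong refl) (auto simp: DD_def)
  also have "\<dots> = (\<Sum>D\<in>DD. weight \<nu> \<alpha> \<beta> D)" by (rule sum.group[OF fin]) (auto simp: DD_def)
  also have "\<dots> = (\<Sum>L\<in>UNIV. \<Sum>D\<in>{D \<in> DD. {u. T < real (D u)} = L}. weight \<nu> \<alpha> \<beta> D)"
    by (rule sum.group[symmetric, OF fin]) auto
  also have "\<dots> = (\<Sum>L\<in>UNIV. \<Sum>D\<in>tuples x T L. weight \<nu> \<alpha> \<beta> D)"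
    by (intro sum.cong refl) (auto simp: DD_def tuples_def)
  also have "\<dots> \<le> (\<Sum>L\<in>UNIV. \<bar>\<Sum>D\<in>tuples x T L. weight \<nu> \<alpha> \<beta> D\<bar>)" by (intro sum_mono abs_ge_self)
  finally show ?thesis .
qed

lemma sum_card_Sel_le:
  assumes x: "x \<ge> 1"
  shows "real (\<Sum>m\<in>oddsqf x. card (Sel \<nu> m \<alpha> \<beta>))
    \<le> 65536 * (real x * (30 + (1 + 400 * ln (1 + 4 * ln (real x))) ^ 16))"
proof -
  define l where "l = ln (real x)"
  have l: "l \<ge> 0" using x by (simp add: l_def)
  \<comment> \<open>A linked pair loses 9 logarithms in the bilinear bound and 16 in the sum over
    the other coordinates. The saving \<open>T^(1/16) = (1 + 4 * l)^25\<close> offsets all 25, and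
    \<open>ln T\<close> is still only of order log log x.\<close>
  define T where "T = (1 + 4 * l) ^ 400"
  have T: "T \<ge> 1" unfolding T_def using l by (intro one_le_power) simp
  have lnT: "ln T = 400 * ln (1 + 4 * l)" unfolding T_def using l by (subst ln_realpow) auto
  have lnT0: "ln T \<ge> 0" using T by simp
  have Tp: "T powr (- 1 / 16) = inverse ((1 + 4 * l) ^ 25)"
  proof -
    have "T = (1 + 4 * l) powr 400" unfolding T_def using l by (subst powr_numeral) auto
    then have "T powr (- 1 / 16) = (1 + 4 * l) powr (400 * (- 1 / 16))" by (simp only: powr_powr)
    also have "(400 * (- 1 / 16) :: real) = - 25" by simp
    also have "(1 + 4 * l) powr (- 25) = inverse ((1 + 4 * l) ^ 25)" using l by (subst powr_minus, subst powr_numeral) auto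
    finally show ?thesis .
  qed
  have "\<bar>\<Sum>D\<in>tuples x T L. weight \<nu> \<alpha> \<beta> D\<bar> \<le> real x * (30 + (1 + ln T) ^ 16)" for L
  proof (cases "\<exists>u\<in>L. \<exists>v\<in>L. linked u v")
    case True
    then obtain u v where uv: "linked u v" "u \<in> L" "v \<in> L" by blast
    have "(1 + l) ^ 16 \<le> (1 + 4 * l) ^ 16" using l by (intro power_mono) auto
    then have "(1 + 4 * l) ^ 9 * (1 + l) ^ 16 \<le> (1 + 4 * l) ^ 9 * (1 + 4 * l) ^ 16" using l by (intro mult_left_mono zero_le_power) auto
    also have "\<dots> = (1 + 4 * l) ^ 25" by (simp flip: power_add)
    finally have "(1 + 4 * l) ^ 9 * (1 + l) ^ 16 * inverse ((1 + 4 * l) ^ 25) \<le> (1 + 4 * l) ^ 25 * inverse ((1 + 4 * l) ^ 25)"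
      using l by (intro mult_right_mono) auto
    also have "\<dots> = 1" using l by (intro right_inverse) auto
    finally have h: "(1 + 4 * l) ^ 9 * (1 + l) ^ 16 * inverse ((1 + 4 * l) ^ 25) \<le> 1" .
    have "\<bar>\<Sum>D\<in>tuples x T L. weight \<nu> \<alpha> \<beta> D\<bar> \<le> 30 * (1 + 4 * l) ^ 9 * real x * T powr (- 1 / 16) * (1 + l) ^ 16"
      unfolding l_def by (rule linked_sum_le[OF uv T x])
    also have "\<dots> = (30 * real x) * ((1 + 4 * l) ^ 9 * (1 + l) ^ 16 * inverse ((1 + 4 * l) ^ 25))" unfolding Tp by (simp only: mult_ac)
    also have "\<dots> \<le> (30 * real x) * 1" using h by (rule mult_left_mono) simp
    also have "\<dots> \<le> real x * (30 + (1 + ln T) ^ 16)" using lnT0 by (simp add: algebra_simps)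
    finally show ?thesis .
  next
    case False
    have "\<bar>\<Sum>D\<in>tuples x T L. weight \<nu> \<alpha> \<beta> D\<bar> \<le> (\<Sum>D\<in>tuples x T L. \<bar>weight \<nu> \<alpha> \<beta> D\<bar>)" by (rule sum_abs)
    also have "\<dots> \<le> real x * (1 + ln T) ^ 16" using False T by (intro unlinked_sum_le) auto
    also have "\<dots> \<le> real x * (30 + (1 + ln T) ^ 16)" by (intro mult_left_mono) auto
    finally show ?thesis .
  qed
  then have "(\<Sum>L\<in>(UNIV :: idx set set). \<bar>\<Sum>D\<in>tuples x T L. weight \<nu> \<alpha> \<beta> D\<bar>)
      \<le> of_nat (card (UNIV :: idx set set)) * (real x * (30 + (1 + ln T) ^ 16))"
    by (intro sum_bounded_above)
  \<comment> \<open>Any subset of the 16 indices may be the set of large ones, whence 2^16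
    terms.\<close>
  also have "card (UNIV :: idx set set) = 65536" by (simp add: card_UNIV_set)
  finally show ?thesis using sum_Sel_le_tuples[where x = x and \<nu> = \<nu> and \<alpha> = \<alpha> and \<beta> = \<beta> and T = T] unfolding lnT l_def[symmetric] by simp
qed

text \<open>Separates off the even numbers, whose factor 2 is later moved into the parameter
  \<open>\<nu>\<close>. Letting their odd part run up to \<open>x\<close> only enlarges the right
  side.\<close>

lemma sum_sqfree_le:
  fixes g :: "nat \<Rightarrow> nat"
  shows "(\<Sum>n\<in>sqfree_upto x. g n) \<le> (\<Sum>m\<in>oddsqf x. g m + g (2 * m))"
proof -
  have "sqfree_upto x \<subseteq> oddsqf x \<union> (*) 2 ` oddsqf x"
  proof
    fix n assume n: "n \<in> sqfree_upto x"
    show "n \<in> oddsqf x \<union> (*) 2 ` oddsqf x"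
    proof (cases "odd n")
      case True
      then show ?thesis using n by (auto simp: sqfree_upto_def oddsqf_def)
    next
      case False
      then obtain m where m: "n = 2 * m" by blast
      have sq: "squarefree (2 * m)" "n \<le> x" "n \<ge> 1" using n m by (auto simp: sqfree_upto_def)
      have "coprime 2 m" using sq(1) by (rule squarefree_mult_imp_coprime)
      then have "odd m" by simp
      then have "m \<in> oddsqf x" using sq m squarefree_multD[OF sq(1)] by (auto simp: oddsqf_def)
      then show ?thesis using m by blast
    qed
  qed
  then have "(\<Sum>n\<in>sqfree_upto x. g n) \<le> (\<Sum>n\<in>oddsqf x \<union> (*) 2 ` oddsqf x. g n)" by (intro sum_mono2) auto
  also have "\<dots> \<le> (\<Sum>n\<in>oddsqf x. g n) + (\<Sum>n\<in>(*) 2 ` oddsqf x. g n)" by (subst sum.union_inter[symmetric]) auto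
  also have "(\<Sum>n\<in>(*) 2 ` oddsqf x. g n) = (\<Sum>m\<in>oddsqf x. g (2 * m))" by (subst sum.reindex) (auto simp: inj_on_def)
  finally show ?thesis by (simp add: sum.distrib)
qed

text \<open>The 16 pairs of \<open>\<alpha>\<close> and \<open>\<beta>\<close> turn 65536 into
  1048576, and the two cases \<open>\<nu> = \<epsilon>\<close> for odd and
  \<open>\<nu> = 2 * \<epsilon>\<close> for even numbers double it.\<close>

lemma sum_card_formsF_sol_le:
  assumes \<epsilon>: "\<epsilon> \<in> {1, -1}" and x: "x \<ge> 1"
  shows "real (\<Sum>n\<in>sqfree_upto x. card (formsF_sol (3 * (\<epsilon> * int n)) (2 * (\<epsilon> * int n) ^ 2)))
    \<le> real x * (4 + 2097152 * (30 + (1 + 400 * ln (1 + 4 * ln (real x))) ^ 16))"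
proof -
  define V where "V = 30 + (1 + 400 * ln (1 + 4 * ln (real x))) ^ 16"
  define g where "g n = card (formsF_sol (3 * (\<epsilon> * int n)) (2 * (\<epsilon> * int n) ^ 2))" for n
  define h where "h \<nu> m = 2 + (\<Sum>\<alpha>\<in>unit2. \<Sum>\<beta>\<in>unit2. card (Sel \<nu> m \<alpha> \<beta>))" for \<nu> m
  have H: "real (\<Sum>m\<in>oddsqf x. h \<nu> m) \<le> real x * (2 + 1048576 * V)" for \<nu>
  proof -
    have "(\<Sum>m\<in>oddsqf x. h \<nu> m) = 2 * card (oddsqf x) + (\<Sum>m\<in>oddsqf x. \<Sum>\<alpha>\<in>unit2. \<Sum>\<beta>\<in>unit2. card (Sel \<nu> m \<alpha> \<beta>))"
      unfolding h_def sum.distrib by simp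
    also have "(\<Sum>m\<in>oddsqf x. \<Sum>\<alpha>\<in>unit2. \<Sum>\<beta>\<in>unit2. card (Sel \<nu> m \<alpha> \<beta>)) = (\<Sum>\<alpha>\<in>unit2. \<Sum>m\<in>oddsqf x. \<Sum>\<beta>\<in>unit2. card (Sel \<nu> m \<alpha> \<beta>))"
      by (rule sum.swap)
    also have "\<dots> = (\<Sum>\<alpha>\<in>unit2. \<Sum>\<beta>\<in>unit2. \<Sum>m\<in>oddsqf x. card (Sel \<nu> m \<alpha> \<beta>))"
      by (rule sum.cong[OF refl]) (rule sum.swap)
    finally have "real (\<Sum>m\<in>oddsqf x. h \<nu> m)
        = 2 * real (card (oddsqf x)) + (\<Sum>\<alpha>\<in>unit2. \<Sum>\<beta>\<in>unit2. real (\<Sum>m\<in>oddsqf x. card (Sel \<nu> m \<alpha> \<beta>)))" by simp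
    also have "\<dots> \<le> 2 * real x + (\<Sum>\<alpha>\<in>unit2. \<Sum>\<beta>\<in>unit2. 65536 * (real x * V))"
      unfolding V_def by (intro add_mono sum_mono sum_card_Sel_le[OF x]) (use card_oddsqf[of x] in simp)
    also have "\<dots> = real x * (2 + 1048576 * V)" by (simp add: unit2_def algebra_simps)
    finally show ?thesis .
  qed
  have "(\<Sum>n\<in>sqfree_upto x. g n) \<le> (\<Sum>m\<in>oddsqf x. g m + g (2 * m))" by (rule sum_sqfree_le)
  also have "\<dots> \<le> (\<Sum>m\<in>oddsqf x. h \<epsilon> m + h (2 * \<epsilon>) m)"
  proof (intro sum_mono add_mono)
    fix m assume "m \<in> oddsqf x"
    then have m: "odd m" "squarefree m" by (auto simp: oddsqf_def)
    show "g m \<le> h \<epsilon> m" unfolding g_def h_def using \<epsilon> by (intro card_formsF_sol_le m) (auto simp: unit2_def)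
    show "g (2 * m) \<le> h (2 * \<epsilon>) m" unfolding g_def h_def using \<epsilon> by (intro card_formsF_sol_le m) (auto simp: unit2_def)
  qed
  finally have "real (\<Sum>n\<in>sqfree_upto x. g n) \<le> real (\<Sum>m\<in>oddsqf x. h \<epsilon> m) + real (\<Sum>m\<in>oddsqf x. h (2 * \<epsilon>) m)"
    unfolding sum.distrib by (simp only: of_nat_add[symmetric] of_nat_le_iff)
  also have "\<dots> \<le> real x * (2 + 1048576 * V) + real x * (2 + 1048576 * V)" by (intro add_mono H)
  also have "\<dots> = real x * (4 + 2097152 * V)" by (simp add: algebra_simps)
  finally show ?thesis unfolding g_def V_def .
qed

text \<open>The exponent 17 is the first one above the 16 in the bound for soluble forms. The
  quotient therefore decays at least like 1 / log log x.\<close>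

lemma sol_ls_ratio_tendsto:
  assumes \<epsilon>: "\<epsilon> \<in> {1, -1}"
  shows "(\<lambda>x. real (\<Sum>n\<in>sqfree_upto x. card (formsF_sol (3 * (\<epsilon> * int n)) (2 * (\<epsilon> * int n) ^ 2)))
    / real (\<Sum>n\<in>sqfree_upto x. card (formsF_ls (3 * (\<epsilon> * int n)) (2 * (\<epsilon> * int n) ^ 2)))) \<longlonglongrightarrow> 0"
    (is "(\<lambda>x. ?sol x / ?ls x) \<longlonglongrightarrow> 0")
proof -
  obtain c where c: "c > 0" and ev: "eventually (\<lambda>x. (\<Sum>n\<in>sqfree_upto x. 2 ^ omegaQ n :: real) \<ge> c * real x * ln (ln (real x)) ^ 17) sequentially"
    using sum_two_power_omegaQ_ge[of 17] by auto
  define G where "G x = (4 + 2097152 * (30 + (1 + 400 * ln (1 + 4 * ln (real x))) ^ 16)) / ln (ln (real x)) ^ 17" for x :: nat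
  have G0: "G \<longlonglongrightarrow> 0" unfolding G_def by real_asymp
  have "filterlim (\<lambda>x::nat. ln (ln (real x))) at_top sequentially" by real_asymp
  then have evl: "eventually (\<lambda>x::nat. ln (ln (real x)) > 0) sequentially" by (simp add: filterlim_at_top_dense)
  show ?thesis
  proof (rule tendsto_sandwich[where f = "\<lambda>_. 0" and h = "\<lambda>x. 4 / c * G x"])
    show "(\<lambda>x. 4 / c * G x) \<longlonglongrightarrow> 0" using tendsto_mult_right_zero[OF G0, of "4 / c"] .
    show "eventually (\<lambda>x. ?sol x / ?ls x \<le> 4 / c * G x) sequentially"
      using ev evl eventually_ge_at_top[of 1]
    proof eventually_elim
      case (elim x)
      have "(\<Sum>n\<in>sqfree_upto x. 2 ^ omegaQ n) \<le> (\<Sum>n\<in>sqfree_upto x. 4 * card (formsF_ls (3 * (\<epsilon> * int n)) (2 * (\<epsilon> * int n) ^ 2)))"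
        by (intro sum_mono card_formsF_ls_ge[OF _ \<epsilon>] refl) (auto simp: sqfree_upto_def)
      then have "real (\<Sum>n\<in>sqfree_upto x. 2 ^ omegaQ n) \<le> 4 * ?ls x"
        unfolding sum_distrib_left[symmetric] using of_nat_mono by fastforce
      then have ls: "c * real x * ln (ln (real x)) ^ 17 / 4 \<le> ?ls x" using elim(1) by simp
      have pos: "c * real x * ln (ln (real x)) ^ 17 / 4 > 0" using c elim by simp
      have "?sol x / ?ls x \<le> real x * (4 + 2097152 * (30 + (1 + 400 * ln (1 + 4 * ln (real x))) ^ 16))
          / (c * real x * ln (ln (real x)) ^ 17 / 4)"
        using sum_card_formsF_sol_le[OF \<epsilon> elim(3)] ls pos by (intro frac_le) auto
      also have "\<dots> = 4 / c * G x" using elim c unfolding G_def by (simp add: field_simps)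
      finally show ?case .
    qed
    show "eventually (\<lambda>x. 0 \<le> ?sol x / ?ls x) sequentially" by (intro always_eventually allI divide_nonneg_nonneg of_nat_0_le_iff)
  qed simp
qed

theorem theorem5p6:
  shows "((\<lambda>X::real.
            real (\<Sum>n\<in>{n::nat. 0 < n \<and> real n < X \<and> squarefree n}.
                    card (formsF_sol (3 * int n) (2 * int n ^ 2)))
          / real (\<Sum>n\<in>{n::nat. 0 < n \<and> real n < X \<and> squarefree n}.
                    card (formsF_ls (3 * int n) (2 * int n ^ 2))))
          \<longlongrightarrow> 0) at_top
       \<and> ((\<lambda>X::real.
            real (\<Sum>n\<in>{n::nat. 0 < n \<and> real n < X \<and> squarefree n}.
                    card (formsF_sol (- 3 * int n) (2 * int n ^ 2)))
          / real (\<Sum>n\<in>{n::nat. 0 < n \<and> real n < X \<and> squarefree n}.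
                    card (formsF_ls (- 3 * int n) (2 * int n ^ 2))))
          \<longlongrightarrow> 0) at_top"
proof -
  \<comment> \<open>The strict inequality \<open>n < X\<close> with real \<open>X\<close> becomes
    \<open>n \<le> nat \<lceil>X\<rceil> - 1\<close>; for \<open>X \<le> 1\<close> both sides are
    empty.\<close>
  have set_eq: "{n::nat. 0 < n \<and> real n < X \<and> squarefree n} = sqfree_upto (nat \<lceil>X\<rceil> - 1)" for X :: real
  proof -
    have "real n < X \<longleftrightarrow> n \<le> nat \<lceil>X\<rceil> - 1" if "0 < n" for n
      using that by linarith
    then show ?thesis by (auto simp: sqfree_upto_def)
  qed
  have lim: "filterlim (\<lambda>X::real. nat \<lceil>X\<rceil> - 1) at_top at_top"
    unfolding filterlim_at_top
  proof
    fix Z :: nat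
    show "eventually (\<lambda>X::real. Z \<le> nat \<lceil>X\<rceil> - 1) at_top"
      using eventually_gt_at_top[of "real Z + 1"] by eventually_elim linarith
  qed
  show ?thesis
    using filterlim_compose[OF sol_ls_ratio_tendsto[of 1] lim] filterlim_compose[OF sol_ls_ratio_tendsto[of "-1"] lim]
    unfolding set_eq by simp
qed

end
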